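(* Let $C$ be an even positive integer, and let $PQ$ be the largest squarefree divisor of $C$, where $P$ is chosen so that $(C/P)^{1/2}$ is an integer. If the equation $$x^2+C=y^n$$ has a solution $(x,y,n)$ with $x$ and $y$ nonzero integers each divisible by at most one prime, $(x,y)=1$, $n$ a positive integer, and $(|x|,|y|,n)\neq(7,3,4)$, $(|x|,|y|,n)\ne(401,11,5)$, then either $n=3$ or $n\mid N$, where $$N=2\cdot 3^u\, h(-P)\,\left\langle q_1-\left(\frac{-P}{q_1}\right),\dots,q_m-\left(\frac{-P}{q_m}\right)\right\rangle .$$ Here $u=1$ or $0$ according as $3<P\equiv 3 \pmod 8$ or not, and $q_1q_2\cdots q_m=Q$ is the prime factorization of $Q$.
   Context: $(x,y)$ in the condition $(x,y)=1$ denotes the greatest common divisor. $h(-P)$ is the lowest positive integer $h$ such that $\mathfrak a^h$ is principal for every ideal $\mathfrak a$ in (the ring of integers of) $\mathbb Q(\sqrt{-P})$. $\langle a_1,\dots,a_m\rangle$ is the least common multiple of the members of the set $S=\{a_1,\dots,a_m\}$ when $S\neq\emptyset$, and equals $1$ when $S=\emptyset$. $\left(\frac{a}{q}\right)$ is the Legendre symbol for an odd prime $q$, and $\left(\frac{a}{2}\right)=0$. *)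

theory Defs
  imports
    Complex_Main
    "HOL-Computational_Algebra.Computational_Algebra"
    "HOL-Number_Theory.Number_Theory"
    "HOL-Algebra.Ideal_Product"
begin

definition quadratic_field :: "int \<Rightarrow> complex set" where
  "quadratic_field d = {of_rat a + of_rat b * csqrt (of_int d) | a b. True}"

definition ring_of_integers :: "int \<Rightarrow> complex ring" where
  "ring_of_integers d =
     \<lparr>carrier = {z \<in> quadratic_field d. algebraic_int z},
      mult = (*), one = 1, zero = 0, add = (+)\<rparr>"

text \<open>
  \<^term>\<open>h_exp d\<close> is the exponent of the ideal class group of the quadratic field, not its class
  number. The zero ideal is included, which is harmless, since all its positive powers are principal.
\<close>

definition h_exp :: "int \<Rightarrow> nat" where
  "h_exp d = (LEAST h. h > 0 \<and>
     (\<forall>I. ideal I (ring_of_integers d) \<longrightarrow>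
        principalideal (I [^]\<^bsub>ideals_set (ring_of_integers d)\<^esub> h) (ring_of_integers d)))"

text \<open>
  The value at 2 is set to 0 by convention; \<^const>\<open>Legendre\<close> itself gives 1 there for odd \<open>a\<close>.
\<close>

definition legendre0 :: "int \<Rightarrow> nat \<Rightarrow> int" where
  "legendre0 a q = (if q = 2 then 0 else Legendre a (int q))"

text \<open>
  In the last factor, \<^const>\<open>Lcm\<close> of the empty set (the case \<open>Q = 1\<close>) is 1.
\<close>

definition N_bound :: "nat \<Rightarrow> nat \<Rightarrow> int" where
  "N_bound P Q =
     2 * 3 ^ (if 3 < P \<and> [P = 3] (mod 8) then 1 else 0) * int (h_exp (- int P)) *
     Lcm ((\<lambda>q. int q - legendre0 (- int P) q) ` prime_factors Q)"

end

theory Submission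
  imports Defs "HOL-Analysis.Kronecker_Approximation_Theorem"
begin

text \<open>
  Let \<open>\<bar>y\<bar> = p ^ k\<close>, \<open>m = k * n\<close> and \<open>C = P * D\<^sup>2\<close>, so that \<open>x\<^sup>2 + P * D\<^sup>2 = p ^ m\<close>, and put \<open>z =
  x + D * sqrt (- P)\<close>. Since \<open>p\<close> does not divide \<open>2 * x\<close>, the element \<open>z\<close> generates the \<open>m\<close>-th
  power of the ideal \<open>(p, z)\<close> of the ring of integers. If \<open>H\<close> is the exponent of the class group,
  the \<open>H\<close>-th power of that ideal is principal too, and combining the two principal powers gives,
  for a divisor \<open>d\<close> of \<open>H\<close>, an algebraic integer whose power of exponent \<open>m / d\<close> is a unit
  multiple of \<open>z\<close> (\<open>root_of_prime_power_norm\<close>); the unit can be reduced to a sign. For each prime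
  \<open>q\<close> dividing \<open>Q\<close>, the Frobenius congruence shows that raising to the power \<open>q - (-P / q)\<close> makes
  the coefficient of \<open>sqrt (- P)\<close> divisible by \<open>q\<close> (\<open>rank_of_apparition\<close>). As \<open>Q\<close> divides \<open>D\<close> as
  well, a second Bezout argument produces \<open>A + B * sqrt (- P)\<close> with \<open>Q\<close> dividing \<open>B\<close>, whose \<open>s\<close>-th
  power is \<open>\<plusminus> z\<close>, where \<open>m = T * s\<close> and \<open>2 * T\<close> divides the number \<open>N\<close> of the theorem
  (\<open>root_in_order\<close>). So everything is fine unless \<open>s\<close> has a factor \<open>4\<close> or an odd prime factor \<open>r\<close>
  (\<open>exponent_bound\<close>).

  Put \<open>w = P * B\<^sup>2\<close>, an even number, and \<open>M = A\<^sup>2 + w\<close>, a power of \<open>p\<close>. Replacing \<open>A + B * sqrt (-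
  P)\<close> by a power, one may assume \<open>s = 4\<close> or \<open>s = r\<close>. Then \<open>D / B\<close> is a Lucas number all of whose
  prime factors divide \<open>C\<close>, which leaves \<open>\<plusminus> 1\<close> or \<open>\<plusminus> r\<close> for it when \<open>s = r \<ge> 5\<close>, and \<open>x / A\<close> is an
  integer sharing at most the prime \<open>r\<close> with \<open>A\<close>. Because \<open>x\<close> has only one prime factor, one of
  \<open>A\<close> and \<open>x / A\<close> is trivial, and comparing sizes leaves \<open>A = \<plusminus> 1\<close>. The case \<open>\<plusminus> r\<close> gives \<open>401\<^sup>2 +
  250 = 11 ^ 5\<close>, the case \<open>s = 4\<close> gives \<open>7\<^sup>2 + 32 = 3 ^ 4\<close>. For \<open>r = 3\<close> the same reasoning leads
  to \<open>M = 3\<close>, \<open>M = 5\<close> or \<open>M = 3 ^ j + 4\<close>; in the last case \<open>M\<close> is again prime, because of the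
  arithmetic of \<open>x\<^sup>2 + y\<^sup>2\<close> and \<open>x\<^sup>2 + 3 * y\<^sup>2\<close> (\<open>power_of_3_plus_4\<close>). In each of these cases \<open>m\<close>
  is \<open>3\<close>, \<open>4\<close> or \<open>5\<close>.

  The hardest part is that \<open>(1 + sqrt (- w)) ^ r\<close> cannot have \<open>\<plusminus> 1\<close> as coefficient of \<open>sqrt (- w)\<close>
  for odd \<open>r \<ge> 5\<close>. This coefficient, as a function of the exponent, is injective on every residue
  class modulo \<open>4\<close> for 2-adic reasons (\<open>qim_inj_mod4\<close>), which handles \<open>r\<close> congruent to \<open>1\<close> modulo
  \<open>4\<close> and small \<open>w\<close>. The value \<open>1\<close> forces \<open>r\<close> to be too close to \<open>1\<close> in the \<open>l\<close>-adic sense for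
  every odd prime \<open>l\<close> dividing \<open>w\<close>, except for \<open>l = 3\<close> when \<open>9\<close> does not divide \<open>w\<close>, so that only
  \<open>w = 2\<close> and \<open>w = 6\<close> survive (\<open>qim_neq_1\<close>). The value \<open>- 1\<close> gives \<open>r\<close> congruent to \<open>- 1\<close> modulo
  \<open>M - 1\<close> and \<open>2 ^ (r - 1)\<close> congruent to \<open>- 1\<close> modulo \<open>M\<close>; as \<open>M\<close> is a power of \<open>p\<close>, Fermat's
  theorem forces \<open>p = 5\<close>, and the powers of \<open>5\<close> are excluded by a computation modulo \<open>601\<close>
  (\<open>qim_neq_minus_1\<close>).
\<close>

section \<open>Powers of a quadratic irrationality and their 2-adic behaviour\<close>

text \<open>
  With \<open>\<theta> = sqrt (- w)\<close>, these are the integers in \<open>(A + \<theta>) ^ n = qre A w n + qim A w n * \<theta>\<close>.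
  Keeping them as integer sequences in which only \<open>w = P * B\<^sup>2\<close> enters makes congruences modulo
  \<open>w\<close>, \<open>A\<close> and prime powers directly available.
\<close>

fun qre :: "int \<Rightarrow> int \<Rightarrow> nat \<Rightarrow> int" and qim :: "int \<Rightarrow> int \<Rightarrow> nat \<Rightarrow> int" where
  "qre A w 0 = 1"
| "qre A w (Suc n) = A * qre A w n - w * qim A w n"
| "qim A w 0 = 0"
| "qim A w (Suc n) = A * qim A w n + qre A w n"

lemma qre_qim_add:
  "qre A w (m + n) = qre A w m * qre A w n - w * qim A w m * qim A w n"
  "qim A w (m + n) = qre A w m * qim A w n + qim A w m * qre A w n"
proof -
  have "qre A w (m + n) = qre A w m * qre A w n - w * qim A w m * qim A w n
      \<and> qim A w (m + n) = qre A w m * qim A w n + qim A w m * qre A w n"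
  proof (induction m)
    case (Suc m)
    hence IH: "qre A w (m + n) = qre A w m * qre A w n - w * qim A w m * qim A w n"
      "qim A w (m + n) = qre A w m * qim A w n + qim A w m * qre A w n" by blast+
    show ?case unfolding add_Suc qre.simps qim.simps IH by (simp add: algebra_simps)
  qed auto
  thus "qre A w (m + n) = qre A w m * qre A w n - w * qim A w m * qim A w n"
    "qim A w (m + n) = qre A w m * qim A w n + qim A w m * qre A w n" by blast+
qed

lemma qre_qim_norm: "(qre A w n)\<^sup>2 + w * (qim A w n)\<^sup>2 = (A\<^sup>2 + w) ^ n"
proof (induction n)
  case (Suc n)
  have "(qre A w (Suc n))\<^sup>2 + w * (qim A w (Suc n))\<^sup>2
      = (A\<^sup>2 + w) * ((qre A w n)\<^sup>2 + w * (qim A w n)\<^sup>2)"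
    by (simp add: algebra_simps power2_eq_square)
  thus ?case using Suc by simp
qed auto

text \<open>
  Composition of powers: the \<open>m\<close>-th power is again of the form \<open>A' + \<theta>'\<close>, with \<open>\<theta>'\<^sup>2 = - w * (qim
  A w m)\<^sup>2\<close>. This is what reduces a composite exponent to a prime one.
\<close>

lemma qre_qim_mult:
  "qre A w (m * n) = qre (qre A w m) (w * (qim A w m)\<^sup>2) n"
  "qim A w (m * n) = qim A w m * qim (qre A w m) (w * (qim A w m)\<^sup>2) n"
  by (induction n) (auto simp: algebra_simps qre_qim_add power2_eq_square)

lemma qim_cong_w: "w dvd qim A w (Suc n) - int (Suc n) * A ^ n \<and> w dvd qre A w n - A ^ n"
proof (induction n)
  case (Suc n)
  then obtain k l where k: "qim A w (Suc n) = int (Suc n) * A ^ n + w * k"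
    and l: "qre A w n = A ^ n + w * l"
    by (metis add.commute diff_add_cancel dvdE)
  have l': "qre A w (Suc n) = A ^ Suc n + w * (A * l - qim A w n)"
    using l by (simp add: algebra_simps)
  have "qim A w (Suc (Suc n)) = A * qim A w (Suc n) + qre A w (Suc n)" by simp
  also have "\<dots> = int (Suc (Suc n)) * A ^ Suc n + w * (A * k + (A * l - qim A w n))"
    unfolding k l' by (simp add: algebra_simps)
  finally show ?case using l' by (metis add_diff_cancel_left' dvd_triv_left)
qed auto

text \<open>
  For odd exponents \<open>A\<close> divides the real part, and the quotient is known modulo \<open>A\<^sup>2\<close>; only the
  prime factors of the exponent and of \<open>w\<close> can be common to \<open>A\<close> and the quotient.
\<close>

lemma qre_qim_odd_cong:
  "A ^ 3 dvd qre A w (2 * k + 1) - int (2 * k + 1) * A * (- w) ^ k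
   \<and> A\<^sup>2 dvd qim A w (2 * k + 1) - (- w) ^ k"
proof (induction k)
  case (Suc k)
  let ?R = "qre A w (2 * k + 1)" and ?U = "qim A w (2 * k + 1)"
  obtain a b where a: "?R = int (2 * k + 1) * A * (- w) ^ k + A ^ 3 * a"
    and b: "?U = (- w) ^ k + A\<^sup>2 * b"
    using Suc by (metis add.commute diff_add_cancel dvdE)
  have R': "qre A w (2 * Suc k + 1) = (A\<^sup>2 - w) * ?R - 2 * w * A * ?U"
    by (simp add: algebra_simps power2_eq_square)
  have U': "qim A w (2 * Suc k + 1) = (A\<^sup>2 - w) * ?U + 2 * A * ?R"
    by (simp add: algebra_simps power2_eq_square)
  have 1: "qre A w (2 * Suc k + 1) - int (2 * Suc k + 1) * A * (- w) ^ Suc k =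
        A ^ 3 * (int (2 * k + 1) * (- w) ^ k + A\<^sup>2 * a - w * a - 2 * w * b)"
    unfolding R' a b by (simp add: algebra_simps power2_eq_square power3_eq_cube)
  have 2: "qim A w (2 * Suc k + 1) - (- w) ^ Suc k =
        A\<^sup>2 * ((- w) ^ k + A\<^sup>2 * b - w * b + 2 * (int (2 * k + 1) * (- w) ^ k + A\<^sup>2 * a))"
    unfolding U' a b by (simp add: algebra_simps power2_eq_square power3_eq_cube)
  show ?case unfolding 1 2 by simp
qed auto

text \<open>
  The binomial expansion up to \<open>w\<^sup>2\<close>. It is multiplied by a power of \<open>A\<close> in order to avoid the
  exponents \<open>n - 2\<close> and \<open>n - 3\<close>, which are truncated for small \<open>n\<close>; \<open>A\<close> will be invertible for the
  moduli of interest.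
\<close>

lemma qre_qim_expand2:
  "w\<^sup>2 dvd A\<^sup>2 * qre A w n - A ^ n * (A\<^sup>2 - int (n choose 2) * w) \<and>
   w\<^sup>2 dvd A ^ 3 * qim A w n - A ^ n * (int n * A\<^sup>2 - int (n choose 3) * w)"
proof (induction n)
  case (Suc n)
  obtain a b where a: "A\<^sup>2 * qre A w n = A ^ n * (A\<^sup>2 - int (n choose 2) * w) + w\<^sup>2 * a"
    and b: "A ^ 3 * qim A w n = A ^ n * (int n * A\<^sup>2 - int (n choose 3) * w) + w\<^sup>2 * b"
    using Suc by (metis add.commute diff_add_cancel dvdE)
  have c2: "Suc n choose 2 = n + (n choose 2)" by (simp add: numeral_2_eq_2)
  have c3: "Suc n choose 3 = (n choose 2) + (n choose 3)"
    by (simp add: numeral_3_eq_3 numeral_2_eq_2)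
  have q: "w\<^sup>2 dvd A\<^sup>2 * w * qim A w n - A ^ n * (int n * A * w)"
  proof -
    have "w dvd A * qim A w n - int n * A ^ n"
    proof (cases n)
      case (Suc m)
      have "w dvd A * (qim A w (Suc m) - int (Suc m) * A ^ m)"
        using qim_cong_w[of w A m] by (simp del: qim.simps)
      thus ?thesis using Suc by (simp add: algebra_simps)
    qed auto
    hence "w * w dvd (A * w) * (A * qim A w n - int n * A ^ n)"
      by (metis dvd_refl dvd_triv_right mult_dvd_mono)
    thus ?thesis by (simp add: algebra_simps power2_eq_square)
  qed
  then obtain c where c: "A\<^sup>2 * w * qim A w n = A ^ n * (int n * A * w) + w\<^sup>2 * c"
    by (metis add.commute diff_add_cancel dvdE)
  have "A\<^sup>2 * qre A w (Suc n) = A * (A\<^sup>2 * qre A w n) - A\<^sup>2 * w * qim A w n"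
    by (simp add: algebra_simps)
  also have "\<dots> = A ^ Suc n * (A\<^sup>2 - int (Suc n choose 2) * w) + w\<^sup>2 * (A * a - c)"
    unfolding a c c2 by (simp add: algebra_simps)
  finally have 1: "w\<^sup>2 dvd A\<^sup>2 * qre A w (Suc n) - A ^ Suc n * (A\<^sup>2 - int (Suc n choose 2) * w)"
    by simp
  have "A ^ 3 * qim A w (Suc n) = A * (A ^ 3 * qim A w n) + A * (A\<^sup>2 * qre A w n)"
    by (simp add: algebra_simps power3_eq_cube power2_eq_square)
  also have "\<dots> = A ^ Suc n * (int (Suc n) * A\<^sup>2 - int (Suc n choose 3) * w) + w\<^sup>2 * (A * a + A * b)"
    unfolding a b c3 by (simp add: algebra_simps)
  finally have 2: "w\<^sup>2 dvd A ^ 3 * qim A w (Suc n) - A ^ Suc n * (int (Suc n) * A\<^sup>2 - int (Suc n choose 3) * w)"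
    by simp
  show ?case using 1 2 by blast
qed (auto simp: numeral_2_eq_2 numeral_3_eq_3)

lemma qre_qim_expand3:
  "\<exists>a b. qre 1 w n = 1 - int (n choose 2) * w + int (n choose 4) * w\<^sup>2 + w ^ 3 * a \<and>
   qim 1 w n = int n - int (n choose 3) * w + int (n choose 5) * w\<^sup>2 + w ^ 3 * b"
proof (induction n)
  case 0
  show ?case by (rule exI[of _ 0], rule exI[of _ 0]) (auto simp: numeral_eq_Suc)
next
  case (Suc n)
  then obtain a b where ab: "qre 1 w n = 1 - int (n choose 2) * w + int (n choose 4) * w\<^sup>2 + w ^ 3 * a"
   "qim 1 w n = int n - int (n choose 3) * w + int (n choose 5) * w\<^sup>2 + w ^ 3 * b" by blast
  have c: "Suc n choose 2 = n + (n choose 2)" "Suc n choose 3 = (n choose 2) + (n choose 3)"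
    "Suc n choose 4 = (n choose 3) + (n choose 4)" "Suc n choose 5 = (n choose 4) + (n choose 5)"
    by (simp_all add: numeral_eq_Suc)
  show ?case
    by (rule exI[of _ "a - w * b - int (n choose 5)"], rule exI[of _ "a + b"])
       (simp add: ab c algebra_simps power2_eq_square power3_eq_cube)
qed

lemma odd_qre: "even w \<Longrightarrow> odd A \<Longrightarrow> odd (qre A w n)"
  by (induction n) auto

text \<open>
  By repeated squaring from \<open>(1 + \<theta>) ^ 4\<close>, which is \<open>1 + 4 * \<theta>\<close> modulo \<open>8\<close> for even \<open>w\<close>. Multiples
  of \<open>2\<close> alone would not do, since the square of \<open>1 + \<theta>\<close> is in general not \<open>1 + 2 * \<theta>\<close> modulo \<open>4\<close>.
\<close>

lemma qre_qim_cong_pow2: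
  assumes "even w" "2 ^ (e + 2) dvd m"
  shows "2 ^ (e + 3) dvd qre 1 w m - 1 \<and> 2 ^ (e + 3) dvd qim 1 w m - int m"
  using assms(2)
proof (induction e arbitrary: m)
  case 0
  then obtain k where m: "m = 4 * k" by auto
  obtain v where v: "w = 2 * v" using assms by auto
  \<comment> \<open>\<open>(1 + \<theta>) ^ 4 = 1 + 4 * (v * (v - 3)) + (4 - 8 * v) * \<theta>\<close> for \<open>w = 2 * v\<close>\<close>
  have even_v: "even (v * (v - 3))" by simp
  then obtain t where t: "v * (v - 3) = 2 * t" by (rule evenE)
  have r4: "qre 1 w 4 = 1 + 8 * t" and i4: "qim 1 w 4 = 4 - 8 * v"
    using t v by (simp_all add: numeral_eq_Suc algebra_simps)
  have "8 dvd qre 1 w (4 * k) - 1 \<and> 8 dvd qim 1 w (4 * k) - 4 * int k"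
  proof (induction k)
    case (Suc k)
    then obtain a b where a: "qre 1 w (4 * k) = 1 + 8 * a" and b: "qim 1 w (4 * k) = 4 * int k + 8 * b"
      by (metis add.commute diff_add_cancel dvdE)
    have e: "4 * Suc k = 4 * k + 4" by simp
    have 1: "qre 1 w (4 * Suc k) - 1 = 8 * (a + t + 8 * a * t - v * (4 * int k + 8 * b) * (1 - 2 * v))"
      unfolding e qre_qim_add a b r4 i4 by (simp add: v algebra_simps)
    have 2: "qim 1 w (4 * Suc k) - 4 * int (Suc k)
       = 8 * (4 * a - v - 8 * a * v + b + 4 * int k * t + 8 * b * t)"
      unfolding e qre_qim_add a b r4 i4 by (simp add: v algebra_simps)
    show ?case unfolding 1 2 by simp
  qed auto
  thus ?case using m by simp
next
  case (Suc e)
  then obtain n where m: "m = n * 2" and n: "2 ^ (e + 2) dvd n"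
    by (auto simp: dvd_def)
  let ?q = "2 ^ (e + 2) :: int"
  obtain a b where a: "qre 1 w n = 1 + 2 * ?q * a" and b: "qim 1 w n = int n + 2 * ?q * b"
  proof -
    have "2 * ?q = 2 ^ (e + 3)" by (simp add: power_add)
    thus ?thesis using Suc.IH[OF n] that by (metis add.commute diff_add_cancel dvdE)
  qed
  obtain k where k: "int n = ?q * k" using n by (metis dvd_def of_nat_dvd_iff of_nat_numeral of_nat_power)
  obtain v where v: "w = 2 * v" using assms by auto
  have q4: "?q = 4 * 2 ^ e" by simp
  have 1: "qre 1 w m - 1 = 4 * ?q * (a + ?q * a\<^sup>2 - 2 * 2 ^ e * v * (k + 2 * b)\<^sup>2)"
    unfolding m mult_2_right qre_qim_add a b k q4
    by (simp add: v algebra_simps power2_eq_square)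
  have 2: "qim 1 w m - int m = 4 * ?q * (b + ?q * a * k + 2 * ?q * a * b)"
    unfolding m mult_2_right qre_qim_add a b of_nat_add k q4
    by (simp add: v algebra_simps power2_eq_square)
  have "(2::int) ^ (Suc e + 3) = 4 * ?q" by (simp add: power_add)
  thus ?case unfolding 1 2 by simp
qed

lemma qim_cong_mod4:
  assumes "even w" "n = j + 4 * k"
  shows "4 dvd qim 1 w n - qim 1 w j"
proof -
  have "8 dvd qre 1 w (4 * k) - 1" "8 dvd qim 1 w (4 * k) - int (4 * k)"
    using qre_qim_cong_pow2[of w 0 "4 * k"] assms by auto
  then obtain a b where a: "qre 1 w (4 * k) = 1 + 8 * a" and b: "qim 1 w (4 * k) = int (4 * k) + 8 * b"
      by (metis add.commute diff_add_cancel dvdE)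
  have "qim 1 w n - qim 1 w j = 4 * (qre 1 w j * (int k + 2 * b) + 2 * qim 1 w j * a)"
    unfolding assms(2) qre_qim_add a b by (simp add: algebra_simps)
  thus ?thesis by simp
qed

text \<open>
  If \<open>2 ^ e\<close> is the exact power of \<open>2\<close> in \<open>n - j\<close>, then passing from the exponent \<open>j\<close> to \<open>n\<close>
  changes the coefficient by \<open>2 ^ e\<close> times an odd number modulo \<open>2 ^ (e + 1)\<close>.
\<close>

lemma qim_inj_mod4:
  assumes "even w" "n = j + 4 * k" "k > 0"
  shows "qim 1 w n \<noteq> qim 1 w j"
proof
  assume eq: "qim 1 w n = qim 1 w j"
  define m where "m = 4 * k"
  have m0: "m > 0" using assms by (simp add: m_def)
  define e where "e = multiplicity 2 m"
  have m_div: "2 ^ e dvd m" unfolding e_def by (rule multiplicity_dvd)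
  have m_ndiv: "\<not> 2 ^ Suc e dvd m" unfolding e_def
    using m0 by (subst power_dvd_iff_le_multiplicity) auto
  have "2 ^ 2 dvd m" by (simp add: m_def)
  hence e2: "e \<ge> 2" unfolding e_def using m0 by (subst (asm) power_dvd_iff_le_multiplicity) auto
  then obtain f where f: "e = f + 2" by (metis le_add_diff_inverse2)
  have "2 ^ (f + 3) dvd qre 1 w m - 1" "2 ^ (f + 3) dvd qim 1 w m - int m"
    using qre_qim_cong_pow2[OF assms(1), of f m] m_div f by auto
  then obtain a b where a: "qre 1 w m = 1 + 2 ^ (f + 3) * a" and b: "qim 1 w m = int m + 2 ^ (f + 3) * b"
      by (metis add.commute diff_add_cancel dvdE)
  have "0 = qim 1 w n - qim 1 w j" using eq by simp
  also have "\<dots> = qre 1 w j * int m + 2 ^ (f + 3) * (qre 1 w j * b + qim 1 w j * a)"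
    unfolding assms(2) m_def[symmetric] qre_qim_add a b by (simp add: algebra_simps)
  finally have "qre 1 w j * int m = 2 ^ (f + 3) * - (qre 1 w j * b + qim 1 w j * a)"
    by (simp only: mult_minus_right eq_neg_iff_add_eq_0)
  hence "2 ^ (f + 3) dvd qre 1 w j * int m" by (metis dvd_triv_left)
  moreover have "coprime (2 ^ (f + 3)) (qre 1 w j)" using odd_qre[OF assms(1), of 1 j] by simp
  ultimately have "2 ^ (f + 3) dvd int m" by (simp add: coprime_dvd_mult_right_iff)
  hence "2 ^ (f + 3) dvd m" by (metis of_nat_dvd_iff of_nat_numeral of_nat_power)
  moreover have "Suc e = f + 3" using f by simp
  ultimately show False using m_ndiv by metis
qed

lemma prime_dvd_choose_int:
  assumes "prime l" "0 < k" "k < l" shows "int l dvd int (l choose k)"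
  using dvd_choose_prime[of k l] assms by simp

text \<open>
  In the expansion up to \<open>w\<^sup>2\<close> the second term carries one factor \<open>l\<close> from the binomial
  coefficient and one from \<open>w\<close>. This needs \<open>l \<noteq> 3\<close>, because \<open>3 choose 3 = 1\<close>.
\<close>

lemma qim_prime_cong_sq:
  assumes "prime l" "l > 3" "int l dvd w" "coprime (int l) A"
  shows "(int l)\<^sup>2 dvd qim A w l - int l * A ^ (l - 1)"
proof -
  have "w\<^sup>2 dvd A ^ 3 * qim A w l - A ^ l * (int l * A\<^sup>2 - int (l choose 3) * w)"
    using qre_qim_expand2 by blast
  moreover have "(int l)\<^sup>2 dvd w\<^sup>2" using assms by (intro dvd_power_same)
  ultimately have 1: "(int l)\<^sup>2 dvd A ^ 3 * qim A w l - A ^ l * (int l * A\<^sup>2 - int (l choose 3) * w)"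
    using dvd_trans by blast
  have "(int l)\<^sup>2 dvd int (l choose 3) * w"
    unfolding power2_eq_square using assms by (intro mult_dvd_mono prime_dvd_choose_int) auto
  hence "(int l)\<^sup>2 dvd A ^ l * (int (l choose 3) * w)" by simp
  from dvd_diff[OF 1 this]
  have "(int l)\<^sup>2 dvd A ^ 3 * qim A w l - A ^ l * (int l * A\<^sup>2)" by (simp add: algebra_simps)
  also have "A ^ 3 * qim A w l - A ^ l * (int l * A\<^sup>2) = A ^ 3 * (qim A w l - int l * A ^ (l - 1))"
  proof -
    have "A ^ l = A * A ^ (l - 1)" using assms by (simp add: power_eq_if)
    thus ?thesis by (simp add: algebra_simps power2_eq_square power3_eq_cube)
  qed
  finally show ?thesis using assms(4) by (simp add: coprime_dvd_mult_right_iff)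
qed

section \<open>Powers of 1 + sqrt (- w) in which sqrt (- w) has coefficient 1\<close>

lemma pow_cong_1_lift:
  fixes A :: int
  assumes "int l ^ Suc f dvd A - 1"
  shows "int l ^ Suc (Suc f) dvd A ^ l - 1"
proof -
  have "int l dvd A - 1" using assms by (meson dvd_power dvd_trans zero_less_Suc)
  hence c: "[A = 1] (mod int l)" by (simp add: cong_iff_dvd_diff)
  have "[(\<Sum>i<l. A ^ i) = (\<Sum>i<l. 1 ^ i)] (mod int l)"
    by (intro cong_sum cong_pow c)
  hence "int l dvd (\<Sum>i<l. A ^ i)" by (simp add: cong_dvd_iff)
  hence "int l ^ Suc f * int l dvd (A - 1) * (\<Sum>i<l. A ^ i)"
    using assms by (intro mult_dvd_mono)
  also have "(A - 1) * (\<Sum>i<l. A ^ i) = A ^ l - 1" by (simp add: power_diff_1_eq)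
  finally show ?thesis by (simp add: mult_ac)
qed

text \<open>
  The analogue of \<open>qre_qim_cong_pow2\<close> for odd \<open>l\<close>, by induction on the power of \<open>l\<close>. For \<open>l = 3\<close>
  the term \<open>(3 choose 3) * w\<close> is divisible by \<open>9\<close> only if \<open>w\<close> is, whence the extra hypothesis.
\<close>

lemma qre_qim_cong_prime_pow:
  assumes l: "prime l" "l > 2" "int l dvd w" "l = 3 \<Longrightarrow> 9 dvd w" and n: "l ^ f dvd n"
  shows "int l ^ Suc f dvd qre 1 w n - 1 \<and> int l ^ Suc f dvd qim 1 w n - int n"
  using n
proof (induction f arbitrary: n)
  case 0
  have "w dvd qre 1 w n - 1" using qim_cong_w[of w 1 n] by simp
  moreover have "w dvd qim 1 w n - int n"
    using qim_cong_w[of w 1 "n - 1"] by (cases n) (auto simp del: qim.simps(2))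
  ultimately show ?case using l(3) dvd_trans by auto
next
  case (Suc f)
  let ?L = "int l"
  obtain k where n': "n = (l ^ f * k) * l" using Suc.prems by (auto simp: dvd_def mult_ac)
  define m where "m = l ^ f * k"
  have n: "n = m * l" by (simp add: n' m_def)
  define A where "A = qre 1 w m" define U where "U = qim 1 w m" define v where "v = w * U\<^sup>2"
  have IH: "?L ^ Suc f dvd A - 1" "?L ^ Suc f dvd U - int m"
    using Suc.IH[of m] by (auto simp: m_def A_def U_def)
  then obtain b where b: "U = int m + ?L ^ Suc f * b" by (metis add.commute diff_add_cancel dvdE)
  have mk: "int m = ?L ^ f * int k" by (simp add: m_def)
  have U2: "U = ?L ^ f * (int k + ?L * b)" unfolding b mk by (simp add: algebra_simps)
  have lA: "?L dvd A - 1" using IH(1) by (meson dvd_power dvd_trans zero_less_Suc)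
  have cop: "coprime ?L A"
  proof -
    have "[A = 1] (mod ?L)" using lA by (simp add: cong_iff_dvd_diff)
    thus ?thesis by (metis cong_imp_coprime cong_sym coprime_1_left coprime_commute)
  qed
  have lA2: "?L\<^sup>2 dvd ?L * A ^ (l - 1) - ?L"
  proof -
    have "?L dvd A ^ (l - 1) - 1"
      using lA by (metis cong_iff_dvd_diff cong_pow power_one)
    hence "?L * ?L dvd ?L * (A ^ (l - 1) - 1)" by (intro mult_dvd_mono) auto
    thus ?thesis by (simp add: power2_eq_square algebra_simps)
  qed
  have V: "?L\<^sup>2 dvd qim A v l - ?L"
  proof (cases "l = 3")
    case True
    have "v dvd qim A v l - ?L * A ^ (l - 1)" using qim_cong_w[of v A "l - 1"] l by (simp del: qim.simps)
    moreover have "?L\<^sup>2 dvd v" using l(4) True by (simp add: v_def)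
    ultimately have "?L\<^sup>2 dvd qim A v l - ?L * A ^ (l - 1)" using dvd_trans by blast
    from dvd_add[OF this lA2] show ?thesis by simp
  next
    case False
    hence "?L\<^sup>2 dvd qim A v l - ?L * A ^ (l - 1)"
      using l cop by (intro qim_prime_cong_sq) (auto simp: v_def)
    from dvd_add[OF this lA2] show ?thesis by simp
  qed
  then obtain c where c: "qim A v l = ?L + ?L\<^sup>2 * c" by (metis add.commute diff_add_cancel dvdE)
  have "qim 1 w n - int n = U * qim A v l - int m * ?L"
    unfolding n qre_qim_mult by (simp add: A_def U_def v_def)
  also have "\<dots> = ?L ^ Suc (Suc f) * (int k * c + b + ?L * b * c)"
    unfolding c U2 mk by (simp add: algebra_simps power2_eq_square)
  finally have 1: "?L ^ Suc (Suc f) dvd qim 1 w n - int n" by simp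
  have lv: "?L ^ Suc f dvd v"
  proof -
    have "?L * ?L ^ f dvd w * U\<^sup>2" using l(3) U2
      by (intro mult_dvd_mono) (auto simp: power2_eq_square)
    thus ?thesis by (simp add: v_def)
  qed
  have "?L ^ Suc (Suc f) dvd v\<^sup>2"
  proof -
    have "?L ^ Suc (Suc f) dvd ?L ^ (Suc f + Suc f)" by (intro le_imp_power_dvd) simp
    also have "\<dots> dvd v * v" unfolding power_add by (intro mult_dvd_mono lv)
    finally show ?thesis by (simp add: power2_eq_square)
  qed
  moreover have "v\<^sup>2 dvd A\<^sup>2 * qre A v l - A ^ l * (A\<^sup>2 - int (l choose 2) * v)"
    using qre_qim_expand2 by blast
  ultimately have 2: "?L ^ Suc (Suc f) dvd A\<^sup>2 * qre A v l - A ^ l * (A\<^sup>2 - int (l choose 2) * v)"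
    using dvd_trans by blast
  have "?L * ?L ^ Suc f dvd int (l choose 2) * v"
    using l by (intro mult_dvd_mono prime_dvd_choose_int lv) auto
  hence 3: "?L ^ Suc (Suc f) dvd A ^ l * (int (l choose 2) * v)" by simp
  from dvd_diff[OF 2 3] have "?L ^ Suc (Suc f) dvd A\<^sup>2 * (qre A v l - A ^ l)"
    by (simp add: algebra_simps)
  hence "?L ^ Suc (Suc f) dvd qre A v l - A ^ l"
    using cop by (simp add: coprime_dvd_mult_right_iff)
  from dvd_add[OF this pow_cong_1_lift[OF IH(1)]]
  have "?L ^ Suc (Suc f) dvd qre A v l - 1" by simp
  moreover have "qre 1 w n = qre A v l" unfolding n qre_qim_mult by (simp add: A_def U_def v_def)
  ultimately show ?case using 1 by simp
qed

text \<open>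
  For \<open>r\<close> congruent to \<open>1\<close> modulo \<open>4\<close> compare with exponent \<open>1\<close>. Otherwise \<open>w\<close> is twice an odd
  number. If \<open>l\<close> is an odd prime dividing \<open>w\<close> (with \<open>9\<close> dividing \<open>w\<close> if \<open>l = 3\<close>) and \<open>l ^ f\<close> is
  the exact power in \<open>r - 1\<close>, then the coefficient is \<open>r\<close> modulo \<open>l ^ (f + 1)\<close>, hence not \<open>1\<close>.
  What remains is \<open>w = 2\<close>, where exponent \<open>3\<close> already has coefficient \<open>1\<close>, and \<open>w = 6\<close>, which is
  impossible modulo \<open>5\<close>.
\<close>

lemma qim_neq_1:
  assumes "even w" "w > 0" "odd r" "r \<ge> 5" "qim 1 w r = 1"
  shows False
proof (cases "r mod 4 = 1")
  case True
  then obtain k where k: "r = 1 + 4 * k" by (metis mod_mult_div_eq)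
  thus False using qim_inj_mod4[OF assms(1) k] assms by auto
next
  case False
  hence "r mod 4 = 3" using assms(3) by presburger
  then obtain k where k: "r = 3 + 4 * k" by (metis mod_mult_div_eq)
  have q3: "qim 1 w 3 = 3 - w" by (simp add: numeral_3_eq_3)
  have "4 dvd w - 2" using qim_cong_mod4[OF assms(1) k] assms(5) q3 by simp
  then obtain u where "w - 2 = 4 * u" by auto
  then obtain v where v: "w = 2 * v" "odd v" using that[of "2 * u + 1"] by auto
  have no: False if l: "prime l" "l > 2" "int l dvd w" "l = 3 \<Longrightarrow> 9 dvd w" for l
  proof -
    define f where "f = multiplicity l (r - 1)"
    have "l ^ f dvd r - 1" unfolding f_def by (rule multiplicity_dvd)
    from qre_qim_cong_prime_pow[OF l this]
    have "int l ^ Suc f dvd (qre 1 w (r - 1) - 1) + (qim 1 w (r - 1) - int (r - 1))"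
      by (intro dvd_add) blast+
    also have "\<dots> = - int (r - 1)"
    proof -
      have "qim 1 w r = qim 1 w (r - 1) + qre 1 w (r - 1)" using assms(4) by (cases r) auto
      thus ?thesis using assms by simp
    qed
    finally have "l ^ Suc f dvd r - 1" by (metis dvd_minus_iff of_nat_dvd_iff of_nat_power)
    moreover have "r - 1 \<noteq> 0" using assms by simp
    ultimately have "Suc f \<le> f" unfolding f_def using l
      by (subst (asm) power_dvd_iff_le_multiplicity) auto
    thus False by simp
  qed
  have vpos: "v > 0" using v assms by simp
  have "v = 1 \<or> v = 3"
  proof (cases "3 dvd v")
    case True
    then obtain u where u: "v = 3 * u" by auto
    have "u = 1"
    proof (rule ccontr)
      assume "u \<noteq> 1"
      moreover have "u > 0" using u vpos by simp
      ultimately have "nat u \<noteq> 1" by linarith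
      then obtain l where l: "prime l" "l dvd nat u"
        using prime_factor_nat[of "nat u"] by blast
      hence lu: "int l dvd u" using \<open>u > 0\<close> by (metis int_dvd_int_iff int_nat_eq less_imp_le)
      hence "l \<noteq> 2" using u v(2) by auto
      hence "l > 2" using l(1) prime_ge_2_nat[of l] by simp
      moreover have "int l dvd w" using lu u v by simp
      moreover have "9 dvd w" if "l = 3" using lu u v that by auto
      ultimately show False using no l by blast
    qed
    thus ?thesis using u by simp
  next
    case False
    have "v = 1"
    proof (rule ccontr)
      assume "v \<noteq> 1"
      hence "nat v \<noteq> 1" using vpos by linarith
      then obtain l where l: "prime l" "l dvd nat v"
        using prime_factor_nat[of "nat v"] by blast
      hence lv: "int l dvd v" using vpos by (metis int_dvd_int_iff int_nat_eq less_imp_le)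
      hence "l \<noteq> 2" using v(2) by auto
      hence "l > 2" using l(1) prime_ge_2_nat[of l] by simp
      moreover have "int l dvd w" using lv v by simp
      moreover have "l \<noteq> 3" using lv False by auto
      ultimately show False using no l by blast
    qed
    thus ?thesis by simp
  qed
  hence "w = 2 \<or> w = 6" using v by auto
  thus False
  proof
    assume "w = 2"
    thus False using qim_inj_mod4[OF assms(1) k] q3 assms k by auto
  next
    assume w6: "w = 6"
    have n: "(qre 1 w r)\<^sup>2 + 6 = 7 ^ r" using qre_qim_norm[of 1 w r] assms(5) w6 by simp
    have "(7::int) ^ r mod 5 = 3"
    proof -
      have "(7::int) ^ r = 343 * (2401 ^ k)" unfolding k by (simp add: power_add power_mult)
      also have "\<dots> mod 5 = 343 * (2401 ^ k mod 5) mod 5" by (metis mod_mult_right_eq)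
      also have "(2401::int) ^ k mod 5 = 1" by (subst power_mod[symmetric]) simp
      finally show ?thesis by simp
    qed
    hence "((qre 1 w r)\<^sup>2 + 6) mod 5 = 3" using n by simp
    moreover have "\<And>x::int. (x\<^sup>2 + 6) mod 5 \<noteq> 3"
    proof -
      fix x :: int
      have "(x\<^sup>2 + 6) mod 5 = ((x mod 5)\<^sup>2 + 6) mod 5" by (metis mod_add_left_eq power_mod)
      moreover have "x mod 5 \<in> {0,1,2,3,4}" by auto
      ultimately show "(x\<^sup>2 + 6) mod 5 \<noteq> 3" by auto
    qed
    ultimately show False by blast
  qed
qed

section \<open>Powers of 1 + sqrt (- w) in which sqrt (- w) has coefficient -1\<close>

text \<open>
  Modulo the norm \<open>1 + w\<close> one has \<open>\<theta>\<^sup>2 = 1\<close>, so \<open>(1 + \<theta>) ^ 2 = 2 * (1 + \<theta>)\<close>.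
\<close>

lemma qim_cong_norm:
  "1 + w dvd qim 1 w (Suc n) - 2 ^ n \<and> 1 + w dvd qre 1 w (Suc n) - 2 ^ n"
proof (induction n)
  case (Suc n)
  then obtain a b where a: "qim 1 w (Suc n) = 2 ^ n + (1 + w) * a"
    and b: "qre 1 w (Suc n) = 2 ^ n + (1 + w) * b" by (metis add.commute diff_add_cancel dvdE)
  have 1: "qim 1 w (Suc (Suc n)) - 2 ^ Suc n = (1 + w) * (a + b)"
    using a b by (simp add: algebra_simps)
  have 2: "qre 1 w (Suc (Suc n)) - 2 ^ Suc n = (1 + w) * (a + b) - (1 + w) * (2 ^ n + (1 + w) * a)"
    unfolding qre.simps(2)[of _ _ "Suc n"] a b by (simp add: algebra_simps)
  show ?case unfolding 1 2 by (intro conjI dvd_triv_left dvd_diff)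
qed auto

lemma qre_qim_cong:
  assumes "[w = w'] (mod m)"
  shows "[qre A w n = qre A w' n] (mod m) \<and> [qim A w n = qim A w' n] (mod m)"
  using assms by (induction n) (auto intro!: cong_add cong_diff cong_mult)

lemma qim_closed_form: "2 * t * qim 1 (- (t\<^sup>2)) n = (1 + t) ^ n - (1 - t) ^ n
   \<and> 2 * qre 1 (- (t\<^sup>2)) n = (1 + t) ^ n + (1 - t) ^ n"
proof (induction n)
  case (Suc n)
  let ?R = "qre 1 (- (t\<^sup>2)) n" and ?U = "qim 1 (- (t\<^sup>2)) n"
  have 1: "2 * t * qim 1 (- (t\<^sup>2)) (Suc n) = 2 * t * ?U + t * (2 * ?R)" by (simp add: algebra_simps)
  have 2: "2 * qre 1 (- (t\<^sup>2)) (Suc n) = 2 * ?R + t * (2 * t * ?U)"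
    by (simp add: algebra_simps power2_eq_square)
  show ?case unfolding 1 2 Suc[THEN conjunct1] Suc[THEN conjunct2] by (simp add: algebra_simps)
qed auto

lemma power_mod_period:
  fixes a m :: int
  assumes "a ^ e mod m = 1 mod m"
  shows "a ^ n mod m = a ^ (n mod e) mod m"
proof -
  have "a ^ n = (a ^ e) ^ (n div e) * a ^ (n mod e)"
    by (simp add: power_mult[symmetric] power_add[symmetric])
  also have "\<dots> mod m = (((a ^ e) mod m) ^ (n div e) mod m) * a ^ (n mod e) mod m"
    by (simp add: power_mod mod_mult_left_eq)
  also have "\<dots> = (1 ^ (n div e) mod m) * a ^ (n mod e) mod m" unfolding assms power_mod ..
  also have "\<dots> = a ^ (n mod e) mod m" by (simp add: mod_mult_left_eq)
  finally show ?thesis .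
qed

lemma prime_601: "prime (601::nat)"
proof -
  have small: "d = 1" if "d dvd 601" "d \<le> 24" for d :: nat
  proof -
    have "\<forall>d\<in>set [2..<25]. 601 mod d \<noteq> (0::nat)" by code_simp
    hence "\<not> (2 \<le> d \<and> d < 25)" using that(1) by (metis atLeastLessThan_iff set_upt dvd_eq_mod_eq_0)
    moreover have "d \<noteq> 0" using dvd_pos_nat[of 601 d] that(1) by simp
    ultimately show ?thesis using that(2) by linarith
  qed
  have "m = 1 \<or> m = 601" if "m dvd 601" for m :: nat
  proof -
    from that obtain k where k: "601 = m * k" by (elim dvdE)
    have "m \<le> 24 \<or> k \<le> 24"
    proof (rule ccontr)
      assume "\<not> ?thesis"
      hence "25 * 25 \<le> m * k" by (intro mult_le_mono) auto
      thus False using k by simp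
    qed
    thus ?thesis using small[of m] small[of k] that k by (metis dvd_triv_right mult.right_neutral)
  qed
  thus ?thesis unfolding prime_nat_iff by simp
qed

text \<open>
  Squaring with immediate reduction. Unlike \<open>x * x mod m\<close>, it is not simplified before its
  argument has been evaluated to a numeral, which makes \<open>power_mod_numeral\<close> an evaluation by
  repeated squaring.
\<close>

definition sq_mod :: "int \<Rightarrow> int \<Rightarrow> int" where "sq_mod x m = x * x mod m"

lemma power_mod_numeral:
  "(a::int) ^ numeral (num.Bit0 k) mod m = sq_mod (a ^ numeral k mod m) m"
  "(a::int) ^ numeral (num.Bit1 k) mod m = (a mod m) * sq_mod (a ^ numeral k mod m) m mod m"
  "sq_mod (numeral x) m = numeral x * numeral x mod m" "sq_mod 1 m = 1 mod m" "sq_mod 0 m = 0"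
  by (auto simp: sq_mod_def power_numeral_even power_numeral_odd mod_simps Let_def mult_ac)

text \<open>
  If \<open>- w\<close> is a square modulo \<open>m\<close>, then the coefficient is a combination of powers of \<open>1 + t\<close> and
  \<open>1 - t\<close> modulo \<open>m\<close>, so it depends only on the exponent modulo their common period.
\<close>

lemma qim_neq_minus_1_by_period:
  fixes w t m :: int
  assumes "[w = - (t\<^sup>2)] (mod m)" "r mod e \<in> S"
    and per: "(1 + t) ^ e mod m = 1 mod m" "((1 - t) mod m) ^ e mod m = 1 mod m"
    and S: "\<forall>s\<in>S. ((1 + t) ^ s mod m - ((1 - t) mod m) ^ s mod m + 2 * t) mod m \<noteq> 0"
  shows "qim 1 w r \<noteq> -1"
proof
  assume "qim 1 w r = -1"
  hence "[-1 = qim 1 (- (t\<^sup>2)) r] (mod m)"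
    using qre_qim_cong[OF assms(1), of 1 r] by simp
  hence "[2 * t * -1 = 2 * t * qim 1 (- (t\<^sup>2)) r] (mod m)" by (intro cong_mult cong_refl)
  hence "[2 * t * -1 = (1 + t) ^ r - (1 - t) ^ r] (mod m)"
    unfolding qim_closed_form[THEN conjunct1] .
  also have "[(1 + t) ^ r - (1 - t) ^ r = (1 + t) ^ (r mod e) mod m - (1 - t) ^ (r mod e) mod m] (mod m)"
    using power_mod_period[OF per(1), of r] power_mod_period[OF per(2)[unfolded power_mod], of r]
    by (intro cong_diff) (simp_all add: Cong.cong_def)
  finally have "[2 * t * -1 + 2 * t = (1 + t) ^ (r mod e) mod m - (1 - t) ^ (r mod e) mod m + 2 * t] (mod m)"
    by (intro cong_add cong_refl)
  hence "((1 + t) ^ (r mod e) mod m - (1 - t) ^ (r mod e) mod m + 2 * t) mod m = 0"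
    unfolding Cong.cong_def by simp
  thus False using S assms(2) by (auto simp add: power_mod)
qed

lemma euler_criterion_square:
  fixes x a :: int
  assumes "x\<^sup>2 mod int p = a mod int p" "prime p" "p > 2"
  shows "a ^ ((p - 1) div 2) mod int p \<noteq> int p - 1"
proof
  assume a: "a ^ ((p - 1) div 2) mod int p = int p - 1"
  have "QuadRes (int p) a" unfolding QuadRes_def Cong.cong_def using assms by blast
  hence "Legendre a (int p) = 0 \<or> Legendre a (int p) = 1" unfolding Legendre_def by auto
  moreover have "Legendre a (int p) mod int p = int p - 1"
    using euler_criterion[OF assms(2,3), of a] a by (simp add: Cong.cong_def)
  ultimately show False using assms(3) by auto
qed

text \<open>
  The prime \<open>601\<close> is chosen because \<open>5\<close> has the small order \<open>12\<close> modulo it, while \<open>600\<close> is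
  divisible by \<open>25\<close> and \<open>8\<close>. The hypotheses determine \<open>r\<close> modulo \<open>200\<close>, hence leave three residues
  of \<open>r\<close> modulo \<open>600\<close> and six residues of the odd number \<open>d\<close> modulo \<open>12\<close>. In four of the six cases
  \<open>- w\<close> is a square modulo \<open>601\<close> and the coefficient can be computed; in the other two the norm
  equation would make a nonresidue a square.
\<close>

lemma qim_neq_minus_1_if_power_of_5:
  assumes "odd d" "d \<ge> 3" "(2::int) ^ (r - 1) mod 125 = 124" "r mod 8 = 3"
    and "qim 1 (5 ^ d - 1) r = -1"
  shows False
proof -
  define w :: int where "w = 5 ^ d - 1"
  have p: "(2::int) ^ (r - 1) mod 125 = 2 ^ ((r - 1) mod 100) mod 125"
    by (rule power_mod_period) (simp add: power_mod_numeral del: power_numeral)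
  have "(r - 1) mod 100 = 50"
  proof -
    \<comment> \<open>\<open>2\<close> is a primitive root modulo \<open>125\<close>.\<close>
    have all: "\<forall>i\<in>set [0..<100]. (2::int) ^ i mod 125 = 124 \<longrightarrow> i = 50" by code_simp
    have "(r - 1) mod 100 \<in> set [0..<100]" by simp
    thus ?thesis using all p assms(3) by metis
  qed
  then obtain b where "r - 1 = 50 + 100 * b" by (metis mod_mult_div_eq)
  moreover have "r \<ge> 1" using assms(4) by (cases r) auto
  ultimately have b: "r = 51 + 100 * b" by simp
  have "(3 + 4 * b) mod 8 = 3"
  proof -
    have "r = (3 + 4 * b) + 8 * (6 + 12 * b)" using b by simp
    thus ?thesis using assms(4) by (metis mod_mult_self2)
  qed
  hence "even b" by presburger
  then obtain c where c: "r = 51 + 200 * c" using b by (auto elim: evenE)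
  have "c mod 3 = 0 \<or> c mod 3 = 1 \<or> c mod 3 = 2" by presburger
  moreover have "c = c mod 3 + 3 * (c div 3)" by simp
  ultimately have "\<exists>e. r = 51 + 600 * e \<or> r = 251 + 600 * e \<or> r = 451 + 600 * e"
    using c by (intro exI[of _ "c div 3"]) linarith
  hence r600: "r mod 600 \<in> {51, 251, 451}" by auto
  have "r mod 4 = 3" using assms(4) by presburger
  hence r12: "r mod 12 = 3 \<or> r mod 12 = 7 \<or> r mod 12 = 11" by presburger
  have d12: "d mod 12 = 1 \<or> d mod 12 = 3 \<or> d mod 12 = 5 \<or> d mod 12 = 7 \<or> d mod 12 = 9 \<or> d mod 12 = 11"
    using assms(1) by presburger
  have five: "(5::int) ^ n mod 601 = 5 ^ (n mod 12) mod 601" for n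
    by (rule power_mod_period) (simp add: power_mod_numeral del: power_numeral)
  have w: "w mod 601 = (5 ^ (d mod 12) mod 601 - 1) mod 601"
    unfolding w_def by (metis five mod_diff_left_eq)
  have norm: "(qre 1 w r)\<^sup>2 = 5 ^ (d * r) - w"
    using qre_qim_norm[of 1 w r] assms(5) by (simp add: w_def power_mult)
  have sq': "(qre 1 w r)\<^sup>2 mod int 601 = (5 ^ ((d * r) mod 12) mod 601 - (5 ^ (d mod 12) mod 601 - 1)) mod int 601"
  proof -
    have "(5 ^ (d * r) - w) mod 601 = (5 ^ (d * r) mod 601 - w mod 601) mod 601"
      by (rule mod_diff_eq[symmetric])
    also have "\<dots> = (5 ^ ((d * r) mod 12) mod 601 - (5 ^ (d mod 12) mod 601 - 1) mod 601) mod 601"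
      unfolding five[of "d * r"] w ..
    also have "\<dots> = (5 ^ ((d * r) mod 12) mod 601 - (5 ^ (d mod 12) mod 601 - 1)) mod 601"
      by (rule mod_diff_right_eq)
    finally show ?thesis unfolding norm of_nat_numeral .
  qed
  have m1: "qim 1 w r = -1" using assms(5) by (simp add: w_def)
  have dr: "(d * r) mod 12 = ((d mod 12) * (r mod 12)) mod 12" by (simp add: mod_simps)
  from d12 show False
  proof (elim disjE)
    assume d: "d mod 12 = 1"
    hence "[w = - (250\<^sup>2)] (mod 601)" using w by (simp add: Cong.cong_def)
    from qim_neq_minus_1_by_period[OF this r600] show False using m1
      by (auto simp: power_mod_numeral simp del: power_numeral)
  next
    assume d: "d mod 12 = 5"
    hence "[w = - (219\<^sup>2)] (mod 601)" using w by (simp add: Cong.cong_def)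
    from qim_neq_minus_1_by_period[OF this r600] show False using m1
      by (auto simp: power_mod_numeral simp del: power_numeral)
  next
    assume d: "d mod 12 = 7"
    hence "[w = - (288\<^sup>2)] (mod 601)" using w by (simp add: Cong.cong_def)
    from qim_neq_minus_1_by_period[OF this r600] show False using m1
      by (auto simp: power_mod_numeral simp del: power_numeral)
  next
    assume d: "d mod 12 = 11"
    hence "[w = - (11\<^sup>2)] (mod 601)" using w by (simp add: Cong.cong_def)
    from qim_neq_minus_1_by_period[OF this r600] show False using m1
      by (auto simp: power_mod_numeral simp del: power_numeral)
  next
    assume d: "d mod 12 = 3"
    show False using r12
    proof (elim disjE)
      assume "r mod 12 = 3"
      from euler_criterion_square[of _ 601, OF sq'[unfolded dr d this] prime_601] show False
        by (simp add: power_mod_numeral del: power_numeral)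
    next
      assume "r mod 12 = 7"
      from euler_criterion_square[of _ 601, OF sq'[unfolded dr d this] prime_601] show False
        by (simp add: power_mod_numeral del: power_numeral)
    next
      assume "r mod 12 = 11"
      from euler_criterion_square[of _ 601, OF sq'[unfolded dr d this] prime_601] show False
        by (simp add: power_mod_numeral del: power_numeral)
    qed
  next
    assume d: "d mod 12 = 9"
    show False using r12
    proof (elim disjE)
      assume "r mod 12 = 3"
      from euler_criterion_square[of _ 601, OF sq'[unfolded dr d this] prime_601] show False
        by (simp add: power_mod_numeral del: power_numeral)
    next
      assume "r mod 12 = 7"
      from euler_criterion_square[of _ 601, OF sq'[unfolded dr d this] prime_601] show False
        by (simp add: power_mod_numeral del: power_numeral)
    next
      assume "r mod 12 = 11"
      from euler_criterion_square[of _ 601, OF sq'[unfolded dr d this] prime_601] show False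
        by (simp add: power_mod_numeral del: power_numeral)
    qed
  qed
qed

text \<open>
  Here \<open>r\<close> is \<open>3\<close> modulo \<open>4\<close> and \<open>4\<close> divides \<open>w\<close>. Modulo \<open>w\<close> the coefficient is \<open>r\<close>, so \<open>w\<close>
  divides \<open>r + 1\<close>; modulo \<open>N = 1 + w\<close> it is \<open>2 ^ (r - 1)\<close>. As \<open>p - 1\<close> divides \<open>N - 1 = w\<close>, Fermat
  gives \<open>2 ^ (r + 1) = 1\<close> modulo \<open>p\<close>, and therefore \<open>4 = - 1\<close> modulo \<open>p\<close>, that is, \<open>p = 5\<close>. An
  even exponent \<open>d\<close> makes \<open>N\<close> a square, which is impossible since two distinct squares are too far
  apart; \<open>d = 1\<close> is \<open>w = 4\<close>, where exponent \<open>3\<close> already has coefficient \<open>- 1\<close>; odd \<open>d \<ge> 3\<close> is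
  excluded modulo \<open>601\<close>.
\<close>

lemma qim_neq_minus_1:
  assumes "even w" "w > 0" "odd r" "r \<ge> 5" "qim 1 w r = -1" "prime p" "1 + w = int p ^ d"
  shows False
proof (cases "r mod 4 = 1")
  case True
  then obtain k where k: "r = 1 + 4 * k" by (metis mod_mult_div_eq)
  thus False using qim_cong_mod4[OF assms(1) k] assms by auto
next
  case False
  hence "r mod 4 = 3" using assms(3) by presburger
  then obtain k where k: "r = 3 + 4 * k" by (metis mod_mult_div_eq)
  have q3: "qim 1 w 3 = 3 - w" by (simp add: numeral_3_eq_3)
  have w4: "4 dvd w"
  proof -
    have "4 dvd -1 - (3 - w)" using qim_cong_mod4[OF assms(1) k] assms(5) q3 by simp
    hence "4 dvd (-1 - (3 - w)) + 4" by (intro dvd_add) auto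
    thus ?thesis by simp
  qed
  have "w dvd qim 1 w r - int r" using qim_cong_w[of w 1 "r - 1"] assms by (auto simp del: qim.simps(2))
  hence "w dvd - (qim 1 w r - int r)" by (simp only: dvd_minus_iff)
  hence wr: "w dvd int (r + 1)" using assms(5) by (simp add: algebra_simps)
  have "1 + w dvd qim 1 w (Suc (r - 1)) - 2 ^ (r - 1)" using qim_cong_norm by blast
  hence "1 + w dvd - (qim 1 w (Suc (r - 1)) - 2 ^ (r - 1))" by (simp only: dvd_minus_iff)
  hence N: "1 + w dvd 2 ^ (r - 1) + 1" using assms by (simp add: algebra_simps)
  have d0: "d > 0" using assms by (cases d) auto
  have p_odd: "odd p"
  proof
    assume "even p"
    hence "even (int p ^ d)" using d0 by simp
    hence "even (1 + w)" using assms(7) by metis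
    thus False using assms(1) by simp
  qed
  have p5: "p = 5"
  proof -
    have pd: "int p dvd 1 + w" unfolding assms(7) using d0 by simp
    have "int p dvd 4 * (2 ^ (r - 1) + 1)" using pd N dvd_trans by (metis dvd_mult)
    also have "4 * (2 ^ (r - 1) + 1) = 2 ^ (r + 1) + (4::int)"
    proof -
      have "(2::int) ^ (r + 1) = 2 ^ ((r - 1) + 2)"
        by (rule arg_cong[where f = "power 2"]) (use assms(4) in linarith)
      also have "\<dots> = 2 ^ (r - 1) * 2 ^ 2" by (rule power_add)
      finally show ?thesis by simp
    qed
    finally have 1: "int p dvd 2 ^ (r + 1) + 4" .
    have "int (p - 1) dvd int p ^ d - 1"
    proof -
      have "int p - 1 dvd int p ^ d - 1 ^ d" unfolding power_diff_sumr2 by simp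
      moreover have "int (p - 1) = int p - 1" using assms(6) prime_gt_0_nat[of p] by (simp add: of_nat_diff)
      ultimately show ?thesis by simp
    qed
    also have "int p ^ d - 1 = w" using assms(7) by simp
    also note wr
    finally have "p - 1 dvd r + 1" by (simp only: of_nat_dvd_iff)
    then obtain m where m: "r + 1 = (p - 1) * m" by (elim dvdE)
    have "\<not> p dvd 2"
    proof
      assume "p dvd 2"
      hence "p = 2" using primes_dvd_imp_eq[OF assms(6) two_is_prime_nat] by blast
      thus False using p_odd by simp
    qed
    hence "[2 ^ (p - 1) = 1] (mod p)" using assms(6) by (intro fermat_theorem) auto
    hence "[(2 ^ (p - 1)) ^ m = 1 ^ m] (mod p)" by (rule cong_pow)
    hence "[2 ^ (r + 1) = 1] (mod p)" unfolding m by (simp add: power_mult)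
    hence "[int (2 ^ (r + 1)) = int 1] (mod int p)" by (simp only: cong_int_iff)
    hence "int p dvd 2 ^ (r + 1) - 1" by (simp add: cong_iff_dvd_diff)
    from dvd_diff[OF 1 this] have "int p dvd 5" by simp
    hence "p dvd 5" by (metis of_nat_dvd_iff of_nat_numeral)
    moreover have "prime (5::nat)" by simp
    ultimately show ?thesis using assms(6) primes_dvd_imp_eq by blast
  qed
  have norm: "(qre 1 w r)\<^sup>2 + w = (1 + w) ^ r"
    using qre_qim_norm[of 1 w r] assms by simp
  have d_odd: "odd d"
  proof
    assume "even d"
    then obtain c where c: "d = 2 * c" by auto
    define M :: int where "M = 5 ^ c"
    have NM: "1 + w = M\<^sup>2" unfolding assms(7) p5 c M_def by (simp add: power_mult[symmetric] mult.commute)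
    have M1: "M > 1" using d0 c by (simp add: M_def)
    define x where "x = \<bar>qre 1 w r\<bar>"
    have "(1 + w) ^ r = (M ^ r)\<^sup>2" unfolding NM by (simp add: power_mult[symmetric] mult.commute)
    hence e: "x\<^sup>2 = (M ^ r)\<^sup>2 - M\<^sup>2 + 1"
      using norm NM unfolding x_def by simp
    have MM: "M\<^sup>2 \<le> M ^ r" using M1 assms(4) by (intro power_increasing) auto
    have M2: "M\<^sup>2 > 1" using M1 by (simp add: one_less_power)
    have "x\<^sup>2 < (M ^ r)\<^sup>2" using e M2 by linarith
    hence "x < M ^ r" by (rule power2_less_imp_less) (use M1 in simp)
    hence "x \<le> M ^ r - 1" by simp
    moreover have "x \<ge> 0" by (simp add: x_def)
    ultimately have "x\<^sup>2 \<le> (M ^ r - 1)\<^sup>2" by (intro power_mono)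
    hence "x\<^sup>2 \<le> (M ^ r)\<^sup>2 - 2 * M ^ r + 1" by (simp add: power2_eq_square algebra_simps)
    thus False using e MM M2 by linarith
  qed
  show False
  proof (cases "d = 1")
    case True
    hence "w = 4" using assms(7) p5 by simp
    hence "qim 1 w 3 = -1" using q3 by simp
    moreover have "k > 0" using k assms by simp
    ultimately show False using qim_inj_mod4[OF assms(1) k] assms(5) by simp
  next
    case False
    hence d3: "d \<ge> 3" using d0 d_odd by presburger
    have w: "w = 5 ^ d - 1" using assms(7) p5 by simp
    have "(125::int) dvd 5 ^ d" using le_imp_power_dvd[OF d3, of "5::int"] by simp
    moreover have "(5::int) ^ d dvd 2 ^ (r - 1) + 1" using N unfolding assms(7) p5 by simp
    ultimately have "(125::int) dvd 2 ^ (r - 1) + 1" by (rule dvd_trans)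
    then obtain q where "(2::int) ^ (r - 1) + 1 = 125 * q" by (elim dvdE)
    hence "(2::int) ^ (r - 1) = 124 + 125 * (q - 1)" by simp
    hence "(2::int) ^ (r - 1) mod 125 = (124 + 125 * (q - 1)) mod 125" by metis
    also have "\<dots> = 124" by (subst mod_mult_self2) simp
    finally have c: "(2::int) ^ (r - 1) mod 125 = 124" .
    \<comment> \<open>The odd exponent \<open>d\<close> pins down \<open>w\<close> modulo \<open>8\<close>, and hence \<open>r\<close> modulo \<open>8\<close>: the coefficients of
      exponents \<open>3\<close> and \<open>7\<close> are \<open>- 1\<close> and \<open>3\<close> modulo \<open>8\<close>.\<close>
    have w8: "w mod 8 = 4"
    proof -
      have "(5::int) ^ d mod 8 = 5 ^ (d mod 2) mod 8" by (rule power_mod_period) simp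
      thus ?thesis using d_odd w by (simp add: odd_iff_mod_2_eq_one mod_diff_left_eq[symmetric])
    qed
    have "r mod 8 = 3"
    proof (rule ccontr)
      assume "r mod 8 \<noteq> 3"
      hence "r mod 8 = 7" using \<open>r mod 4 = 3\<close> by presburger
      then obtain j where j: "r = 7 + 8 * j" by (metis mod_mult_div_eq)
      have "8 dvd qre 1 w (8 * j) - 1" "8 dvd qim 1 w (8 * j) - int (8 * j)"
        using qre_qim_cong_pow2[OF assms(1), of 0 "8 * j"] by auto
      then obtain a b where a: "qre 1 w (8 * j) = 1 + 8 * a" and b: "qim 1 w (8 * j) = int (8 * j) + 8 * b"
        by (metis add.commute diff_add_cancel dvdE)
      define X where "X = qim 1 w 7 * a + qre 1 w 7 * (int j + b)"
      have e1: "-1 = qim 1 w 7 + 8 * X"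
        unfolding assms(5)[symmetric] j qre_qim_add a b X_def by (simp add: algebra_simps)
      obtain v where v: "w = 4 * v" using w4 by auto
      hence "odd v" using w8 by presburger
      then obtain u where u: "v = 2 * u + 1" by (rule oddE)
      have e2: "qim 1 w 7 = 7 - 35 * w + 21 * w\<^sup>2 - w ^ 3"
        by (simp add: numeral_eq_Suc algebra_simps)
      define Y where "Y = - 35 * u - 17 + 42 * v\<^sup>2 - 8 * v ^ 3"
      have "7 - 35 * w + 21 * w\<^sup>2 - w ^ 3 = 3 + 8 * Y"
        unfolding v Y_def by (simp add: u algebra_simps power2_eq_square power3_eq_cube)
      hence "qim 1 w 7 = 3 + 8 * Y" using e2 by metis
      thus False using e1 by presburger
    qed
    thus False using qim_neq_minus_1_if_power_of_5[OF d_odd d3 c] assms(5) w by simp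
  qed
qed

section \<open>Exponents divisible by 4 or by a prime greater than 3\<close>

lemma qre_qim_minus: "qre (- A) w n = (-1) ^ n * qre A w n \<and> qim (- A) w n = - ((-1) ^ n * qim A w n)"
proof (induction n)
  case (Suc n)
  hence "qre (- A) w n = (-1) ^ n * qre A w n" "qim (- A) w n = - ((-1) ^ n * qim A w n)" by blast+
  note IH = this
  show ?case unfolding qre.simps qim.simps IH by (simp add: algebra_simps)
qed auto

text \<open>
  Used for quantities that are known to be free of all primes but one, and of the square of that
  one.
\<close>

lemma abs_eq_1_or_prime:
  fixes u :: int
  assumes "prime r" "\<And>q::int. prime q \<Longrightarrow> q dvd u \<Longrightarrow> q = r" "\<not> r\<^sup>2 dvd u"
  shows "\<bar>u\<bar> = 1 \<or> \<bar>u\<bar> = r"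
proof (cases "\<bar>u\<bar> = 1")
  case False
  have "u \<noteq> 0" using assms(3) by auto
  hence "\<exists>q. prime q \<and> q dvd u" using False by (metis prime_factor_int)
  then obtain q where "prime q" "q dvd u" by blast
  hence "r dvd u" using assms(2) by blast
  then obtain v where v: "u = r * v" by (elim dvdE)
  have "\<bar>v\<bar> = 1"
  proof (rule ccontr)
    assume "\<bar>v\<bar> \<noteq> 1"
    then obtain q where "prime q" "q dvd v" by (metis prime_factor_int)
    hence "q = r" using assms(2) v by auto
    hence "r * r dvd u" using v \<open>q dvd v\<close> by (simp add: mult_dvd_mono)
    thus False using assms(3) by (simp add: power2_eq_square)
  qed
  thus ?thesis using v assms(1) prime_gt_0_int[of r] by (simp add: abs_mult)
qed auto

lemma abs_eq_1_if_no_prime: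
  fixes u :: int
  assumes "\<And>q::int. prime q \<Longrightarrow> \<not> q dvd u"
  shows "\<bar>u\<bar> = 1"
  using assms by (metis prime_factor_int)

lemma sq_less_3_power:
  assumes "r \<ge> 5"
  shows "(int r)\<^sup>2 < 3 ^ (r - 1)"
  using assms
proof (induction r rule: nat_induct_at_least)
  case (Suc n)
  have "(int (Suc n))\<^sup>2 \<le> 3 * (int n)\<^sup>2"
  proof -
    have "5 * int n \<le> int n * int n" using Suc by (intro mult_right_mono) auto
    moreover have "(int (Suc n))\<^sup>2 = int n * int n + 2 * int n + 1"
      by (simp add: power2_eq_square algebra_simps)
    moreover have "5 \<le> int n" using Suc(1) by simp
    ultimately show ?thesis unfolding power2_eq_square by linarith
  qed
  also have "\<dots> < 3 * 3 ^ (n - 1)" using Suc by simp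
  also have "\<dots> = 3 ^ n" using Suc(1) by (cases n) auto
  finally show ?case by simp
qed auto

lemma prime_power_dvd_cases:
  assumes "prime p" "prime (q::int)" "q dvd int p ^ D"
  shows "q = int p"
proof -
  have "q dvd int p" using assms(2,3) by (rule prime_dvd_power)
  thus ?thesis using assms(1,2) by (metis primes_dvd_imp_eq prime_int_nat_transfer prime_nat_int_transfer)
qed

text \<open>
  A common prime factor of \<open>A\<close> and \<open>w\<close> divides the norm, so it can only be \<open>p\<close>.
\<close>

lemma coprime_A_w:
  fixes A w :: int
  assumes "prime p" "A\<^sup>2 + w = int p ^ D" "\<not> int p dvd A \<or> \<not> int p dvd w"
  shows "coprime A w"
proof (rule ccontr)
  assume "\<not> coprime A w"
  hence "\<bar>gcd A w\<bar> \<noteq> 1" by (simp add: coprime_iff_gcd_eq_1)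
  then obtain q where "prime q" "q dvd gcd A w" by (metis prime_factor_int)
  hence q: "prime q" "q dvd A" "q dvd w" by auto
  hence "q dvd A\<^sup>2 + w" by (simp add: power2_eq_square)
  hence "q = int p" using prime_power_dvd_cases assms(1,2) q(1) by metis
  thus False using assms(3) q by blast
qed

text \<open>
  Every prime factor of the coefficient divides \<open>w\<close>, hence \<open>r * A ^ (r - 1)\<close>, hence \<open>r\<close>; and \<open>r\<^sup>2\<close>
  does not divide it. If \<open>A\<close> had a prime factor, it would be the only prime factor of the real
  part, so that the cofactor of \<open>A\<close> in the real part would be \<open>\<plusminus> 1\<close> or \<open>\<plusminus> r\<close>; then the norm of the
  \<open>r\<close>-th power would be at most \<open>r\<^sup>2\<close> times the norm, which is absurd. So \<open>A = \<plusminus> 1\<close>, the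
  coefficient \<open>\<plusminus> 1\<close> is excluded by the preceding sections, and \<open>\<plusminus> r\<close> is treated \<open>r\<close>-adically.
\<close>

lemma prime_exponent_ge_5:
  fixes A w :: int
  assumes r: "prime r" "r \<ge> 5" and p: "prime p"
    and w: "even w" "w > 0" and N: "A\<^sup>2 + w = int p ^ D"
    and U: "\<And>q::int. prime q \<Longrightarrow> q dvd qim A w r \<Longrightarrow> q dvd w"
    and pX: "\<not> int p dvd qre A w r"
    and X: "\<And>q q'::int. prime q \<Longrightarrow> prime q' \<Longrightarrow> q dvd qre A w r \<Longrightarrow> q' dvd qre A w r \<Longrightarrow> q = q'"
  shows "r = 5 \<and> int p ^ D = 11 \<and> \<bar>qre A w r\<bar> = 401"
proof -
  let ?R = "int r"
  have pR: "prime ?R" using r by simp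
  have "odd r" using r by (intro prime_odd_nat) auto
  then obtain k where k: "r = 2 * k + 1" by (rule oddE)
  obtain t where t: "qre A w r = A * (?R * (- w) ^ k + A\<^sup>2 * t)"
  proof -
    have "A ^ 3 dvd qre A w r - ?R * A * (- w) ^ k" using qre_qim_odd_cong[of A w k] k by blast
    then obtain t where "qre A w r - ?R * A * (- w) ^ k = A ^ 3 * t" by (elim dvdE)
    thus ?thesis using that[of t] by (simp add: algebra_simps power2_eq_square power3_eq_cube)
  qed
  define c where "c = ?R * (- w) ^ k + A\<^sup>2 * t"
  have Xc: "qre A w r = A * c" using t by (simp add: c_def)
  have X0: "qre A w r \<noteq> 0" using pX by auto
  have cop: "coprime A w" using p N pX Xc by (intro coprime_A_w) auto
  have copq: "\<not> q dvd A" if "prime q" "q dvd w" for q :: int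
    using cop that by (meson coprime_common_divisor not_prime_unit)
  have Uw: "w dvd qim A w r - ?R * A ^ (r - 1)" using qim_cong_w[of w A "r - 1"] r by (simp del: qim.simps)
  have Ur: "q = ?R" if "prime q" "q dvd qim A w r" for q :: int
  proof -
    have "q dvd w" using U that by blast
    hence "q dvd qim A w r - ?R * A ^ (r - 1)" using Uw dvd_trans by blast
    hence "q dvd ?R * A ^ (r - 1)" using that(2) by (metis dvd_diff_right_iff)
    hence "q dvd ?R \<or> q dvd A" using that(1) by (metis prime_dvd_mult_iff prime_dvd_power)
    hence "q dvd ?R" using copq that(1) \<open>q dvd w\<close> by blast
    thus ?thesis using that(1) pR primes_dvd_imp_eq by blast
  qed
  have U2: "\<not> ?R\<^sup>2 dvd qim A w r"
  proof
    assume a: "?R\<^sup>2 dvd qim A w r"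
    hence "?R dvd qim A w r" by (simp add: power2_eq_square dvd_mult_left)
    hence rw: "?R dvd w" using U pR by blast
    have "coprime ?R A" using copq[OF pR rw] pR by (simp add: prime_imp_coprime)
    hence "?R\<^sup>2 dvd qim A w r - ?R * A ^ (r - 1)" using r rw by (intro qim_prime_cong_sq) auto
    hence "?R\<^sup>2 dvd ?R * A ^ (r - 1)" using a by (metis dvd_diff_right_iff)
    hence "?R dvd A ^ (r - 1)" using r by (simp add: power2_eq_square)
    hence "?R dvd A" using pR prime_dvd_power by blast
    thus False using copq[OF pR rw] by blast
  qed
  have absU: "\<bar>qim A w r\<bar> = 1 \<or> \<bar>qim A w r\<bar> = ?R"
    using abs_eq_1_or_prime[OF pR Ur U2] by blast
  have "\<bar>A\<bar> = 1"
  proof (rule ccontr)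
    assume "\<bar>A\<bar> \<noteq> 1"
    then obtain q where q: "prime q" "q dvd A" by (metis prime_factor_int)
    have cr: "q' = ?R \<and> ?R dvd A" if "prime q'" "q' dvd c" for q'
    proof -
      have "q' = q" using X[of q' q] that q Xc by simp
      hence "q' dvd A" using q by simp
      hence "q' dvd A\<^sup>2 * t" by (simp add: power2_eq_square)
      hence "q' dvd ?R * (- w) ^ k" using that(2) unfolding c_def by (metis dvd_add_left_iff)
      hence "q' dvd ?R \<or> q' dvd w" using that(1) by (metis prime_dvd_mult_iff prime_dvd_power dvd_minus_iff)
      hence "q' dvd ?R" using copq that(1) \<open>q' dvd A\<close> by blast
      thus ?thesis using that(1) pR primes_dvd_imp_eq \<open>q' dvd A\<close> by blast
    qed
    have "\<not> ?R\<^sup>2 dvd c"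
    proof
      assume a: "?R\<^sup>2 dvd c"
      hence "?R dvd c" by (simp add: power2_eq_square dvd_mult_left)
      hence RA: "?R dvd A" using cr pR by blast
      hence "?R\<^sup>2 dvd A\<^sup>2 * t" by (simp add: dvd_power_same)
      hence "?R\<^sup>2 dvd ?R * (- w) ^ k" using a unfolding c_def by (metis dvd_add_left_iff)
      hence "?R dvd (- w) ^ k" using r by (simp add: power2_eq_square)
      hence "?R dvd - w" by (rule prime_dvd_power[OF pR])
      hence "?R dvd w" by simp
      thus False using copq[OF pR] RA by blast
    qed
    hence "\<bar>c\<bar> = 1 \<or> \<bar>c\<bar> = ?R" using abs_eq_1_or_prime[OF pR] cr by blast
    hence "\<bar>c\<bar> \<le> \<bar>?R\<bar>" using r by auto
    hence c2: "c\<^sup>2 \<le> ?R\<^sup>2" by (simp only: abs_le_square_iff)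
    have "\<bar>qim A w r\<bar> \<le> \<bar>?R\<bar>" using absU r by auto
    hence u2: "(qim A w r)\<^sup>2 \<le> ?R\<^sup>2" by (simp only: abs_le_square_iff)
    define M where "M = A\<^sup>2 + w"
    have "A \<noteq> 0" using X0 Xc by auto
    hence "A\<^sup>2 > 0" by simp
    moreover have "w \<ge> 2" using w by presburger
    ultimately have M3: "M \<ge> 3" unfolding M_def by linarith
    have "M ^ r = A\<^sup>2 * c\<^sup>2 + w * (qim A w r)\<^sup>2"
      using qre_qim_norm[of A w r] Xc by (simp add: M_def power_mult_distrib)
    also have "\<dots> \<le> A\<^sup>2 * ?R\<^sup>2 + w * ?R\<^sup>2"
      using c2 u2 w by (intro add_mono mult_left_mono) auto
    also have "\<dots> = M * ?R\<^sup>2" by (simp add: M_def algebra_simps)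
    \<comment> \<open>Exponential growth beats \<open>r\<^sup>2\<close> already for \<open>M = 3\<close>.\<close>
    finally have "M * M ^ (r - 1) \<le> M * ?R\<^sup>2" using r by (cases r) auto
    hence "M ^ (r - 1) \<le> ?R\<^sup>2" using M3 by simp
    moreover have "(3::int) ^ (r - 1) \<le> M ^ (r - 1)" using M3 by (intro power_mono) auto
    ultimately show False using sq_less_3_power[OF r(2)] by linarith
  qed
  hence A: "A = 1 \<or> A = -1" by linarith
  have U1: "qim A w r = qim 1 w r" and X1: "\<bar>qre A w r\<bar> = \<bar>qre 1 w r\<bar>"
    using A qre_qim_minus[of 1 w r] \<open>odd r\<close> by auto
  have N1: "1 + w = int p ^ D" using N A by auto
  have "qim 1 w r \<noteq> 1" using qim_neq_1[OF w \<open>odd r\<close> r(2)] by blast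
  moreover have "qim 1 w r \<noteq> -1" using qim_neq_minus_1[OF w \<open>odd r\<close> r(2) _ p N1] by blast
  ultimately have absUR: "\<bar>qim 1 w r\<bar> = ?R" using absU U1 by auto
  hence "?R dvd qim A w r" using U1 by (metis dvd_abs_iff dvd_refl)
  hence Rw: "?R dvd w" using U pR by blast
  have sq: "?R\<^sup>2 dvd qim 1 w r - ?R" using qim_prime_cong_sq[OF r(1) _ Rw, of 1] r by simp
  have UR: "qim 1 w r = ?R"
  proof (rule ccontr)
    assume "qim 1 w r \<noteq> ?R"
    hence "qim 1 w r = - ?R" using absUR by linarith
    hence "?R * ?R dvd ?R * -2" using sq by (simp add: power2_eq_square)
    hence "?R dvd -2" using r by (metis dvd_times_left_cancel_iff of_nat_0_eq_iff not_numeral_le_zero)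
    hence "?R \<le> 2" using zdvd_imp_le[of ?R 2] by simp
    thus False using r by simp
  qed
  obtain b where b: "qim 1 w r = ?R - int (r choose 3) * w + int (r choose 5) * w\<^sup>2 + w ^ 3 * b"
    using qre_qim_expand3 by blast
  hence "w * int (r choose 3) = w * (w * (int (r choose 5) + w * b))"
    unfolding UR by (simp add: algebra_simps power2_eq_square power3_eq_cube)
  \<comment> \<open>For \<open>r \<ge> 7\<close> both factors on the right are divisible by \<open>r\<close>, but \<open>r choose 3\<close> is not divisible
    by \<open>r\<^sup>2\<close>.\<close>
  hence c3: "int (r choose 3) = w * (int (r choose 5) + w * b)" using w by simp
  have r5: "r = 5"
  proof (rule ccontr)
    assume "r \<noteq> 5"
    hence "?R dvd int (r choose 5)" using r by (intro prime_dvd_choose_int) auto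
    hence "?R dvd int (r choose 5) + w * b" using Rw by simp
    hence "?R * ?R dvd int (r choose 3)" unfolding c3 using Rw by (rule mult_dvd_mono[rotated])
    moreover have "6 * (r choose 3) = r * ((r - 1) * (r - 2))"
    proof -
      obtain m where m: "r = Suc (Suc (Suc m))"
        using le_Suc_ex[OF r(2)] that[of "_ + 2"] by (auto simp: numeral_eq_Suc)
      have a: "3 * (r choose 3) = r * (r - 1 choose 2)"
        using Suc_times_binomial_eq[of "r - 1" 2] r by (simp add: numeral_3_eq_3 mult.commute)
      have b: "2 * (r - 1 choose 2) = (r - 1) * (r - 2)"
        unfolding m by (simp add: choose_two)
      have "6 * (r choose 3) = 2 * (3 * (r choose 3))" by simp
      also have "\<dots> = r * (2 * (r - 1 choose 2))" unfolding a by simp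
      finally show ?thesis unfolding b .
    qed
    ultimately have "r * r dvd r * ((r - 1) * (r - 2))"
      by (metis dvd_mult of_nat_dvd_iff of_nat_mult)
    hence "r dvd (r - 1) * (r - 2)" using r by simp
    hence "r dvd r - 1 \<or> r dvd r - 2" using r(1) by (simp add: prime_dvd_mult_iff)
    thus False using r by (auto dest!: dvd_imp_le)
  qed
  have "qim 1 w 5 = 5 - 10 * w + w\<^sup>2" by (simp add: numeral_eq_Suc algebra_simps)
  hence "w * (w - 10) = 0" using UR r5 by (simp add: algebra_simps power2_eq_square)
  hence w10: "w = 10" using w by simp
  have "\<bar>qre 1 w 5\<bar> = 401" by (simp add: numeral_eq_Suc w10)
  thus ?thesis using r5 N1 w10 X1 by simp
qed

text \<open>
  The coefficient is \<open>4 * A * (A\<^sup>2 - w)\<close>, and neither \<open>A\<close> nor \<open>A\<^sup>2 - w\<close> shares a prime factor with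
  \<open>w\<close>, so both are \<open>\<plusminus> 1\<close>.
\<close>

lemma exponent_4:
  fixes A w :: int
  assumes p: "prime p" and w: "w > 0" and N: "A\<^sup>2 + w = int p ^ D"
    and U: "\<And>q::int. prime q \<Longrightarrow> q dvd qim A w 4 \<Longrightarrow> q dvd w"
    and pX: "\<not> int p dvd qre A w 4"
  shows "int p ^ D = 3 \<and> \<bar>qre A w 4\<bar> = 7"
proof -
  have U4: "qim A w 4 = 4 * A * (A\<^sup>2 - w)" by (simp add: numeral_eq_Suc algebra_simps)
  have X4: "qre A w 4 = A * (A * (A\<^sup>2 - 6 * w)) + w * w" by (simp add: numeral_eq_Suc algebra_simps)
  have cop: "coprime A w" using p N pX X4 by (intro coprime_A_w) auto
  have copq: "\<not> q dvd A" if "prime q" "q dvd w" for q :: int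
    using cop that by (meson coprime_common_divisor not_prime_unit)
  have "\<bar>A\<bar> = 1"
  proof (rule abs_eq_1_if_no_prime)
    fix q :: int assume "prime q" thus "\<not> q dvd A" using U[of q] copq[of q] U4 by auto
  qed
  hence A: "A = 1 \<or> A = -1" by linarith
  hence A2: "A\<^sup>2 = 1" by auto
  have "\<bar>1 - w\<bar> = 1"
  proof (rule abs_eq_1_if_no_prime)
    fix q :: int assume q: "prime q" show "\<not> q dvd 1 - w"
    proof
      assume "q dvd 1 - w"
      hence "q dvd w" using U[of q] q U4 A2 by auto
      hence "q dvd 1" using \<open>q dvd 1 - w\<close> by (metis dvd_diff_left_iff)
      thus False using q not_prime_unit by blast
    qed
  qed
  hence "w = 2" using w by linarith
  thus ?thesis using N A2 A by (auto simp: numeral_eq_Suc)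
qed

section \<open>Primes of the form a * a + P * b * b\<close>

text \<open>
  Thue's pigeonhole argument: among the pairs \<open>(i, j)\<close> with \<open>0 \<le> i, j \<le> sqrt p\<close> two give the same
  value of \<open>i * Y - j * X\<close> modulo \<open>p\<close>, and their difference is \<open>(a, b)\<close>.
\<close>

lemma thue_norm_form:
  fixes X Y P :: int
  assumes p: "prime p" and dv: "int p dvd X\<^sup>2 + P * Y\<^sup>2" and Y: "\<not> int p dvd Y" and P: "P > 0"
  obtains a b :: int where "int p dvd a\<^sup>2 + P * b\<^sup>2" "0 < a\<^sup>2 + P * b\<^sup>2" "a\<^sup>2 + P * b\<^sup>2 < (1 + P) * int p"
proof -
  have "\<exists>s. s\<^sup>2 \<le> p \<and> p < (Suc s)\<^sup>2"
  proof (induction p)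
    case (Suc n)
    then obtain s where s: "s\<^sup>2 \<le> n" "n < (Suc s)\<^sup>2" by blast
    show ?case
    proof (cases "Suc n < (Suc s)\<^sup>2")
      case True thus ?thesis using s by (intro exI[of _ s]) auto
    next
      case False
      moreover have "(Suc s)\<^sup>2 < (Suc (Suc s))\<^sup>2" by (intro power_strict_mono) auto
      ultimately have "Suc n = (Suc s)\<^sup>2" "Suc n < (Suc (Suc s))\<^sup>2" using s by linarith+
      thus ?thesis by (metis order_refl)
    qed
  qed (auto intro!: exI[of _ 0])
  then obtain s where s: "s\<^sup>2 \<le> p" "p < (Suc s)\<^sup>2" by blast
  have "s\<^sup>2 \<noteq> p"
  proof
    assume "s\<^sup>2 = p"
    hence "prime (s ^ 2)" using p by simp
    thus False by (simp add: prime_power_iff)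
  qed
  hence s2: "(int s)\<^sup>2 < int p" using s(1) by (metis nat_less_le of_nat_less_iff of_nat_power)
  let ?A = "{0..s} \<times> {0..s}"
  define f where "f = (\<lambda>(i, j). (int i * Y - int j * X) mod int p)"
  have p0: "int p > 0" using p prime_gt_0_nat by simp
  have "f ` ?A \<subseteq> {0..<int p}" using p0 by (auto simp: f_def)
  hence "card (f ` ?A) \<le> card {0..<int p}" by (intro card_mono) auto
  also have "\<dots> = p" by simp
  also have "p < card ?A" using s(2) by (simp add: power2_eq_square)
  finally have "\<not> inj_on f ?A" by (intro pigeonhole)
  then obtain x y where xy: "x \<in> ?A" "y \<in> ?A" "x \<noteq> y" "f x = f y" by (auto simp: inj_on_def)
  obtain i j i' j' where ij: "x = (i, j)" "y = (i', j')" by (cases x, cases y) auto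
  define a b where "a = int i - int i'" and "b = int j - int j'"
  have "(int i * Y - int j * X) mod int p = (int i' * Y - int j' * X) mod int p"
    using xy(4) by (simp add: ij f_def)
  hence "int p dvd (int i * Y - int j * X) - (int i' * Y - int j' * X)" by (simp add: mod_eq_dvd_iff)
  hence d: "int p dvd a * Y - b * X" by (simp add: a_def b_def algebra_simps)
  have "int p dvd (a * Y - b * X) * (a * Y + b * X) + b\<^sup>2 * (X\<^sup>2 + P * Y\<^sup>2)"
    by (rule dvd_add[OF dvd_mult2[OF d] dvd_mult[OF dv]])
  also have "(a * Y - b * X) * (a * Y + b * X) + b\<^sup>2 * (X\<^sup>2 + P * Y\<^sup>2) = (a\<^sup>2 + P * b\<^sup>2) * Y\<^sup>2"
    by (simp add: algebra_simps power2_eq_square)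
  finally have "int p dvd a\<^sup>2 + P * b\<^sup>2 \<or> int p dvd Y\<^sup>2" using p by (simp add: prime_dvd_mult_iff)
  hence 1: "int p dvd a\<^sup>2 + P * b\<^sup>2" using Y p by (metis prime_dvd_power prime_nat_int_transfer)
  have "a \<noteq> 0 \<or> b \<noteq> 0" using xy(3) by (auto simp: ij a_def b_def)
  hence 2: "0 < a\<^sup>2 + P * b\<^sup>2" using P
    by (metis add_nonneg_pos add_pos_nonneg less_imp_le mult_pos_pos zero_le_mult_iff zero_le_power2 zero_less_power2)
  have "\<bar>a\<bar> \<le> \<bar>int s\<bar>" "\<bar>b\<bar> \<le> \<bar>int s\<bar>" using xy by (auto simp: ij a_def b_def)
  hence "a\<^sup>2 \<le> (int s)\<^sup>2" "b\<^sup>2 \<le> (int s)\<^sup>2" by (simp_all only: abs_le_square_iff)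
  hence "a\<^sup>2 < int p" "b\<^sup>2 < int p" using s2 by linarith+
  hence "a\<^sup>2 + P * b\<^sup>2 < int p + P * int p" using P by (intro add_strict_mono mult_strict_left_mono) auto
  hence 3: "a\<^sup>2 + P * b\<^sup>2 < (1 + P) * int p" by (simp add: algebra_simps)
  show ?thesis using that 1 2 3 by blast
qed

lemma prime_eq_sum_two_squares:
  fixes X Y :: int
  assumes "prime p" "int p dvd X\<^sup>2 + Y\<^sup>2" "\<not> int p dvd Y"
  shows "\<exists>a b. a\<^sup>2 + b\<^sup>2 = int p"
proof -
  obtain a b :: int where ab: "int p dvd a\<^sup>2 + 1 * b\<^sup>2" "0 < a\<^sup>2 + 1 * b\<^sup>2" "a\<^sup>2 + 1 * b\<^sup>2 < (1 + 1) * int p"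
    using thue_norm_form[of p X 1 Y] assms by auto
  then obtain k where k: "a\<^sup>2 + b\<^sup>2 = int p * k" by (auto elim: dvdE)
  have p0: "int p > 0" using assms(1) prime_gt_0_nat by simp
  have "int p * k < (1 + 1) * int p" using ab(3) k by (metis mult_1)
  hence "int p * k < int p * 2" by (simp only: one_add_one mult.commute)
  hence "k < 2" using p0 by (metis mult_less_cancel_left_pos)
  moreover have "k > 0" using ab k p0 by (simp add: zero_less_mult_iff)
  ultimately have "k = 1" by simp
  thus ?thesis using k by auto
qed

text \<open>
  Thue's argument leaves the multiples \<open>p\<close>, \<open>2 * p\<close> and \<open>3 * p\<close>. The second is impossible modulo
  \<open>4\<close>, and the third gives \<open>p\<close> after dividing \<open>a\<close> by \<open>3\<close>.
\<close>

lemma prime_eq_square_plus_3_square: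
  fixes X Y :: int
  assumes "prime p" "odd p" "int p dvd X\<^sup>2 + 3 * Y\<^sup>2" "\<not> int p dvd Y"
  shows "\<exists>a b. a\<^sup>2 + 3 * b\<^sup>2 = int p"
proof -
  obtain a b :: int where ab: "int p dvd a\<^sup>2 + 3 * b\<^sup>2" "0 < a\<^sup>2 + 3 * b\<^sup>2" "a\<^sup>2 + 3 * b\<^sup>2 < (1 + 3) * int p"
    using thue_norm_form[of p X 3 Y] assms by auto
  then obtain k where k: "a\<^sup>2 + 3 * b\<^sup>2 = int p * k" by (auto elim: dvdE)
  have p0: "int p > 0" using assms(1) prime_gt_0_nat by simp
  have "int p * k < (1 + 3) * int p" using ab(3) k by metis
  also have "\<dots> = int p * 4" by simp
  finally have "int p * k < int p * 4" .
  hence "k < 4" using p0 by (metis mult_less_cancel_left_pos)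
  moreover have "k > 0" using ab k p0 by (simp add: zero_less_mult_iff)
  ultimately have "k = 1 \<or> k = 2 \<or> k = 3" by linarith
  thus ?thesis
  proof (elim disjE)
    assume "k = 1" thus ?thesis using k by auto
  next
    assume k2: "k = 2"
    have "even (a\<^sup>2 + 3 * b\<^sup>2)" using k k2 by simp
    hence e: "even a = even b" by simp
    have "4 dvd a\<^sup>2 + 3 * b\<^sup>2"
    proof (cases "even a")
      case True
      then obtain a' b' where "a = 2 * a'" "b = 2 * b'" using e by (auto elim!: evenE)
      thus ?thesis by (simp add: power2_eq_square)
    next
      case False
      then obtain a' b' where "a = 2 * a' + 1" "b = 2 * b' + 1" using e by (auto elim!: oddE)
      hence "a\<^sup>2 + 3 * b\<^sup>2 = 4 * (a'\<^sup>2 + a' + 3 * b'\<^sup>2 + 3 * b' + 1)"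
        by (simp add: power2_eq_square algebra_simps)
      thus ?thesis by simp
    qed
    hence "4 dvd int p * 2" using k k2 by simp
    hence "2 dvd int p" by presburger
    thus ?thesis using assms(2) by simp
  next
    assume k3: "k = 3"
    have "a\<^sup>2 = 3 * (int p - b\<^sup>2)" using k k3 by simp
    hence "3 dvd a\<^sup>2" by (metis dvd_triv_left)
    hence "3 dvd a" by (rule prime_dvd_power[rotated]) simp
    then obtain c where c: "a = 3 * c" by (elim dvdE)
    hence "b\<^sup>2 + 3 * c\<^sup>2 = int p" using k k3 by (simp add: power2_eq_square)
    thus ?thesis by blast
  qed
qed

lemma dvd_conjugate_cases:
  fixes a b X Y P :: int
  assumes p: "prime p" and N: "a\<^sup>2 + P * b\<^sup>2 = int p" and j: "j > 0" "X\<^sup>2 + P * Y\<^sup>2 = int p ^ j"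
  shows "int p dvd Y * a - X * b \<or> int p dvd Y * a + X * b"
proof -
  have "(Y * a - X * b) * (Y * a + X * b) = Y\<^sup>2 * (a\<^sup>2 + P * b\<^sup>2) - b\<^sup>2 * (X\<^sup>2 + P * Y\<^sup>2)"
    by (simp add: algebra_simps power2_eq_square)
  also have "\<dots> = int p * Y\<^sup>2 - b\<^sup>2 * int p ^ j" unfolding N j by simp
  also have "int p dvd \<dots>" by (rule dvd_diff[OF dvd_triv_left dvd_mult]) (use j(1) in \<open>auto simp: dvd_power\<close>)
  finally show ?thesis using p by (simp add: prime_dvd_mult_iff)
qed

text \<open>
  Unique factorisation for a single prime, without ideals: \<open>X + Y * sqrt (- P)\<close> is divisible by \<open>a
  + b * sqrt (- P)\<close>, and the quotient satisfies the hypotheses again, since otherwise it would be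
  divisible by the conjugate and \<open>p\<close> would divide \<open>X\<close>. At the end only an element of norm \<open>1\<close> is
  left.
\<close>

lemma norm_form_descent:
  fixes a b X Y P :: int
  assumes p: "prime p" and N: "a\<^sup>2 + P * b\<^sup>2 = int p" and P: "P > 0" "\<not> int p dvd P"
    and XY: "X\<^sup>2 + P * Y\<^sup>2 = int p ^ j" "j > 0 \<Longrightarrow> \<not> int p dvd X" "j > 0 \<Longrightarrow> int p dvd Y * a - X * b"
  shows "\<exists>e f. e\<^sup>2 + P * f\<^sup>2 = 1 \<and>
      X = e * qre a (P * b\<^sup>2) j - P * f * (b * qim a (P * b\<^sup>2) j) \<and>
      Y = e * (b * qim a (P * b\<^sup>2) j) + f * qre a (P * b\<^sup>2) j"
  using XY
proof (induction j arbitrary: X Y)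
  case 0
  thus ?case by (intro exI[of _ X] exI[of _ Y]) auto
next
  case (Suc j)
  have p0: "int p > 0" using p prime_gt_0_nat by simp
  have pp: "prime (int p)" using p by simp
  obtain Y1 where Y1: "Y * a - X * b = int p * Y1" using Suc.prems(3) by (auto elim: dvdE)
  have "(X * a + P * Y * b)\<^sup>2 + P * (Y * a - X * b)\<^sup>2 = (a\<^sup>2 + P * b\<^sup>2) * (X\<^sup>2 + P * Y\<^sup>2)"
    by (simp add: algebra_simps power2_eq_square)
  hence nn: "(X * a + P * Y * b)\<^sup>2 + P * (int p * Y1)\<^sup>2 = int p * (int p * int p ^ j)"
    unfolding N Suc.prems(1) Y1 by simp
  hence "(X * a + P * Y * b)\<^sup>2 = int p * (int p * int p ^ j - P * int p * Y1\<^sup>2)"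
    by (simp add: algebra_simps power2_eq_square)
  hence "int p dvd (X * a + P * Y * b)\<^sup>2" by simp
  hence "int p dvd X * a + P * Y * b" using pp prime_dvd_power by blast
  then obtain X1 where X1: "X * a + P * Y * b = int p * X1" by (elim dvdE)
  have "(int p * int p) * (X1\<^sup>2 + P * Y1\<^sup>2) = (int p * int p) * int p ^ j"
    using nn unfolding X1 by (simp add: algebra_simps power2_eq_square)
  hence N1: "X1\<^sup>2 + P * Y1\<^sup>2 = int p ^ j" using p0 by simp
  have "int p * X = int p * (a * X1 - P * b * Y1)"
  proof -
    have "int p * (a * X1 - P * b * Y1) = a * (X * a + P * Y * b) - P * b * (Y * a - X * b)"
      unfolding X1 Y1 by (simp add: algebra_simps)
    also have "\<dots> = (a\<^sup>2 + P * b\<^sup>2) * X" by (simp add: algebra_simps power2_eq_square)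
    finally show ?thesis by (metis N)
  qed
  hence X: "X = a * X1 - P * b * Y1" using p0 by (metis less_irrefl mult_left_cancel)
  have "int p * Y = int p * (a * Y1 + b * X1)"
  proof -
    have "int p * (a * Y1 + b * X1) = b * (X * a + P * Y * b) + a * (Y * a - X * b)"
      unfolding X1 Y1 by (simp add: algebra_simps)
    also have "\<dots> = (a\<^sup>2 + P * b\<^sup>2) * Y" by (simp add: algebra_simps power2_eq_square)
    finally show ?thesis by (metis N)
  qed
  hence Y: "Y = a * Y1 + b * X1" using p0 by (metis less_irrefl mult_left_cancel)
  have 1: "\<not> int p dvd X1" if "j > 0"
  proof
    assume a: "int p dvd X1"
    hence "int p dvd X1\<^sup>2" by (simp add: power2_eq_square)
    moreover have "int p dvd X1\<^sup>2 + P * Y1\<^sup>2" unfolding N1 using that by (simp add: dvd_power)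
    ultimately have "int p dvd P * Y1\<^sup>2" by (metis dvd_add_right_iff)
    hence "int p dvd Y1\<^sup>2" using P pp by (simp add: prime_dvd_mult_iff)
    hence "int p dvd Y1" using pp prime_dvd_power by blast
    hence "int p dvd X" unfolding X using a by simp
    thus False using Suc.prems(2) by simp
  qed
  have 2: "int p dvd Y1 * a - X1 * b" if "j > 0"
  proof (rule ccontr)
    assume "\<not> ?thesis"
    hence "int p dvd Y1 * a + X1 * b" using dvd_conjugate_cases[OF p N that N1] by blast
    hence pY: "int p dvd Y" unfolding Y by (simp add: mult.commute)
    have "int p dvd X\<^sup>2 + P * Y\<^sup>2" unfolding Suc.prems(1) by simp
    moreover have "int p dvd P * Y\<^sup>2" using pY by (simp add: power2_eq_square)
    ultimately have "int p dvd X\<^sup>2" by (metis dvd_add_left_iff)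
    hence "int p dvd X" using pp prime_dvd_power by blast
    thus False using Suc.prems(2) by simp
  qed
  obtain e f where ef: "e\<^sup>2 + P * f\<^sup>2 = 1"
      "X1 = e * qre a (P * b\<^sup>2) j - P * f * (b * qim a (P * b\<^sup>2) j)"
      "Y1 = e * (b * qim a (P * b\<^sup>2) j) + f * qre a (P * b\<^sup>2) j"
    using Suc.IH[OF N1 1 2] by blast
  show ?case
    by (rule exI[of _ e], rule exI[of _ f], intro conjI ef(1); unfold X Y ef(2,3) qre.simps qim.simps)
       (simp_all add: algebra_simps power2_eq_square)
qed

lemma abs_eq_1_if_dvd_3_power:
  fixes c :: int
  assumes "c dvd 3 ^ l" "\<not> 3 dvd c"
  shows "\<bar>c\<bar> = 1"
proof (rule abs_eq_1_if_no_prime)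
  fix q :: int assume q: "prime q"
  show "\<not> q dvd c"
  proof
    assume "q dvd c"
    hence "q dvd 3" using assms(1) q by (meson dvd_trans prime_dvd_power)
    hence "q = 3" using q primes_dvd_imp_eq[of q 3] by simp
    thus False using \<open>q dvd c\<close> assms(2) by simp
  qed
qed

section \<open>Prime powers exceeding a power of 3 by 4\<close>

text \<open>
  The factors \<open>Y - 2\<close> and \<open>Y + 2\<close> of \<open>3 ^ k\<close> cannot both be divisible by \<open>3\<close>.
\<close>

lemma power_of_3_plus_4_even:
  assumes "4 + 3 ^ k = (int p ^ i)\<^sup>2"
  shows False
proof -
  define Y where "Y = int p ^ i"
  have e: "(Y - 2) * (Y + 2) = 3 ^ k" using assms by (simp add: Y_def algebra_simps power2_eq_square)
  have Y0: "Y \<ge> 0" by (simp add: Y_def)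
  have d: "Y - 2 dvd 3 ^ k" "Y + 2 dvd 3 ^ k" using e by (metis dvd_triv_left dvd_triv_right)+
  have "\<bar>Y - 2\<bar> = 1"
  proof (rule abs_eq_1_if_dvd_3_power[OF d(1)], rule notI)
    assume "3 dvd Y - 2"
    hence "\<not> 3 dvd Y + 2" by presburger
    hence "\<bar>Y + 2\<bar> = 1" by (rule abs_eq_1_if_dvd_3_power[OF d(2)])
    thus False using Y0 by linarith
  qed
  moreover have "Y \<noteq> 1"
  proof
    assume "Y = 1"
    hence "(3::int) ^ k = -3" using e by simp
    moreover have "(3::int) ^ k > 0" by simp
    ultimately show False by linarith
  qed
  ultimately have "Y = 3" by linarith
  hence "\<bar>5::int\<bar> = 1" using d(2) by (intro abs_eq_1_if_dvd_3_power[of _ k]) auto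
  thus False by simp
qed

text \<open>
  In the Gaussian integers, \<open>3 ^ l + 2 * \<i>\<close> is up to a unit the \<open>j\<close>-th power of a prime element \<open>a
  + b * \<i>\<close> with \<open>b\<close> even, and parity reduces the unit to a sign. For a prime \<open>r\<close> dividing \<open>j\<close>
  write it as \<open>(A + B * \<i>) ^ r\<close>. As \<open>B\<close> is even and divides \<open>2\<close>, it is \<open>\<plusminus> 2\<close>; modulo \<open>3\<close> one sees
  that \<open>3\<close> divides \<open>A\<close>. For \<open>r \<noteq> 3\<close> the cofactor of \<open>A\<close> in \<open>3 ^ l\<close> is prime to \<open>3\<close>, so \<open>A = \<plusminus> 3 ^
  l\<close>, which contradicts the norms; for \<open>r = 3\<close> the coefficient \<open>3 * A\<^sup>2 - 4\<close> is not \<open>\<plusminus> 1\<close>.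
\<close>

lemma power_of_9_plus_4:
  assumes p: "prime p" and l: "l > 0" and e: "(3 ^ l)\<^sup>2 + 4 = int p ^ j" and j: "odd j" "j > 1"
  shows False
proof -
  have pp: "prime (int p)" using p by simp
  have odd_pj: "odd (int p ^ j)" unfolding e[symmetric] by simp
  hence odd_p: "odd p" using j by simp
  have p2: "\<not> int p dvd 2"
  proof
    assume "int p dvd 2"
    hence "int p = 2" using pp primes_dvd_imp_eq[of "int p" 2] by simp
    thus False using odd_p by simp
  qed
  have pdvd: "int p dvd (3 ^ l)\<^sup>2 + 2\<^sup>2" using e j by (simp add: dvd_power)
  obtain a0 b0 where ab0: "a0\<^sup>2 + b0\<^sup>2 = int p" using prime_eq_sum_two_squares[OF p pdvd p2] by blast
  have "\<exists>a b. a\<^sup>2 + b\<^sup>2 = int p \<and> odd a \<and> even b"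
  proof (cases "odd a0")
    case True
    moreover have "even b0" using ab0 odd_p True by (metis even_add even_of_nat even_power odd_pos pos2)
    ultimately show ?thesis using ab0 by blast
  next
    case False
    moreover have "odd b0" using ab0 odd_p False by (metis even_add even_of_nat even_power odd_pos pos2)
    ultimately show ?thesis using ab0 by (intro exI[of _ b0] exI[of _ a0]) auto
  qed
  then obtain a b1 where ab1: "a\<^sup>2 + b1\<^sup>2 = int p" "odd a" "even b1" by blast
  have "int p dvd 2 * a - 3 ^ l * b1 \<or> int p dvd 2 * a + 3 ^ l * b1"
    by (rule dvd_conjugate_cases[of p a 1 b1 j "3 ^ l" 2]) (use p ab1 e j in auto)
  then obtain b where b: "a\<^sup>2 + b\<^sup>2 = int p" "even b" "int p dvd 2 * a - 3 ^ l * b"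
  proof
    assume "int p dvd 2 * a - 3 ^ l * b1" thus ?thesis using that ab1 by blast
  next
    assume "int p dvd 2 * a + 3 ^ l * b1" thus ?thesis using that[of "- b1"] ab1 by simp
  qed
  have p3: "\<not> int p dvd 3 ^ l"
  proof
    assume a: "int p dvd 3 ^ l"
    hence "int p dvd (3 ^ l)\<^sup>2" by (simp add: power2_eq_square)
    hence "int p dvd 2\<^sup>2" using pdvd by (metis dvd_add_right_iff)
    thus False using p2 pp prime_dvd_power by blast
  qed
  have "\<not> int p dvd 1" using pp not_prime_unit by blast
  then obtain f g where fg: "f\<^sup>2 + 1 * g\<^sup>2 = 1"
    "3 ^ l = f * qre a (1 * b\<^sup>2) j - 1 * g * (b * qim a (1 * b\<^sup>2) j)"
    "2 = f * (b * qim a (1 * b\<^sup>2) j) + g * qre a (1 * b\<^sup>2) j"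
    using norm_form_descent[of p a 1 b "3 ^ l" 2 j] p b e p3 j by auto
  have odd_R: "odd (qre a (b\<^sup>2) j)" using ab1 b by (intro odd_qre) auto
  have g0: "g = 0"
  proof (rule ccontr)
    assume "g \<noteq> 0"
    hence "g\<^sup>2 \<ge> 1" by (simp add: int_one_le_iff_zero_less)
    hence "g\<^sup>2 = 1" "f\<^sup>2 = 0" using fg(1) zero_le_power2[of f] by linarith+
    hence "f = 0" by simp
    hence "2 = g * qre a (b\<^sup>2) j" using fg(3) by simp
    moreover have "odd (g\<^sup>2)" using \<open>g\<^sup>2 = 1\<close> by simp
    hence "odd g" by simp
    ultimately show False using odd_R by (metis even_mult_iff even_numeral)
  qed
  hence f1: "\<bar>f\<bar> = 1" using fg(1) by (simp add: abs_square_eq_1)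
  have R: "\<bar>qre a (b\<^sup>2) j\<bar> = 3 ^ l"
  proof -
    have "f * qre a (b\<^sup>2) j = 3 ^ l" using fg(2) g0 by simp
    hence "\<bar>f\<bar> * \<bar>qre a (b\<^sup>2) j\<bar> = \<bar>3 ^ l\<bar>" by (metis abs_mult)
    thus ?thesis using f1 by simp
  qed
  have U: "\<bar>b * qim a (b\<^sup>2) j\<bar> = 2"
  proof -
    have "f * (b * qim a (b\<^sup>2) j) = 2" using fg(3) g0 by simp
    hence "\<bar>f\<bar> * \<bar>b * qim a (b\<^sup>2) j\<bar> = \<bar>2\<bar>" by (metis abs_mult)
    thus ?thesis using f1 by simp
  qed
  obtain r where r: "prime r" "r dvd j" using j prime_factor_nat[of j] by auto
  then obtain i where i: "j = i * r" by (metis dvd_def mult.commute)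
  have i0: "i > 0" using i j by (cases i) auto
  have odd_r: "odd r" using i j by simp
  define A B where "A = qre a (b\<^sup>2) i" and "B = b * qim a (b\<^sup>2) i"
  have R': "\<bar>qre A (B\<^sup>2) r\<bar> = 3 ^ l" and U': "\<bar>B * qim A (B\<^sup>2) r\<bar> = 2"
    using R U unfolding i qre_qim_mult A_def B_def by (simp_all add: power_mult_distrib mult_ac)
  have NAB: "A\<^sup>2 + B\<^sup>2 = int p ^ i"
    using qre_qim_norm[of a "b\<^sup>2" i] b(1) by (simp add: A_def B_def power_mult_distrib)
  have even_B: "even B" using b by (simp add: B_def)
  have B: "B\<^sup>2 = 4" and U1: "\<bar>qim A (B\<^sup>2) r\<bar> = 1"
  proof -
    obtain B' where B': "B = 2 * B'" using even_B by (elim evenE)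
    have "\<bar>B' * qim A (B\<^sup>2) r\<bar> = 1" using U' unfolding B' by (simp add: abs_mult)
    hence "\<bar>B'\<bar> = 1" "\<bar>qim A (B\<^sup>2) r\<bar> = 1" by (metis abs_zmult_eq_1 mult.commute)+
    thus "B\<^sup>2 = 4" "\<bar>qim A (B\<^sup>2) r\<bar> = 1" using B' by (auto simp: power2_eq_square abs_if split: if_splits)
  qed
  have p1: "int p mod 3 = 1"
  proof -
    have "(int p ^ j) mod 3 = 1"
    proof -
      have "(3::int) dvd (3 ^ l)\<^sup>2" using l by (simp add: power2_eq_square dvd_power)
      thus ?thesis unfolding e[symmetric] by presburger
    qed
    obtain m where m: "j = 2 * m + 1" using j by (elim oddE)
    have "int p mod 3 = 0 \<or> int p mod 3 = 1 \<or> int p mod 3 = 2" by presburger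
    moreover have "(int p mod 3) ^ j mod 3 = 1" using \<open>(int p ^ j) mod 3 = 1\<close> by (simp add: power_mod)
    moreover have "(2::int) ^ j mod 3 = 2"
    proof -
      have "(2::int) ^ j mod 3 = 2 ^ (j mod 2) mod 3" by (rule power_mod_period) simp
      thus ?thesis using j by (simp add: odd_iff_mod_2_eq_one)
    qed
    ultimately show ?thesis using j by (auto simp: power_0_left)
  qed
  have "3 dvd A"
  proof -
    have "int p ^ i mod 3 = (int p mod 3) ^ i mod 3" by (simp add: power_mod)
    hence "int p ^ i mod 3 = 1" using p1 by simp
    hence "(A\<^sup>2 + 4) mod 3 = 1" using NAB B by simp
    hence "3 dvd A\<^sup>2" by presburger
    thus ?thesis by (rule prime_dvd_power[rotated]) simp
  qed
  show False
  proof (cases "r = 3")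
    case True
    have "qim A 4 3 = 3 * A\<^sup>2 - 4" by (simp add: numeral_eq_Suc algebra_simps)
    hence "\<bar>3 * A\<^sup>2 - 4\<bar> = 1" using U1 True B by simp
    moreover obtain c where "A = 3 * c" using \<open>3 dvd A\<close> by (elim dvdE)
    hence "A\<^sup>2 = 9 * c\<^sup>2" by (simp add: power2_eq_square)
    ultimately show False by presburger
  next
    case False
    obtain k where k: "r = 2 * k + 1" using odd_r by (elim oddE)
    have "A ^ 3 dvd qre A 4 r - int r * A * (- 4) ^ k" using qre_qim_odd_cong[of A 4 k] k by blast
    then obtain t where t: "qre A 4 r - int r * A * (- 4) ^ k = A ^ 3 * t" by (elim dvdE)
    define c where "c = int r * (- 4) ^ k + A\<^sup>2 * t"
    have Ac: "qre A 4 r = A * c" using t by (simp add: c_def algebra_simps power2_eq_square power3_eq_cube)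
    have "\<not> 3 dvd c"
    proof
      assume "3 dvd c"
      moreover have "3 dvd A\<^sup>2 * t" using \<open>3 dvd A\<close> by (simp add: power2_eq_square)
      ultimately have "3 dvd int r * (- 4) ^ k" unfolding c_def by (metis dvd_add_left_iff)
      moreover have "prime (3::int)" by simp
      ultimately have "3 dvd int r \<or> (3::int) dvd - 4" using prime_dvd_mult_iff prime_dvd_power by metis
      hence "3 dvd r" by (auto simp: int_dvd_int_iff[symmetric])
      thus False using r(1) False primes_dvd_imp_eq[of 3 r] by auto
    qed
    moreover have "c dvd 3 ^ l"
    proof -
      have "c dvd qre A 4 r" unfolding Ac by simp
      thus ?thesis using R' B by (metis dvd_abs_iff)
    qed
    ultimately have "\<bar>c\<bar> = 1" by (intro abs_eq_1_if_dvd_3_power)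
    hence "\<bar>A\<bar> = 3 ^ l" using R' B Ac by (simp add: abs_mult)
    hence "A\<^sup>2 = (3 ^ l)\<^sup>2" by (metis power2_abs)
    hence "int p ^ i = int p ^ j" using NAB B e by simp
    hence "i = j" using prime_gt_1_nat[OF p] by (simp add: power_inject_exp)
    thus False using i i0 r(1) by auto
  qed
qed

text \<open>
  The same argument with \<open>2 + 3 ^ l * sqrt (- 3)\<close>. Now \<open>A\<close> must be \<open>\<plusminus> 2\<close> by parity, and the
  coefficient is prime to \<open>3\<close> unless \<open>r = 3\<close>, where the cofactor \<open>4 - 9 * B\<^sup>2\<close> of \<open>A\<close> is not \<open>\<plusminus>
  1\<close>.
\<close>

lemma three_times_power_of_9_plus_4:
  assumes p: "prime p" and e: "4 + 3 * (3 ^ l)\<^sup>2 = int p ^ j" and j: "odd j" "j > 1"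
  shows False
proof -
  have pp: "prime (int p)" using p by simp
  have odd_pj: "odd (int p ^ j)" unfolding e[symmetric] by simp
  hence odd_p: "odd p" using j by simp
  have p2: "\<not> int p dvd 2"
  proof
    assume "int p dvd 2"
    hence "int p = 2" using pp primes_dvd_imp_eq[of "int p" 2] by simp
    thus False using odd_p by simp
  qed
  have pdvd: "int p dvd 2\<^sup>2 + 3 * (3 ^ l)\<^sup>2" using e j by (simp add: dvd_power)
  have p3: "\<not> int p dvd 3"
  proof
    assume "int p dvd 3"
    hence "int p dvd 3 * (3 ^ l)\<^sup>2" by simp
    hence "int p dvd 2\<^sup>2" using pdvd by (metis dvd_add_left_iff)
    thus False using p2 pp prime_dvd_power by blast
  qed
  have p3l: "\<not> int p dvd 3 ^ l" using p3 pp prime_dvd_power by blast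
  obtain a b1 where ab1: "a\<^sup>2 + 3 * b1\<^sup>2 = int p"
    using prime_eq_square_plus_3_square[OF p odd_p pdvd p3l] by blast
  have "int p dvd 3 ^ l * a - 2 * b1 \<or> int p dvd 3 ^ l * a + 2 * b1"
    by (rule dvd_conjugate_cases[of p a 3 b1 j 2 "3 ^ l"]) (use p ab1 e j in auto)
  then obtain b where b: "a\<^sup>2 + 3 * b\<^sup>2 = int p" "int p dvd 3 ^ l * a - 2 * b"
  proof
    assume "int p dvd 3 ^ l * a - 2 * b1" thus ?thesis using that ab1 by blast
  next
    assume "int p dvd 3 ^ l * a + 2 * b1" thus ?thesis using that[of "- b1"] ab1 by simp
  qed
  let ?w = "3 * b\<^sup>2"
  obtain f g where fg: "f\<^sup>2 + 3 * g\<^sup>2 = 1"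
    "2 = f * qre a ?w j - 3 * g * (b * qim a ?w j)"
    "3 ^ l = f * (b * qim a ?w j) + g * qre a ?w j"
    using norm_form_descent[of p a 3 b 2 "3 ^ l" j] p b e p2 p3 j by auto
  have g0: "g = 0"
  proof (rule ccontr)
    assume "g \<noteq> 0"
    hence "g\<^sup>2 \<ge> 1" by (simp add: int_one_le_iff_zero_less)
    thus False using fg(1) zero_le_power2[of f] by linarith
  qed
  hence f1: "\<bar>f\<bar> = 1" using fg(1) by (simp add: abs_square_eq_1)
  have R: "\<bar>qre a ?w j\<bar> = 2"
  proof -
    have "f * qre a ?w j = 2" using fg(2) g0 by simp
    hence "\<bar>f\<bar> * \<bar>qre a ?w j\<bar> = \<bar>2\<bar>" by (metis abs_mult)
    thus ?thesis using f1 by simp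
  qed
  have U: "\<bar>b * qim a ?w j\<bar> = 3 ^ l"
  proof -
    have "f * (b * qim a ?w j) = 3 ^ l" using fg(3) g0 by simp
    hence "\<bar>f\<bar> * \<bar>b * qim a ?w j\<bar> = \<bar>3 ^ l\<bar>" by (metis abs_mult)
    thus ?thesis using f1 by simp
  qed
  obtain r where r: "prime r" "r dvd j" using j prime_factor_nat[of j] by auto
  then obtain i where i: "j = i * r" by (metis dvd_def mult.commute)
  have i0: "i > 0" using i j by (cases i) auto
  have odd_r: "odd r" using i j by simp
  obtain k where k: "r = 2 * k + 1" using odd_r by (elim oddE)
  define A B where "A = qre a ?w i" and "B = b * qim a ?w i"
  have R': "\<bar>qre A (3 * B\<^sup>2) r\<bar> = 2" and U': "\<bar>B * qim A (3 * B\<^sup>2) r\<bar> = 3 ^ l"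
    using R U unfolding i qre_qim_mult A_def B_def by (simp_all add: power_mult_distrib mult_ac)
  have NAB: "A\<^sup>2 + 3 * B\<^sup>2 = int p ^ i"
    using qre_qim_norm[of a ?w i] b(1) by (simp add: A_def B_def power_mult_distrib mult_ac)
  have even_A: "even A"
  proof (rule ccontr)
    assume "odd A"
    have "odd (A\<^sup>2 + 3 * B\<^sup>2)" unfolding NAB using odd_p by simp
    hence "even B" using \<open>odd A\<close> by simp
    hence "even \<bar>B * qim A (3 * B\<^sup>2) r\<bar>" by simp
    thus False unfolding U' by simp
  qed
  have "A ^ 3 dvd qre A (3 * B\<^sup>2) r - int r * A * (- (3 * B\<^sup>2)) ^ k"
    using qre_qim_odd_cong[of A "3 * B\<^sup>2" k] k by blast
  then obtain t where t: "qre A (3 * B\<^sup>2) r - int r * A * (- (3 * B\<^sup>2)) ^ k = A ^ 3 * t" by (elim dvdE)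
  have "qre A (3 * B\<^sup>2) r = A * (int r * (- (3 * B\<^sup>2)) ^ k + A\<^sup>2 * t)"
    using t by (simp add: algebra_simps power2_eq_square power3_eq_cube)
  then obtain c where c: "qre A (3 * B\<^sup>2) r = A * c" by blast
  obtain A' where A': "A = 2 * A'" using even_A by (elim evenE)
  have "\<bar>2 * (A' * c)\<bar> = 2" using R' c A' by (metis mult.assoc)
  hence "\<bar>A' * c\<bar> = 1" by linarith
  hence "\<bar>A'\<bar> = 1" and c1: "\<bar>c\<bar> = 1" by (metis abs_zmult_eq_1 mult.commute)+
  hence A2: "A\<^sup>2 = 4" using A' by (auto simp: power2_eq_square abs_if split: if_splits)
  show False
  proof (cases "r = 3")
    case True
    have "qre A (3 * B\<^sup>2) 3 = A * (A\<^sup>2 - 9 * B\<^sup>2)" by (simp add: numeral_eq_Suc algebra_simps)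
    moreover have "A \<noteq> 0" using A2 by auto
    ultimately have "c = 4 - 9 * B\<^sup>2" using c True A2 by auto
    thus False using c1 by presburger
  next
    case False
    have "3 * B\<^sup>2 dvd qim A (3 * B\<^sup>2) r - int r * A ^ (2 * k)"
      using qim_cong_w[of "3 * B\<^sup>2" A "2 * k"] k by (simp del: qim.simps)
    hence d3: "3 dvd qim A (3 * B\<^sup>2) r - int r * A ^ (2 * k)" by (rule dvd_mult_left)
    have "\<not> 3 dvd qim A (3 * B\<^sup>2) r"
    proof
      assume "3 dvd qim A (3 * B\<^sup>2) r"
      hence "3 dvd int r * A ^ (2 * k)" using d3 by (metis dvd_diff_right_iff)
      moreover have "A ^ (2 * k) = 4 ^ k" using A2 by (simp add: power_mult)
      moreover have "prime (3::int)" by simp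
      ultimately have "3 dvd int r \<or> (3::int) dvd 4" using prime_dvd_mult_iff prime_dvd_power by metis
      hence "3 dvd r" by (auto simp: int_dvd_int_iff[symmetric])
      thus False using r(1) False primes_dvd_imp_eq[of 3 r] by auto
    qed
    moreover have "qim A (3 * B\<^sup>2) r dvd 3 ^ l" unfolding U'[symmetric] by simp
    ultimately have "\<bar>qim A (3 * B\<^sup>2) r\<bar> = 1" by (intro abs_eq_1_if_dvd_3_power)
    hence "\<bar>B\<bar> = 3 ^ l" using U' by (simp add: abs_mult)
    hence "B\<^sup>2 = (3 ^ l)\<^sup>2" by (metis power2_abs)
    hence "int p ^ i = int p ^ j" using NAB A2 e by simp
    hence "i = j" using prime_gt_1_nat[OF p] by (simp add: power_inject_exp)
    thus False using i i0 r(1) by auto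
  qed
qed

lemma power_of_3_plus_4:
  assumes "prime p" "4 + 3 ^ k = int p ^ j" "k > 0"
  shows "j = 1"
proof (rule ccontr)
  assume "j \<noteq> 1"
  moreover have "j \<noteq> 0"
  proof
    assume "j = 0"
    hence "4 + (3::int) ^ k = 1" using assms(2) by simp
    moreover have "(3::int) ^ k > 0" by simp
    ultimately show False by linarith
  qed
  ultimately have j1: "j > 1" by simp
  have "odd j"
  proof
    assume "even j"
    then obtain i where "j = 2 * i" by (elim evenE)
    thus False using power_of_3_plus_4_even[of k p i] assms(2) by (simp add: power_mult[symmetric] mult.commute)
  qed
  show False
  proof (cases "even k")
    case True
    then obtain l where "k = 2 * l" by (elim evenE)
    thus False using power_of_9_plus_4[OF assms(1) _ _ \<open>odd j\<close> j1, of l] assms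
      by (simp add: power_mult[symmetric] mult.commute add.commute)
  next
    case False
    then obtain l where "k = 2 * l + 1" by (elim oddE)
    thus False using three_times_power_of_9_plus_4[OF assms(1) _ \<open>odd j\<close> j1, of l] assms
      by (simp add: power_mult[symmetric] mult.commute add.commute)
  qed
qed

text \<open>
  Modulo \<open>16\<close> the exponent is \<open>2 * f\<close> with \<open>f\<close> odd. The two coprime factors of \<open>(3 ^ f - 1) / 2 *
  ((3 ^ f + 1) / 4) = a\<^sup>2\<close> are squares, so \<open>3 ^ f = (2 * b - 1) * (2 * b + 1)\<close>.
\<close>

lemma power_of_3_eq_8_square_plus_1:
  fixes a :: int
  assumes e: "3 ^ e = 8 * a\<^sup>2 + 1" and a: "odd a"
  shows "a\<^sup>2 = 1"
proof -
  obtain m where m: "a = 2 * m + 1" using a by (elim oddE)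
  have "(3::int) ^ e mod 16 = 9"
  proof -
    have "(3::int) ^ e = 9 + 16 * (2 * m * m + 2 * m)" unfolding e m by (simp add: algebra_simps power2_eq_square)
    thus ?thesis by (metis mod_mult_self2 mod_pos_pos_trivial zero_le_numeral numeral_less_iff semiring_norm(76,78,79,80,81))
  qed
  moreover have "(3::int) ^ e mod 16 = 3 ^ (e mod 4) mod 16"
    by (rule power_mod_period) simp
  moreover have "e mod 4 = 0 \<or> e mod 4 = 1 \<or> e mod 4 = 2 \<or> e mod 4 = 3" by presburger
  ultimately have "e mod 4 = 2" by auto
  then obtain g where "e = 2 + 4 * g" by (metis mod_mult_div_eq)
  then obtain f where f: "e = 2 * f" "odd f" using that[of "2 * g + 1"] by simp
  have "(3::int) ^ f mod 8 = 3 ^ (f mod 2) mod 8" by (rule power_mod_period) simp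
  hence "(3::int) ^ f mod 8 = 3" using f by (simp add: odd_iff_mod_2_eq_one)
  then obtain n where n: "(3::int) ^ f = 3 + 8 * n" by (metis mod_mult_div_eq)
  have n0: "n \<ge> 0"
  proof -
    have "(3::int) ^ f > 0" by simp
    thus ?thesis using n by linarith
  qed
  have "(3 + 8 * n)\<^sup>2 = 8 * a\<^sup>2 + 1"
    using e unfolding f n[symmetric] by (simp add: power_mult[symmetric] mult.commute)
  hence "(4 * n + 1) * (2 * n + 1) = a\<^sup>2" by (simp add: algebra_simps power2_eq_square)
  hence nat_eq: "nat (2 * n + 1) * nat (4 * n + 1) = (nat \<bar>a\<bar>)\<^sup>2"
    using n0 by (simp add: nat_mult_distrib[symmetric] nat_power_eq[symmetric] mult.commute)
  have "coprime (2 * n + 1) (4 * n + 1)"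
  proof (rule coprimeI)
    fix d assume d: "d dvd 2 * n + 1" "d dvd 4 * n + 1"
    hence "d dvd 2 * (2 * n + 1) - (4 * n + 1)" by (intro dvd_diff dvd_mult)
    thus "is_unit d" by simp
  qed
  hence "coprime (nat (2 * n + 1)) (nat (4 * n + 1))"
    using n0 by (metis add_nonneg_nonneg coprime_int_iff int_nat_eq mult_nonneg_nonneg zero_le_numeral zero_le_one)
  moreover have "is_nth_power 2 (nat (2 * n + 1) * nat (4 * n + 1))"
    unfolding nat_eq is_nth_power_def by blast
  ultimately have "is_nth_power 2 (nat (2 * n + 1))"
    using n0 by (auto intro: is_nth_power_mult_coprime_natD(1))
  then obtain b0 where "nat (2 * n + 1) = b0 ^ 2" by (auto simp: is_nth_power_def)
  then obtain b :: int where b: "2 * n + 1 = b\<^sup>2" "b \<ge> 0"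
    using n0 by (metis add_nonneg_nonneg int_nat_eq mult_nonneg_nonneg of_nat_0_le_iff of_nat_power zero_le_numeral zero_le_one)
  have fac: "(2 * b - 1) * (2 * b + 1) = 3 ^ f"
    unfolding n using b(1) by (simp add: algebra_simps power2_eq_square)
  have "\<bar>2 * b - 1\<bar> = 1"
  proof (rule abs_eq_1_if_dvd_3_power[of _ f], goal_cases)
    case 1 show ?case unfolding fac[symmetric] by simp
  next
    case 2
    show ?case
    proof
      assume "3 dvd 2 * b - 1"
      hence "\<not> 3 dvd 2 * b + 1" by presburger
      moreover have "2 * b + 1 dvd 3 ^ f" unfolding fac[symmetric] by simp
      ultimately have "\<bar>2 * b + 1\<bar> = 1" by (intro abs_eq_1_if_dvd_3_power)
      hence "b = 0" using b(2) by linarith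
      thus False using \<open>3 dvd 2 * b - 1\<close> by simp
    qed
  qed
  hence "b = 0 \<or> b = 1" by linarith
  hence "n = 0" using b(1) by auto
  thus ?thesis using \<open>(4 * n + 1) * (2 * n + 1) = a\<^sup>2\<close> by simp
qed

section \<open>Exponents divisible by 3 and the bound for the exponent\<close>

lemma eq_prime_power_if_only_prime_factor:
  fixes V :: int
  assumes "V > 0" and only: "\<And>q::int. prime q \<Longrightarrow> q dvd V \<Longrightarrow> q = int p"
  shows "\<exists>k. V = int p ^ k"
proof -
  have "\<forall>q\<in>prime_factors (nat V). q = p"
  proof
    fix q assume "q \<in> prime_factors (nat V)"
    hence "prime q" "q dvd nat V" by auto
    hence "prime (int q)" "int q dvd V" using assms(1) by (auto simp: int_dvd_int_iff[symmetric])
    hence "int q = int p" by (rule only)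
    thus "q = p" by simp
  qed
  hence sub: "prime_factors (nat V) \<subseteq> {p}" by auto
  have "nat V = (\<Prod>q\<in>prime_factors (nat V). q ^ multiplicity q (nat V))"
    using assms(1) by (subst prime_factorization_nat) auto
  also have "\<dots> = p ^ (if p \<in> prime_factors (nat V) then multiplicity p (nat V) else 0)"
  proof (cases "p \<in> prime_factors (nat V)")
    case True
    hence "prime_factors (nat V) = {p}" using sub by blast
    thus ?thesis using True by simp
  next
    case False
    hence "prime_factors (nat V) = {}" using sub by blast
    thus ?thesis using False by simp
  qed
  finally obtain k where "nat V = p ^ k" by blast
  hence "V = int p ^ k" using assms(1) by (metis int_nat_eq less_imp_le of_nat_power)
  thus ?thesis by blast
qed

text \<open>
  The coefficient is \<open>3 * A\<^sup>2 - w\<close> and its prime factors can only be \<open>3\<close>; the real part is \<open>A *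
  (A\<^sup>2 - 3 * w)\<close>, and these factors share at most the prime \<open>3\<close>. If \<open>\<bar>A\<bar> \<noteq> 1\<close>, the single prime
  factor of the real part forces \<open>A\<^sup>2 - 3 * w = 1\<close>, whence \<open>8 * A\<^sup>2 + 1\<close> is a power of \<open>3\<close>, or \<open>3\<close>
  divides \<open>A\<close> and \<open>w\<close> is close to both \<open>3 * A\<^sup>2\<close> and \<open>A\<^sup>2 / 3\<close>. So \<open>A = \<plusminus> 1\<close> and \<open>3 - w\<close> is up to
  sign a power of \<open>3\<close>, and \<open>1 + w\<close> turns out to be a prime.
\<close>

lemma exponent_3:
  fixes A w :: int
  assumes p: "prime p" and w: "even w" "w > 0" and N: "A\<^sup>2 + w = int p ^ D"
    and U: "\<And>q::int. prime q \<Longrightarrow> q dvd qim A w 3 \<Longrightarrow> q dvd w"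
    and pX: "\<not> int p dvd qre A w 3"
    and X: "\<And>q q'::int. prime q \<Longrightarrow> prime q' \<Longrightarrow> q dvd qre A w 3 \<Longrightarrow> q' dvd qre A w 3 \<Longrightarrow> q = q'"
    and D: "D > 0"
  shows "D = 1"
proof -
  have U3: "qim A w 3 = 3 * A\<^sup>2 - w" and X3: "qre A w 3 = A * (A\<^sup>2 - 3 * w)"
    by (simp_all add: numeral_eq_Suc algebra_simps)
  define c where "c = A\<^sup>2 - 3 * w"
  have Xc: "qre A w 3 = A * c" by (simp add: X3 c_def)
  have X0: "A \<noteq> 0" using pX Xc by auto
  have cop: "coprime A w" using p N pX Xc by (intro coprime_A_w) auto
  have copq: "\<not> q dvd A" if "prime q" "q dvd w" for q :: int
    using cop that by (meson coprime_common_divisor not_prime_unit)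
  have p3: "prime (3::int)" by simp
  have Uq: "q = 3 \<and> 3 dvd w" if q: "prime q" "q dvd 3 * A\<^sup>2 - w" for q :: int
  proof -
    have qw: "q dvd w" using U[OF q(1)] q(2) U3 by simp
    hence "q dvd (3 * A\<^sup>2 - w) + w" using q(2) by (intro dvd_add)
    hence "q dvd 3 * A\<^sup>2" by simp
    hence "q dvd 3 \<or> q dvd A" using q(1) by (metis prime_dvd_mult_iff prime_dvd_power)
    hence "q dvd 3" using copq q(1) qw by blast
    thus ?thesis using q(1) p3 qw primes_dvd_imp_eq by blast
  qed
  have "\<bar>A\<bar> = 1"
  proof (cases "3 dvd A")
    case True
    hence nw: "\<not> 3 dvd w" using copq[OF p3] by blast
    hence "\<bar>3 * A\<^sup>2 - w\<bar> = 1" using Uq by (intro abs_eq_1_if_no_prime) blast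
    moreover obtain B where B: "A = 3 * B" using True by (elim dvdE)
    have c9: "c = 3 * (3 * B\<^sup>2 - w)" by (simp add: c_def B power2_eq_square)
    have "\<bar>c\<bar> = 1 \<or> \<bar>c\<bar> = 3"
    proof (rule abs_eq_1_or_prime[OF p3])
      fix q :: int assume "prime q" "q dvd c"
      thus "q = 3" using X[of q 3] Xc True by simp
    next
      show "\<not> 3\<^sup>2 dvd c"
      proof
        assume "3\<^sup>2 dvd c"
        hence "(3::int) * 3 dvd 3 * (3 * B\<^sup>2 - w)" unfolding c9 by (simp add: power2_eq_square)
        hence "3 dvd 3 * B\<^sup>2 - w" by (simp only: dvd_times_left_cancel_iff)
        thus False using nw by presburger
      qed
    qed
    hence "\<bar>A\<^sup>2 - 3 * w\<bar> = 1 \<or> \<bar>A\<^sup>2 - 3 * w\<bar> = 3" by (simp add: c_def)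
    moreover have "A\<^sup>2 = 9 * B\<^sup>2" by (simp add: B power2_eq_square)
    moreover have "B\<^sup>2 > 0" using X0 B by simp
    ultimately have "w \<ge> 27 * B\<^sup>2 - 1" "A\<^sup>2 - 3 * w \<ge> -3" "A\<^sup>2 = 9 * B\<^sup>2" "B\<^sup>2 \<ge> 1" by linarith+
    hence False by linarith
    thus ?thesis ..
  next
    case False
    show ?thesis
    proof (rule ccontr)
      assume "\<bar>A\<bar> \<noteq> 1"
      then obtain q where q: "prime q" "q dvd A" by (metis prime_factor_int)
      have "\<bar>c\<bar> = 1"
      proof (rule abs_eq_1_if_no_prime, rule notI)
        fix q' :: int assume q': "prime q'" "q' dvd c"
        hence "q' = q" using X[of q' q] q Xc by simp
        hence qA: "q' dvd A" using q by simp
        hence "q' dvd A\<^sup>2" by (simp add: power2_eq_square)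
        hence "q' dvd A\<^sup>2 - c" using q' by (intro dvd_diff)
        hence "q' dvd 3 * w" by (simp add: c_def)
        hence "q' dvd 3 \<or> q' dvd w" using q' by (simp add: prime_dvd_mult_iff)
        hence "q' dvd 3" using copq q' qA by blast
        hence "q' = 3" using q' p3 primes_dvd_imp_eq by blast
        thus False using False qA by simp
      qed
      hence "A\<^sup>2 - 3 * w = 1 \<or> A\<^sup>2 - 3 * w = -1" by (simp add: c_def) linarith
      moreover have "A\<^sup>2 mod 3 \<noteq> 2"
      proof -
        have "A\<^sup>2 mod 3 = (A mod 3)\<^sup>2 mod 3" by (simp add: power_mod)
        moreover have "A mod 3 = 0 \<or> A mod 3 = 1 \<or> A mod 3 = 2" by presburger
        ultimately show ?thesis by auto
      qed
      ultimately have Aw: "A\<^sup>2 = 3 * w + 1" by presburger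
      define V where "V = 3 * A\<^sup>2 - w"
      have V3: "3 * V = 8 * A\<^sup>2 + 1" using Aw by (simp add: V_def)
      have V0: "V > 0" using V3 zero_le_power2[of A] by linarith
      have "\<exists>k. V = 3 ^ k"
      proof -
        have "\<exists>k. V = int 3 ^ k"
          by (rule eq_prime_power_if_only_prime_factor[OF V0]) (use Uq in \<open>simp add: V_def\<close>)
        thus ?thesis by simp
      qed
      then obtain k where "V = 3 ^ k" by blast
      hence "3 ^ Suc k = 8 * A\<^sup>2 + 1" using V3 by simp
      moreover have "odd A"
      proof
        assume "even A"
        hence "even (A\<^sup>2)" by simp
        thus False using Aw w by simp
      qed
      ultimately have "A\<^sup>2 = 1" by (rule power_of_3_eq_8_square_plus_1)
      thus False using \<open>\<bar>A\<bar> \<noteq> 1\<close> by (auto simp: power2_eq_1_iff)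
    qed
  qed
  hence A2: "A\<^sup>2 = 1" by (simp add: abs_square_eq_1)
  have D1: "D = 1" if "prime (p ^ D)" using that by (simp add: prime_power_iff)
  have pD: "p ^ D = nat n \<and> n = 1 + w" if "1 + w = n" for n
    using N A2 that by (metis nat_int of_nat_power)
  show ?thesis
  proof (cases "w = 2 \<or> w = 4")
    case True
    hence "p ^ D = 3 \<or> p ^ D = 5" using pD by fastforce
    hence "prime (p ^ D)" by auto
    thus ?thesis by (rule D1)
  next
    case False
    define V where "V = w - 3"
    have V1: "V > 1" using w False unfolding V_def by presburger
    have "\<exists>k. V = int 3 ^ k"
    proof (rule eq_prime_power_if_only_prime_factor)
      show "V > 0" using V1 by simp
      fix q :: int assume q: "prime q" "q dvd V"
      have "V = - (3 * A\<^sup>2 - w)" by (simp add: V_def A2)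
      hence "q dvd 3 * A\<^sup>2 - w" using q(2) by (metis dvd_minus_iff)
      thus "q = int 3" using Uq q(1) by simp
    qed
    then obtain k where k: "V = 3 ^ k" by auto
    have "k > 0" using k V1 by (cases k) auto
    moreover have "4 + 3 ^ k = int p ^ D" using N A2 k by (simp add: V_def)
    ultimately show ?thesis using power_of_3_plus_4[OF p] by blast
  qed
qed

lemma only_prime_factors_2_or_3:
  fixes s :: nat
  assumes "s > 0" "\<not> s dvd 2"
  obtains "4 dvd s" | r where "prime r" "r dvd s" "r \<ge> 3"
proof (cases "\<exists>r. prime r \<and> r dvd s \<and> r \<ge> 3")
  case False
  hence two: "r = 2" if "prime r" "r dvd s" for r
  proof -
    have "\<not> r \<ge> 3" using False that by blast
    thus ?thesis using prime_ge_2_nat[OF that(1)] by linarith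
  qed
  have "s \<noteq> 1" using assms by auto
  then obtain r where "prime r" "r dvd s" using prime_factor_nat by blast
  then obtain t where t: "s = 2 * t" using two by blast
  have "t \<noteq> 1" using t assms by auto
  then obtain r where "prime r" "r dvd t" using prime_factor_nat by blast
  hence "2 dvd t" using two t by (metis dvd_mult)
  hence "4 dvd s" using t by auto
  thus ?thesis by (rule that)
qed (use that in blast)

text \<open>
  Reduction of a composite exponent \<open>s\<close> to \<open>4\<close> or to an odd prime \<open>r\<close>, by replacing \<open>A + \<theta>\<close> by its
  power with exponent \<open>s / 4\<close> or \<open>s / r\<close>. The cases for \<open>4\<close> and \<open>r\<close> all say that the norm of that
  power is \<open>p\<close> itself, which determines \<open>T * s\<close>.
\<close>

lemma exponent_bound:
  fixes A w :: int
  assumes p: "prime p" and w: "even w" "w > 0" and N: "A\<^sup>2 + w = int p ^ T" and T: "T > 0" and s: "s > 0"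
    and U: "\<And>q::int. prime q \<Longrightarrow> q dvd qim A w s \<Longrightarrow> q dvd w"
    and U0: "qim A w s \<noteq> 0"
    and pX: "\<not> int p dvd qre A w s"
    and X: "\<And>q q'::int. prime q \<Longrightarrow> prime q' \<Longrightarrow> q dvd qre A w s \<Longrightarrow> q' dvd qre A w s \<Longrightarrow> q = q'"
  shows "s dvd 2 \<or> T * s = 3 \<or> (T * s = 4 \<and> p = 3 \<and> \<bar>qre A w s\<bar> = 7) \<or>
         (T * s = 5 \<and> p = 11 \<and> \<bar>qre A w s\<bar> = 401)"
proof (cases "s dvd 2")
  case False
  define A' w' where "A' = (\<lambda>i. qre A w i)" and "w' = (\<lambda>i. w * (qim A w i)\<^sup>2)"
  have re: "qre A w s = qre (A' i) (w' i) r" and im: "qim A w s = qim A w i * qim (A' i) (w' i) r"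
    if "s = i * r" for i r using that by (simp_all add: qre_qim_mult A'_def w'_def)
  have w'e: "even (w' i)" for i using w by (simp add: w'_def)
  have w'p: "w' i > 0" if "s = i * r" for i r using w im[OF that] U0 by (auto simp: w'_def)
  have N': "(A' i)\<^sup>2 + w' i = int p ^ (T * i)" for i
    using qre_qim_norm[of A w i] N by (simp add: A'_def w'_def power_mult)
  have U': "q dvd w' i" if "s = i * r" "prime q" "q dvd qim (A' i) (w' i) r" for i r and q :: int
    using U[OF that(2)] im[OF that(1)] that(3) by (simp add: w'_def)
  have nat_eq: "p ^ e = n" if "int p ^ e = int n" for e n using that by (metis of_nat_eq_iff of_nat_power)
  from s False show ?thesis
  proof (cases rule: only_prime_factors_2_or_3)
    case 1
    then obtain i where i: "s = i * 4" by (metis dvd_def mult.commute)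
    have "int p ^ (T * i) = 3 \<and> \<bar>qre (A' i) (w' i) 4\<bar> = 7"
      by (rule exponent_4[OF p w'p[OF i] N']) (use U'[OF i] pX re[OF i] in auto)
    hence e: "p ^ (T * i) = 3" "\<bar>qre A w s\<bar> = 7" using nat_eq[of _ 3] re[OF i] by auto
    hence "prime (p ^ (T * i))" by simp
    hence "T * i = 1" by (simp add: prime_power_iff)
    thus ?thesis using e i by auto
  next
    case (2 r)
    then obtain i where i: "s = i * r" by (metis dvd_def mult.commute)
    have i0: "T * i > 0" using i s T by (cases i) auto
    show ?thesis
    proof (cases "r = 3")
      case True
      have "T * i = 1"
        by (rule exponent_3[OF p w'e w'p[OF i] N' _ _ _ i0]) (use U'[OF i] pX re[OF i] X True in auto)
      thus ?thesis using i True by auto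
    next
      case False
      moreover have "r \<noteq> 4" using 2(1) by auto
      ultimately have "r \<ge> 5" using 2(3) by linarith
      hence r: "r = 5 \<and> int p ^ (T * i) = 11 \<and> \<bar>qre (A' i) (w' i) r\<bar> = 401"
        by (rule prime_exponent_ge_5[OF 2(1) _ p w'e w'p[OF i] N']) (use U'[OF i] pX re[OF i] X in auto)
      hence e: "p ^ (T * i) = 11" "\<bar>qre A w s\<bar> = 401" using nat_eq[of _ 11] re[OF i] by auto
      hence "prime (p ^ (T * i))" by simp
      hence "T * i = 1" by (simp add: prime_power_iff)
      thus ?thesis using e i r by auto
    qed
  qed
qed auto

section \<open>Quadratic algebraic integers\<close>

definition sqrtm :: "nat \<Rightarrow> complex" where "sqrtm P = csqrt (of_int (- int P))"

abbreviation OK :: "nat \<Rightarrow> complex set" where "OK P \<equiv> carrier (ring_of_integers (- int P))"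

lemma sqrtm_eq: "sqrtm P = \<i> * of_real (sqrt (real P))"
  unfolding sqrtm_def
proof (rule csqrt_unique)
  show "(\<i> * complex_of_real (sqrt (real P)))\<^sup>2 = of_int (- int P)"
    by (simp add: power_mult_distrib flip: of_real_power)
qed auto

lemma sqrtm_square: "sqrtm P * sqrtm P = - of_nat P"
  using power2_csqrt[of "of_int (- int P)"] unfolding sqrtm_def by (simp add: power2_eq_square)

lemma cnj_sqrtm: "cnj (sqrtm P) = - sqrtm P"
  by (simp add: sqrtm_eq)

text \<open>
  Evaluation at a complex number of polynomials with integer coefficients, to which the theory of
  contents applies.
\<close>

definition int_eval :: "int poly \<Rightarrow> complex \<Rightarrow> complex" where
  "int_eval p z = poly (map_poly of_int p) z"

lemma int_eval_pCons: "int_eval (pCons a p) z = of_int a + z * int_eval p z"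
  by (simp add: int_eval_def map_poly_pCons)

lemma int_eval_0: "int_eval 0 z = 0"
  by (simp add: int_eval_def)

lemma int_eval_add: "int_eval (p + q) z = int_eval p z + int_eval q z"
  by (induction p q rule: poly_induct2) (simp_all add: int_eval_pCons int_eval_0 algebra_simps)

lemma int_eval_smult: "int_eval (Polynomial.smult a p) z = of_int a * int_eval p z"
  by (induction p) (simp_all add: int_eval_pCons int_eval_0 algebra_simps)

lemma int_eval_mult: "int_eval (p * q) z = int_eval p z * int_eval q z"
  by (induction p) (simp_all add: int_eval_pCons int_eval_0 int_eval_add int_eval_smult algebra_simps)

text \<open>
  Gauss's lemma: comparing contents shows that \<open>c\<close> divides \<open>g\<close>, so \<open>Q\<close> divides the monic \<open>f\<close> over
  the integers.
\<close>

lemma primitive_factor_of_monic: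
  fixes f Q g :: "int poly"
  assumes f: "lead_coeff f = 1" and Q: "Polynomial.content Q = 1" and c: "c \<noteq> 0" and eq: "Polynomial.smult c f = Q * g"
  shows "is_unit (lead_coeff Q)"
proof -
  have "Polynomial.content f dvd 1" using f by (metis content_dvd_coeff)
  hence cf: "Polynomial.content f = 1" by (metis is_unit_content_iff is_unit_normalize normalize_content)
  have "Polynomial.content (Polynomial.smult c f) = Polynomial.content g" unfolding eq by (simp add: content_mult Q)
  hence "normalize c = Polynomial.content g" using cf by simp
  moreover have "[:Polynomial.content g:] dvd g" by simp
  ultimately have "[:c:] dvd g" by (metis const_poly_dvd_iff normalize_dvd_iff content_dvd_coeff)
  then obtain g' where g': "g = Polynomial.smult c g'" by (auto elim!: dvdE)
  have "Polynomial.smult c f = Polynomial.smult c (Q * g')" unfolding eq g' by simp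
  hence "Polynomial.smult c (f - Q * g') = 0" by (simp add: smult_diff_right)
  hence "f = Q * g'" using c by simp
  hence "lead_coeff Q * lead_coeff g' = 1" using f by (simp add: lead_coeff_mult)
  thus ?thesis by (metis dvd_triv_left)
qed

text \<open>
  A monic annihilating polynomial of \<open>z\<close> has zero pseudo-remainder modulo \<open>Q\<close>, by minimality of
  the degree.
\<close>

lemma lead_coeff_primitive_annihilator:
  assumes z: "algebraic_int z" and Q: "Polynomial.content Q = 1" "int_eval Q z = 0"
    and minimal: "\<And>r. degree r < degree Q \<Longrightarrow> int_eval r z = 0 \<Longrightarrow> r = 0"
  shows "is_unit (lead_coeff Q)"
proof -
  obtain f where f: "int_eval f z = 0" "lead_coeff f = 1"
    using z unfolding algebraic_int_altdef_ipoly int_eval_def by blast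
  have Q0: "Q \<noteq> 0" using Q by auto
  obtain q r where qr: "pseudo_divmod f Q = (q, r)" by (cases "pseudo_divmod f Q") auto
  note pd = pseudo_divmod[OF Q0 qr]
  let ?c = "lead_coeff Q ^ (Suc (degree f) - degree Q)"
  have "r = 0"
  proof (cases "r = 0")
    case False
    hence deg: "degree r < degree Q" using pd(2) by blast
    have "int_eval (Polynomial.smult ?c f) z = int_eval (Q * q + r) z" using pd(1) by simp
    hence "int_eval r z = 0" using f Q(2) by (simp add: int_eval_add int_eval_mult int_eval_smult)
    thus ?thesis using minimal deg by blast
  qed
  hence "Polynomial.smult ?c f = Q * q" using pd(1) by simp
  thus ?thesis by (rule primitive_factor_of_monic[OF f(2) Q(1), rotated]) (use Q0 in simp)
qed

lemma primitive_multiple: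
  fixes p :: "int poly"
  assumes "p \<noteq> 0"
  obtains c q where "c > 0" "p = Polynomial.smult c q" "Polynomial.content q = 1"
proof
  show "Polynomial.content p > 0" using assms by (metis content_eq_zero_iff normalize_content int_one_le_iff_zero_less abs_ge_zero normalize_int_def order_le_less zero_le_one abs_of_nonneg less_le)
  show "p = Polynomial.smult (Polynomial.content p) (primitive_part p)" by simp
  show "Polynomial.content (primitive_part p) = 1" using assms by simp
qed

text \<open>
  Trace and norm of a quadratic algebraic integer are integers: the primitive multiple of its
  quadratic polynomial has leading coefficient \<open>1\<close>. No linear polynomial can vanish at a nonreal
  number.
\<close>

lemma algebraic_int_nonreal:
  fixes z :: complex and T N :: rat
  assumes z: "algebraic_int z" and im: "Im z \<noteq> 0" and root: "z\<^sup>2 - of_rat T * z + of_rat N = 0"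
  shows "\<exists>t n. T = of_int t \<and> N = of_int n"
proof -
  obtain t1 t2 where t: "quotient_of T = (t1, t2)" by (cases "quotient_of T")
  obtain n1 n2 where n: "quotient_of N = (n1, n2)" by (cases "quotient_of N")
  have t0: "t2 > 0" and T: "T = of_int t1 / of_int t2"
    using quotient_of_denom_pos[OF t] quotient_of_div[OF t] by auto
  have n0: "n2 > 0" and N: "N = of_int n1 / of_int n2"
    using quotient_of_denom_pos[OF n] quotient_of_div[OF n] by auto
  define Q0 where "Q0 = [:n1 * t2, - t1 * n2, t2 * n2:]"
  have "Q0 \<noteq> 0" using t0 n0 by (simp add: Q0_def)
  then obtain c Q where cQ: "c > 0" "Q0 = Polynomial.smult c Q" "Polynomial.content Q = 1" by (rule primitive_multiple)
  have Q00: "int_eval Q0 z = 0"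
  proof -
    have "int_eval Q0 z = of_int (t2 * n2) * (z\<^sup>2 - of_rat T * z + of_rat N)"
      using t0 n0 unfolding T N Q0_def
      by (simp add: int_eval_pCons int_eval_0 of_rat_divide field_simps power2_eq_square)
    thus ?thesis using root by simp
  qed
  hence Qz: "int_eval Q z = 0" using cQ by (simp add: int_eval_smult)
  have degQ: "degree Q = 2"
  proof -
    have "degree Q0 = 2" using t0 n0 by (simp add: Q0_def)
    thus ?thesis using cQ by simp
  qed
  have min: "r = 0" if "degree r < degree Q" "int_eval r z = 0" for r
  proof -
    have "degree r \<le> 1" using that(1) degQ by simp
    obtain a r' where r': "r = pCons a r'" by (rule pCons_cases)
    have "degree r' = 0" using \<open>degree r \<le> 1\<close> r' by (cases "r' = 0") auto
    then obtain b where r: "r = [:a, b:]" using r' by (metis degree_eq_zeroE)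
    have e: "of_int a + z * of_int b = 0" using that(2) by (simp add: r int_eval_pCons int_eval_0)
    hence "Im (of_int a + z * of_int b) = 0" by simp
    hence "b = 0" using im by simp
    thus ?thesis using e r by simp
  qed
  have unit: "is_unit (lead_coeff Q)" by (rule lead_coeff_primitive_annihilator[OF z cQ(3) Qz min])
  have co: "c * poly.coeff Q 2 = t2 * n2" "c * poly.coeff Q 1 = - t1 * n2" "c * poly.coeff Q 0 = n1 * t2"
    using arg_cong[OF cQ(2), of "\<lambda>p. poly.coeff p 2"] arg_cong[OF cQ(2), of "\<lambda>p. poly.coeff p 1"]
      arg_cong[OF cQ(2), of "\<lambda>p. poly.coeff p 0"] by (simp_all add: Q0_def numeral_2_eq_2)
  have "poly.coeff Q 2 = 1"
  proof -
    have "is_unit (poly.coeff Q 2)" using unit degQ by simp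
    moreover have "poly.coeff Q 2 > 0" using co(1) cQ(1) t0 n0 by (metis mult_pos_pos zero_less_mult_pos)
    ultimately show ?thesis by simp
  qed
  hence c: "c = t2 * n2" using co by simp
  have "t1 * n2 = (t2 * n2) * (- poly.coeff Q 1)" using co(2) c by simp
  hence "n2 * (t1 + t2 * poly.coeff Q 1) = 0" by (simp only: algebra_simps)
  hence "t1 = t2 * (- poly.coeff Q 1)" using n0 by simp
  hence "T = of_int (- poly.coeff Q 1)" unfolding T using t0 by simp
  moreover have "n1 * t2 = (t2 * n2) * poly.coeff Q 0" using co(3) unfolding c by (rule sym)
  hence "t2 * (n1 - n2 * poly.coeff Q 0) = 0" by (simp only: algebra_simps)
  hence "n1 = n2 * poly.coeff Q 0" using t0 by simp
  hence "N = of_int (poly.coeff Q 0)" unfolding N using n0 by simp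
  ultimately show ?thesis by blast
qed

section \<open>Integers of an imaginary quadratic field\<close>

text \<open>
  All integers of the field have this form; the pair \<open>(a, b)\<close> is admissible iff \<open>4\<close> divides \<open>a\<^sup>2 +
  P * b\<^sup>2\<close>, a condition that treats all residues of \<open>P\<close> modulo \<open>4\<close> uniformly.
\<close>

definition half_int :: "nat \<Rightarrow> int \<Rightarrow> int \<Rightarrow> complex" where
  "half_int P a b = (of_int a + of_int b * sqrtm P) / 2"

lemma half_int_Re_Im: "Re (half_int P a b) = of_int a / 2" "Im (half_int P a b) = of_int b * sqrt (real P) / 2"
  by (simp_all add: half_int_def sqrtm_eq)

lemma half_int_eq_iff: "P > 0 \<Longrightarrow> half_int P a b = half_int P c d \<longleftrightarrow> a = c \<and> b = d"
  by (auto simp: complex_eq_iff half_int_Re_Im)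

lemma half_int_norm: "half_int P a b * cnj (half_int P a b) = of_int (a\<^sup>2 + int P * b\<^sup>2) / 4"
proof -
  have "(real_of_int a / 2)\<^sup>2 + (real_of_int b * sqrt (real P) / 2)\<^sup>2 = real_of_int (a\<^sup>2 + int P * b\<^sup>2) / 4"
    by (simp add: power_mult_distrib power_divide field_simps)
  hence "half_int P a b * cnj (half_int P a b) = of_real (real_of_int (a\<^sup>2 + int P * b\<^sup>2) / 4)"
    unfolding complex_mult_cnj half_int_Re_Im by (simp only:)
  thus ?thesis by simp
qed

lemma complex_of_rat: "(of_rat v :: complex) = of_real (of_rat v)"
proof -
  obtain m n where "quotient_of v = (m, n)" by (cases "quotient_of v")
  hence "v = of_int m / of_int n" by (rule quotient_of_div)
  thus ?thesis by (simp add: of_rat_divide)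
qed

lemma mem_quadratic_field: "z \<in> quadratic_field (- int P) \<longleftrightarrow> (\<exists>u v. z = of_rat u + of_rat v * sqrtm P)"
  by (auto simp: quadratic_field_def sqrtm_def)

lemma squarefree_rational_sqrt:
  fixes v :: rat
  assumes sf: "squarefree P" and e: "of_nat P * v\<^sup>2 = of_int k"
  shows "\<exists>b. v = of_int b"
proof -
  obtain m n where mn: "quotient_of v = (m, n)" by (cases "quotient_of v")
  have n0: "n > 0" and v: "v = of_int m / of_int n" and cop: "coprime m n"
    using quotient_of_denom_pos[OF mn] quotient_of_div[OF mn] quotient_of_coprime[OF mn] by auto
  have "(of_nat P * of_int m ^ 2 :: rat) = of_int k * of_int n ^ 2"
    using e n0 unfolding v by (simp add: field_simps)
  hence "(of_int (int P * m\<^sup>2) :: rat) = of_int (k * n\<^sup>2)" by simp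
  hence "int P * m\<^sup>2 = k * n\<^sup>2" by (simp only: of_int_eq_iff)
  hence "n\<^sup>2 dvd int P * m\<^sup>2" by simp
  moreover have "coprime (n\<^sup>2) (m\<^sup>2)" using cop by (simp add: coprime_commute)
  ultimately have "n\<^sup>2 dvd int P" by (simp add: coprime_dvd_mult_left_iff)
  hence "(nat n)\<^sup>2 dvd P" using n0 by (metis int_dvd_int_iff int_nat_eq less_imp_le of_nat_power)
  hence "is_unit (nat n)" using sf by (auto simp: squarefree_def)
  hence "n = 1" using n0 by simp
  thus ?thesis using v by auto
qed

text \<open>
  Trace \<open>t\<close> and norm \<open>n\<close> of an algebraic integer \<open>u + v * sqrt (- P)\<close> are integers, and \<open>P * (2 *
  v)\<^sup>2 = 4 * n - t\<^sup>2\<close> forces \<open>2 * v\<close> to be an integer because \<open>P\<close> is squarefree.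
\<close>

lemma carrier_OK:
  assumes sf: "squarefree P" and P: "P > 0"
  shows "z \<in> OK P \<longleftrightarrow> (\<exists>a b. z = half_int P a b \<and> 4 dvd a\<^sup>2 + int P * b\<^sup>2)"
proof
  assume "z \<in> OK P"
  hence zK: "z \<in> quadratic_field (- int P)" and alg: "algebraic_int z"
    by (auto simp: ring_of_integers_def)
  obtain u v where z: "z = of_rat u + of_rat v * sqrtm P" using zK mem_quadratic_field by blast
  show "\<exists>a b. z = half_int P a b \<and> 4 dvd a\<^sup>2 + int P * b\<^sup>2"
  proof (cases "v = 0")
    case True
    hence "z \<in> \<rat>" using z by simp
    hence "z \<in> \<int>" using alg rational_algebraic_int_is_int by blast
    then obtain a where "z = of_int a" by (elim Ints_cases)
    hence "z = half_int P (2 * a) 0" by (simp add: half_int_def)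
    thus ?thesis by (intro exI[of _ "2 * a"] exI[of _ 0]) (simp add: power2_eq_square)
  next
    case False
    have sP: "sqrt (real P) > 0" using P by simp
    have "Im z = of_rat v * sqrt (real P)" unfolding z by (simp add: sqrtm_eq complex_of_rat)
    hence im: "Im z \<noteq> 0" using False sP by simp
    define T N where "T = 2 * u" and "N = u\<^sup>2 + of_nat P * v\<^sup>2"
    have "z\<^sup>2 - of_rat T * z + of_rat N = of_rat v ^ 2 * (sqrtm P * sqrtm P) + of_nat P * of_rat v ^ 2"
      unfolding z T_def N_def by (simp add: of_rat_add of_rat_mult of_rat_power algebra_simps power2_eq_square)
    hence root: "z\<^sup>2 - of_rat T * z + of_rat N = 0" unfolding sqrtm_square by (simp add: mult.commute)
    obtain t n where tn: "T = of_int t" "N = of_int n" using algebraic_int_nonreal[OF alg im root] by blast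
    have "of_nat P * (2 * v)\<^sup>2 = 4 * N - T\<^sup>2" unfolding T_def N_def by (simp add: algebra_simps power2_eq_square)
    also have "\<dots> = of_int (4 * n - t\<^sup>2)" unfolding tn by simp
    finally obtain b where b: "2 * v = of_int b" using squarefree_rational_sqrt[OF sf] by blast
    have uv: "u = of_int t / 2" "v = of_int b / 2" using tn(1) b by (simp_all add: T_def)
    have "(of_rat u :: complex) = of_int t / 2" "(of_rat v :: complex) = of_int b / 2"
      unfolding uv by (simp_all add: of_rat_divide)
    hence "z = half_int P t b" unfolding z half_int_def by (simp only: add_divide_distrib times_divide_eq_left)
    moreover have "4 * N = of_int (t\<^sup>2 + int P * b\<^sup>2)"
      unfolding N_def uv by (simp add: power2_eq_square)
    hence "(of_int (4 * n) :: rat) = of_int (t\<^sup>2 + int P * b\<^sup>2)" using tn by simp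
    hence "4 * n = t\<^sup>2 + int P * b\<^sup>2" by (simp only: of_int_eq_iff)
    hence "4 dvd t\<^sup>2 + int P * b\<^sup>2" by (metis dvd_triv_left)
    ultimately show ?thesis by blast
  qed
next
  assume "\<exists>a b. z = half_int P a b \<and> 4 dvd a\<^sup>2 + int P * b\<^sup>2"
  then obtain a b n where z: "z = half_int P a b" and n: "a\<^sup>2 + int P * b\<^sup>2 = 4 * n" by (auto elim: dvdE)
  have "z = of_rat (of_int a / 2) + of_rat (of_int b / 2) * sqrtm P"
    by (simp add: z half_int_def of_rat_divide add_divide_distrib)
  hence "z \<in> quadratic_field (- int P)" using mem_quadratic_field by blast
  moreover have "algebraic_int z"
  proof
    have "z * cnj z = of_int n" unfolding z half_int_norm n by simp
    moreover have "z + cnj z = of_int a" by (simp add: z half_int_def cnj_sqrtm add_divide_distrib[symmetric])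
    ultimately have "z * z - of_int a * z + of_int n = 0" by (metis (no_types, lifting) add.commute diff_add_cancel diff_add_eq_diff_diff_swap distrib_right eq_iff_diff_eq_0 mult.commute)
    thus "poly [:of_int n, - of_int a, 1:] z = 0" by (simp add: algebra_simps)
  qed (auto simp: Polynomial.coeff_pCons split: nat.splits)
  ultimately show "z \<in> OK P" by (simp add: ring_of_integers_def)
qed

lemma half_int_parity:
  assumes sf: "squarefree P" and d: "4 dvd a\<^sup>2 + int P * b\<^sup>2"
  shows "even a \<longleftrightarrow> even b" and "odd a \<Longrightarrow> P mod 4 = 3"
proof -
  have n4: "\<not> 4 dvd P"
  proof
    assume "4 dvd P"
    hence "2\<^sup>2 dvd P" by simp
    thus False using sf unfolding squarefree_def by (metis nat_dvd_1_iff_1 numeral_eq_one_iff semiring_norm(85))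
  qed
  obtain a' where a: "a = 2 * a' \<or> a = 2 * a' + 1" by (metis evenE oddE)
  obtain b' where b: "b = 2 * b' \<or> b = 2 * b' + 1" by (metis evenE oddE)
  have sq: "(2 * x)\<^sup>2 = 4 * x\<^sup>2" "(2 * x + 1)\<^sup>2 = 4 * (x\<^sup>2 + x) + 1" for x :: int
    by (simp_all add: algebra_simps power2_eq_square)
  consider "a = 2 * a'" "b = 2 * b'" | "a = 2 * a'" "b = 2 * b' + 1" | "a = 2 * a' + 1" "b = 2 * b'"
    | "a = 2 * a' + 1" "b = 2 * b' + 1" using a b by blast
  hence "(even a \<longleftrightarrow> even b) \<and> (odd a \<longrightarrow> P mod 4 = 3)"
  proof cases
    case 2
    have "4 dvd (4 * (a'\<^sup>2 + int P * (b'\<^sup>2 + b'))) + int P"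
      using d unfolding 2 sq by (simp add: algebra_simps)
    hence "4 dvd int P" by (simp add: dvd_add_right_iff)
    hence "4 dvd P" by presburger
    thus ?thesis using n4 by simp
  next
    case 3
    have "4 dvd (4 * (a'\<^sup>2 + a' + int P * b'\<^sup>2)) + 1"
      using d unfolding 3 sq by (simp add: algebra_simps)
    thus ?thesis by presburger
  next
    case 4
    have "4 dvd (4 * (a'\<^sup>2 + a' + int P * (b'\<^sup>2 + b'))) + (1 + int P)"
      using d unfolding 4 sq by (simp add: algebra_simps)
    hence "4 dvd 1 + int P" by (simp add: dvd_add_right_iff)
    hence "P mod 4 = 3" by presburger
    thus ?thesis unfolding 4 by simp
  qed auto
  thus "even a \<longleftrightarrow> even b" and "odd a \<Longrightarrow> P mod 4 = 3" by blast+
qed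

locale imag_quad =
  fixes P :: nat
  assumes sf: "squarefree P" and P0: "P > 0"
begin

abbreviation "R \<equiv> ring_of_integers (- int P)"

lemma R_simps [simp]: "mult R = (*)" "one R = 1" "zero R = 0" "add R = (+)"
  by (simp_all add: ring_of_integers_def)

lemma OK_I: "4 dvd a\<^sup>2 + int P * b\<^sup>2 \<Longrightarrow> half_int P a b \<in> carrier R"
  using carrier_OK[OF sf P0] by blast

lemma OK_E:
  assumes "z \<in> carrier R"
  obtains a b where "z = half_int P a b" "4 dvd a\<^sup>2 + int P * b\<^sup>2" "even a \<longleftrightarrow> even b" "odd a \<longrightarrow> P mod 4 = 3"
  using assms carrier_OK[OF sf P0] half_int_parity[OF sf] by blast

lemma OK_int [simp]: "of_int k \<in> carrier R"
proof -
  have "of_int k = half_int P (2 * k) 0" by (simp add: half_int_def)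
  thus ?thesis using OK_I[of "2 * k" 0] by (simp add: power2_eq_square)
qed

lemma OK_nat [simp]: "of_nat k \<in> carrier R"
  using OK_int[of "int k"] by simp

lemma OK_0 [simp]: "0 \<in> carrier R" and OK_1 [simp]: "1 \<in> carrier R"
  using OK_int[of 0] OK_int[of 1] by simp_all

lemma OK_pair [simp]: "of_int a + of_int b * sqrtm P \<in> carrier R"
proof -
  have "of_int a + of_int b * sqrtm P = half_int P (2 * a) (2 * b)"
    unfolding half_int_def by (simp only: of_int_mult of_int_numeral) (simp add: algebra_simps add_divide_distrib)
  moreover have "4 dvd (2 * a)\<^sup>2 + int P * (2 * b)\<^sup>2"
    by (simp add: power_mult_distrib mult.left_commute[of _ 4])
  ultimately show ?thesis using OK_I by metis
qed

lemma OK_add [simp]: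
  assumes "x \<in> carrier R" "y \<in> carrier R"
  shows "x + y \<in> carrier R"
proof -
  obtain a b where x: "x = half_int P a b" "4 dvd a\<^sup>2 + int P * b\<^sup>2" "even a \<longleftrightarrow> even b" "odd a \<longrightarrow> P mod 4 = 3"
    using assms(1) by (rule OK_E)
  obtain c d where y: "y = half_int P c d" "4 dvd c\<^sup>2 + int P * d\<^sup>2" "even c \<longleftrightarrow> even d" "odd c \<longrightarrow> P mod 4 = 3"
    using assms(2) by (rule OK_E)
  have e: "x + y = half_int P (a + c) (b + d)"
    unfolding x y half_int_def by (simp only: of_int_add) (simp add: algebra_simps add_divide_distrib)
  have "even (a * c + int P * (b * d))"
  proof (cases "even a \<or> even c")
    case True
    thus ?thesis using x(3) y(3) by auto
  next
    case False
    hence "P mod 4 = 3" using x(4) by blast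
    hence "odd P" by presburger
    thus ?thesis using False x(3) y(3) by simp
  qed
  then obtain e where "a * c + int P * (b * d) = 2 * e" by (rule evenE)
  hence "4 dvd 2 * (a * c + int P * (b * d))" by simp
  hence "4 dvd (a\<^sup>2 + int P * b\<^sup>2) + (c\<^sup>2 + int P * d\<^sup>2) + 2 * (a * c + int P * (b * d))"
    by (rule dvd_add[OF dvd_add[OF x(2) y(2)]])
  hence "4 dvd (a + c)\<^sup>2 + int P * (b + d)\<^sup>2"
    by (simp add: algebra_simps power2_eq_square)
  thus ?thesis unfolding e by (rule OK_I)
qed

lemma half_int_mult:
  assumes "even (a * c - int P * (b * d))" "even (a * d + b * c)"
  shows "half_int P a b * half_int P c d = half_int P ((a * c - int P * (b * d)) div 2) ((a * d + b * c) div 2)"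
proof -
  obtain m n where m: "a * c - int P * (b * d) = 2 * m" and n: "a * d + b * c = 2 * n"
    by (metis assms evenE)
  have "half_int P a b * half_int P c d =
     (of_int (a * c) + of_int (b * d) * (sqrtm P * sqrtm P) + of_int (a * d + b * c) * sqrtm P) / 4"
    unfolding half_int_def by (simp only: of_int_mult of_int_add) (simp add: field_simps)
  also have "\<dots> = (of_int (a * c - int P * (b * d)) + of_int (a * d + b * c) * sqrtm P) / 4"
    unfolding sqrtm_square by (simp add: mult.commute)
  also have "\<dots> = half_int P m n" unfolding m n half_int_def by (simp only: of_int_mult of_int_numeral) (simp add: field_simps)
  finally show ?thesis unfolding m n by simp
qed

lemma OK_mult [simp]:
  assumes "x \<in> carrier R" "y \<in> carrier R"
  shows "x * y \<in> carrier R"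
proof -
  obtain a b where x: "x = half_int P a b" "4 dvd a\<^sup>2 + int P * b\<^sup>2" "even a \<longleftrightarrow> even b" "odd a \<longrightarrow> P mod 4 = 3"
    using assms(1) by (rule OK_E)
  obtain c d where y: "y = half_int P c d" "4 dvd c\<^sup>2 + int P * d\<^sup>2" "even c \<longleftrightarrow> even d" "odd c \<longrightarrow> P mod 4 = 3"
    using assms(2) by (rule OK_E)
  have ev: "even (a * c - int P * (b * d))" "even (a * d + b * c)"
  proof -
    show "even (a * d + b * c)" using x(3) y(3) by auto
    show "even (a * c - int P * (b * d))"
    proof (cases "even a \<or> even c")
      case True
      thus ?thesis using x(3) y(3) by auto
    next
      case False
      hence "P mod 4 = 3" using x(4) by blast
      hence "odd P" by presburger
      thus ?thesis using False x(3) y(3) by simp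
    qed
  qed
  obtain m n where m: "a * c - int P * (b * d) = 2 * m" and n: "a * d + b * c = 2 * n"
    by (metis ev evenE)
  have e: "x * y = half_int P m n" unfolding x y using half_int_mult[OF ev] m n by simp
  have "4 * (m\<^sup>2 + int P * n\<^sup>2) = (2 * m)\<^sup>2 + int P * (2 * n)\<^sup>2" by (simp add: power_mult_distrib)
  also have "\<dots> = (a\<^sup>2 + int P * b\<^sup>2) * (c\<^sup>2 + int P * d\<^sup>2)"
    unfolding m[symmetric] n[symmetric] by (simp add: algebra_simps power2_eq_square)
  also have "4 * 4 dvd \<dots>" using x(2) y(2) by (intro mult_dvd_mono)
  finally have "4 * 4 dvd 4 * (m\<^sup>2 + int P * n\<^sup>2)" .
  hence "4 dvd m\<^sup>2 + int P * n\<^sup>2" by (subst (asm) dvd_times_left_cancel_iff) simp_all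
  thus ?thesis unfolding e by (rule OK_I)
qed

lemma OK_minus [simp]: "x \<in> carrier R \<Longrightarrow> - x \<in> carrier R"
  using OK_mult[OF OK_int[of "-1"]] by simp

lemma OK_power [simp]: "x \<in> carrier R \<Longrightarrow> x ^ n \<in> carrier R"
  by (induction n) auto

lemma OK_cnj [simp]: "x \<in> carrier R \<Longrightarrow> cnj x \<in> carrier R"
proof -
  assume "x \<in> carrier R"
  then obtain a b where x: "x = half_int P a b" "4 dvd a\<^sup>2 + int P * b\<^sup>2" by (rule OK_E)
  have "cnj x = half_int P a (- b)" unfolding x half_int_def by (simp add: cnj_sqrtm)
  thus ?thesis using OK_I[of a "- b"] x by simp
qed

lemma OK_norm:
  assumes "x \<in> carrier R"
  obtains n :: nat where "x * cnj x = of_nat n"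
proof -
  obtain a b where x: "x = half_int P a b" "4 dvd a\<^sup>2 + int P * b\<^sup>2" using assms by (rule OK_E)
  then obtain k where k: "a\<^sup>2 + int P * b\<^sup>2 = 4 * k" by (elim dvdE)
  have "a\<^sup>2 + int P * b\<^sup>2 \<ge> 0" by simp
  hence "k \<ge> 0" using k by simp
  hence "x * cnj x = of_nat (nat k)" unfolding x half_int_norm k by (simp add: of_nat_nat)
  thus ?thesis by (rule that)
qed

lemma R_cring: "cring R"
proof (rule cringI)
  show "abelian_group R"
  proof (rule abelian_groupI)
    fix x assume "x \<in> carrier R"
    thus "\<exists>y\<in>carrier R. y \<oplus>\<^bsub>R\<^esub> x = \<zero>\<^bsub>R\<^esub>" by (intro bexI[of _ "- x"]) auto
  qed (auto simp: algebra_simps)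
  show "comm_monoid R" by (rule comm_monoidI) (auto simp: algebra_simps)
qed (auto simp: algebra_simps)

section \<open>Ideals and their norms\<close>

lemma ideal_iff:
  "ideal I R \<longleftrightarrow> I \<subseteq> carrier R \<and> 0 \<in> I \<and> (\<forall>x\<in>I. \<forall>y\<in>I. x + y \<in> I) \<and> (\<forall>x\<in>I. \<forall>a\<in>carrier R. a * x \<in> I)"
  (is "_ \<longleftrightarrow> ?rhs")
proof
  assume I: "ideal I R"
  have "I \<subseteq> carrier R" using ideal.Icarr[OF I] by blast
  moreover have "0 \<in> I" using additive_subgroup.zero_closed[OF ideal.axioms(1)[OF I]] by simp
  moreover have "\<forall>x\<in>I. \<forall>y\<in>I. x + y \<in> I"
    using additive_subgroup.a_closed[OF ideal.axioms(1)[OF I]] by simp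
  moreover have "\<forall>x\<in>I. \<forall>a\<in>carrier R. a * x \<in> I" using ideal.I_l_closed[OF I] by simp
  ultimately show ?rhs by blast
next
  assume rhs: ?rhs
  interpret cring R by (rule R_cring)
  show "ideal I R"
  proof (rule idealI)
    show "ring R" by (rule ring_axioms)
    show "subgroup I (add_monoid R)"
    proof
      fix x assume x: "x \<in> I"
      hence "\<ominus>\<^bsub>R\<^esub> x = - x" using rhs by (intro minus_equality) auto
      moreover have "- 1 * x \<in> I" using rhs x OK_int[of "-1"] by (metis of_int_1 of_int_minus)
      ultimately show "inv\<^bsub>add_monoid R\<^esub> x \<in> I" by (simp add: a_inv_def)
    qed (use rhs in auto)
  qed (use rhs in \<open>auto simp: mult.commute\<close>)
qed

lemma idealD:
  assumes "ideal I R"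
  shows "x \<in> I \<Longrightarrow> x \<in> carrier R" "0 \<in> I" "x \<in> I \<Longrightarrow> y \<in> I \<Longrightarrow> x + y \<in> I"
    "x \<in> I \<Longrightarrow> a \<in> carrier R \<Longrightarrow> a * x \<in> I" "x \<in> I \<Longrightarrow> y \<in> I \<Longrightarrow> x - y \<in> I"
proof -
  note * = assms[unfolded ideal_iff]
  show "x \<in> I \<Longrightarrow> x \<in> carrier R" "0 \<in> I" "x \<in> I \<Longrightarrow> y \<in> I \<Longrightarrow> x + y \<in> I"
    "x \<in> I \<Longrightarrow> a \<in> carrier R \<Longrightarrow> a * x \<in> I" using * by auto
  show "x - y \<in> I" if "x \<in> I" "y \<in> I"
  proof -
    have "of_int (-1) * y \<in> I" using * that OK_int by blast
    hence "x + of_int (-1) * y \<in> I" using * that by blast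
    thus ?thesis by simp
  qed
qed

definition principal :: "complex \<Rightarrow> complex set" where "principal a = (\<lambda>r. r * a) ` carrier R"

lemma principal_iff: "principalideal I R \<longleftrightarrow> (\<exists>a\<in>carrier R. I = principal a)"
proof -
  interpret cring R by (rule R_cring)
  have eq: "Idl\<^bsub>R\<^esub> {a} = principal a" if "a \<in> carrier R" for a
    using cgenideal_eq_genideal[OF that] by (auto simp: cgenideal_def principal_def)
  have id: "ideal (principal a) R" if "a \<in> carrier R" for a
    using genideal_ideal[of "{a}"] that eq[OF that] by simp
  show ?thesis
  proof
    assume "principalideal I R"
    from principalideal.generate[OF this] show "\<exists>a\<in>carrier R. I = principal a" using eq by auto
  next
    assume "\<exists>a\<in>carrier R. I = principal a"
    thus "principalideal I R" using eq id by (intro principalidealI) auto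
  qed
qed

lemma principal_is_ideal: "a \<in> carrier R \<Longrightarrow> ideal (principal a) R"
  using principal_iff principalideal.axioms(1) by blast

abbreviation "ideal_monoid \<equiv> ideals_set R"

lemma ideal_comm_monoid: "comm_monoid ideal_monoid"
  using cring.ideals_set_is_comm_monoid[OF R_cring] .

lemma ideal_monoid_simps: "carrier ideal_monoid = {I. ideal I R}" "mult ideal_monoid I J = ideal_prod R I J" "one ideal_monoid = carrier R"
  by (simp_all add: ideals_set_def)

lemma ideal_prod_subset:
  assumes "\<And>i j. i \<in> I \<Longrightarrow> j \<in> J \<Longrightarrow> i * j \<in> K" "\<And>x y. x \<in> K \<Longrightarrow> y \<in> K \<Longrightarrow> x + y \<in> K"
  shows "ideal_prod R I J \<subseteq> K"
proof
  fix x assume "x \<in> ideal_prod R I J"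
  thus "x \<in> K" by (induction rule: ideal_prod.induct) (use assms in auto)
qed

lemma ideal_prodI: "i \<in> I \<Longrightarrow> j \<in> J \<Longrightarrow> i * j \<in> ideal_prod R I J"
  using ideal_prod.prod[of i I j J R] by simp

lemma principal_times_ideal:
  assumes a: "a \<in> carrier R" and I: "ideal I R"
  shows "mult ideal_monoid (principal a) I = (\<lambda>x. a * x) ` I"
proof
  show "mult ideal_monoid (principal a) I \<subseteq> (\<lambda>x. a * x) ` I"
    unfolding ideal_monoid_simps
  proof (rule ideal_prod_subset)
    fix i j assume "i \<in> principal a" "j \<in> I"
    then obtain r where "i = r * a" "r \<in> carrier R" by (auto simp: principal_def)
    hence "i * j = a * (r * j)" "r * j \<in> I" using idealD(4)[OF I] \<open>j \<in> I\<close> by auto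
    thus "i * j \<in> (\<lambda>x. a * x) ` I" by blast
  next
    fix x y assume "x \<in> (\<lambda>x. a * x) ` I" "y \<in> (\<lambda>x. a * x) ` I"
    then obtain u v where "x = a * u" "y = a * v" "u \<in> I" "v \<in> I" by blast
    hence "x + y = a * (u + v)" "u + v \<in> I" using idealD(3)[OF I] by (auto simp: algebra_simps)
    thus "x + y \<in> (\<lambda>x. a * x) ` I" by blast
  qed
  show "(\<lambda>x. a * x) ` I \<subseteq> mult ideal_monoid (principal a) I"
  proof (clarify, unfold ideal_monoid_simps)
    fix x assume "x \<in> I"
    moreover have "a \<in> principal a" unfolding principal_def using OK_1 by force
    ultimately show "a * x \<in> ideal_prod R (principal a) I" by (intro ideal_prodI)
  qed
qed

lemma principal_mult:
  assumes "a \<in> carrier R" "b \<in> carrier R"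
  shows "mult ideal_monoid (principal a) (principal b) = principal (a * b)"
  unfolding principal_times_ideal[OF assms(1) principal_is_ideal[OF assms(2)]] unfolding principal_def image_image
  by (intro image_cong) (auto simp: algebra_simps)

lemma principal_power:
  assumes "a \<in> carrier R"
  shows "principal a [^]\<^bsub>ideal_monoid\<^esub> (n::nat) = principal (a ^ n)"
proof (induction n)
  case 0
  interpret comm_monoid ideal_monoid by (rule ideal_comm_monoid)
  show ?case by (auto simp: ideal_monoid_simps principal_def)
next
  case (Suc n)
  interpret comm_monoid ideal_monoid by (rule ideal_comm_monoid)
  have "principal a [^]\<^bsub>ideal_monoid\<^esub> Suc n = mult ideal_monoid (principal (a ^ n)) (principal a)" using Suc by simp
  also have "\<dots> = principal (a ^ Suc n)" using assms by (subst principal_mult) (auto simp: mult.commute)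
  finally show ?case .
qed

lemma ideal_power: "ideal I R \<Longrightarrow> ideal (I [^]\<^bsub>ideal_monoid\<^esub> (n::nat)) R"
proof -
  interpret comm_monoid ideal_monoid by (rule ideal_comm_monoid)
  assume "ideal I R"
  hence "I [^]\<^bsub>ideal_monoid\<^esub> n \<in> carrier ideal_monoid" by (intro nat_pow_closed) (simp add: ideal_monoid_simps)
  thus ?thesis by (simp add: ideal_monoid_simps)
qed

lemma power_mem_ideal_power:
  assumes "x \<in> I" shows "x ^ n \<in> I [^]\<^bsub>ideal_monoid\<^esub> n"
proof (induction n)
  case 0
  interpret comm_monoid ideal_monoid by (rule ideal_comm_monoid)
  show ?case by (simp add: ideal_monoid_simps)
next
  case (Suc n)
  interpret comm_monoid ideal_monoid by (rule ideal_comm_monoid)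
  have "x ^ n * x \<in> ideal_prod R (I [^]\<^bsub>ideal_monoid\<^esub> n) I" using Suc assms by (intro ideal_prodI)
  thus ?case by (simp add: ideal_monoid_simps mult.commute)
qed

lemma quadratic_field_divide_nat:
  assumes "x \<in> carrier R"
  shows "x / of_nat n \<in> quadratic_field (- int P)"
proof -
  obtain a b where x: "x = half_int P a b" using assms by (rule OK_E)
  have "x / of_nat n = of_rat (of_int a / (2 * of_nat n)) + of_rat (of_int b / (2 * of_nat n)) * sqrtm P"
    unfolding x half_int_def by (simp add: of_rat_divide of_rat_mult add_divide_distrib)
  thus ?thesis using mem_quadratic_field by blast
qed

lemma OK_I_trace_norm:
  assumes K: "z \<in> quadratic_field (- int P)" and t: "z + cnj z = of_int t" and n: "z * cnj z = of_int n"
  shows "z \<in> carrier R"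
proof -
  have "algebraic_int z"
  proof
    have "z * z - of_int t * z + of_int n = 0" unfolding t[symmetric] n[symmetric] by (simp add: algebra_simps)
    thus "poly [:of_int n, - of_int t, 1:] z = 0" by (simp add: algebra_simps)
  qed (auto simp: Polynomial.coeff_pCons split: nat.splits)
  thus ?thesis using K by (simp add: ring_of_integers_def)
qed

lemma cnj_ideal:
  assumes "ideal I R" shows "ideal (cnj ` I) R"
  unfolding ideal_iff
proof (intro conjI ballI subsetI)
  fix x assume "x \<in> cnj ` I" thus "x \<in> carrier R" using idealD(1)[OF assms] by auto
next
  show "0 \<in> cnj ` I" using idealD(2)[OF assms] by (metis complex_cnj_zero image_eqI)
next
  fix x y assume "x \<in> cnj ` I" "y \<in> cnj ` I"
  thus "x + y \<in> cnj ` I" using idealD(3)[OF assms] by (auto simp flip: complex_cnj_add)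
next
  fix x a assume "x \<in> cnj ` I" and a: "a \<in> carrier R"
  then obtain u where u: "x = cnj u" "u \<in> I" by blast
  have "cnj a * u \<in> I" using idealD(4)[OF assms u(2)] a by simp
  moreover have "a * x = cnj (cnj a * u)" by (simp add: u)
  ultimately show "a * x \<in> cnj ` I" by blast
qed

text \<open>
  Hurwitz's argument: \<open>G\<close> is the gcd of the norms of all elements of \<open>I\<close>. By polarisation it
  divides the traces of the products \<open>x * cnj y\<close>, so \<open>x * cnj y / G\<close> has integral trace and norm.
  Conversely \<open>G\<close> is an integral combination of norms. This makes ideals cancellable.
\<close>

lemma ideal_times_cnj:
  assumes I: "ideal I R" and nz: "x0 \<in> I" "x0 \<noteq> 0"
  shows "\<exists>G::nat. G > 0 \<and> mult ideal_monoid I (cnj ` I) = principal (of_nat G)"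
proof -
  define S where "S = {n::nat. \<exists>x\<in>I. x * cnj x = of_nat n}"
  define G where "G = Gcd S"
  have G_dvd: "\<exists>k. x * cnj x = of_nat (G * k)" if x: "x \<in> I" for x
  proof -
    obtain n :: nat where n: "x * cnj x = of_nat n" using OK_norm idealD(1)[OF I x] by blast
    hence "n \<in> S" unfolding S_def using x by blast
    hence "G dvd n" unfolding G_def by simp
    thus ?thesis using n by (auto simp: dvd_def)
  qed
  have G0: "G > 0"
  proof -
    obtain k where k: "x0 * cnj x0 = of_nat (G * k)" using G_dvd nz by blast
    have "x0 * cnj x0 \<noteq> 0" using nz by simp
    thus ?thesis using k by (cases "G = 0") auto
  qed
  have prod_dvd: "x * cnj y \<in> principal (of_nat G)" if x: "x \<in> I" and y: "y \<in> I" for x y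
  proof -
    define w where "w = x * cnj y / of_nat G"
    obtain k1 where k1: "x * cnj x = of_nat (G * k1)" using G_dvd x by blast
    obtain k2 where k2: "y * cnj y = of_nat (G * k2)" using G_dvd y by blast
    obtain k3 where k3: "(x + y) * cnj (x + y) = of_nat (G * k3)" using G_dvd idealD(3)[OF I x y] by blast
    have "x * cnj y + y * cnj x = (x + y) * cnj (x + y) - x * cnj x - y * cnj y" by (simp add: algebra_simps)
    also have "\<dots> = of_nat G * (of_nat k3 - of_nat k1 - of_nat k2)"
      unfolding k1 k2 k3 by (simp add: algebra_simps)
    finally have tr: "w + cnj w = of_int (int k3 - int k1 - int k2)"
      using G0 by (simp add: w_def field_simps)
    have "w * cnj w = (x * cnj x) * (y * cnj y) / (of_nat G * of_nat G)" by (simp add: w_def)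
    also have "\<dots> = of_int (int k1 * int k2)" unfolding k1 k2 using G0 by simp
    finally have nm: "w * cnj w = of_int (int k1 * int k2)" .
    have "w \<in> quadratic_field (- int P)" unfolding w_def
      using idealD(1)[OF I] x y by (intro quadratic_field_divide_nat) simp
    hence "w \<in> carrier R" using tr nm by (rule OK_I_trace_norm)
    moreover have "x * cnj y = w * of_nat G" using G0 by (simp add: w_def)
    ultimately show ?thesis unfolding principal_def by blast
  qed
  have J: "ideal (mult ideal_monoid I (cnj ` I)) R"
    using monoid.m_closed[OF comm_monoid.axioms(1)[OF ideal_comm_monoid], of I "cnj ` I"] I cnj_ideal[OF I]
    by (simp add: ideal_monoid_simps)
  have sub: "mult ideal_monoid I (cnj ` I) \<subseteq> principal (of_nat G)"
    unfolding ideal_monoid_simps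
    by (rule ideal_prod_subset) (use prod_dvd idealD(3)[OF principal_is_ideal[OF OK_nat]] in auto)
  have sub2: "principal (of_nat G) \<subseteq> mult ideal_monoid I (cnj ` I)"
  proof -
    let ?J = "mult ideal_monoid I (cnj ` I)"
    have S_mem: "of_nat n \<in> ?J" if nS: "n \<in> S" for n
    proof -
      obtain x where x: "x \<in> I" "x * cnj x = of_nat n" using nS unfolding S_def by blast
      hence "x * cnj x \<in> ?J" unfolding ideal_monoid_simps by (intro ideal_prodI) auto
      thus ?thesis using x by simp
    qed
    define k where "k = (LEAST k::nat. k > 0 \<and> of_nat k \<in> ?J)"
    obtain n0 where n0: "n0 \<in> S" "n0 > 0"
    proof -
      obtain n :: nat where n: "x0 * cnj x0 = of_nat n" using OK_norm idealD(1)[OF I nz(1)] by blast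
      moreover have "x0 * cnj x0 \<noteq> 0" using nz by simp
      ultimately show ?thesis using that[of n] nz unfolding S_def by (cases n) auto
    qed
    have k: "k > 0 \<and> of_nat k \<in> ?J" unfolding k_def
      by (rule LeastI[of _ n0]) (use n0 S_mem in auto)
    have "k dvd n" if "n \<in> S" for n
    proof -
      have "of_nat n - of_nat (n div k) * of_nat k \<in> ?J"
        using idealD(5)[OF J S_mem[OF that] idealD(4)[OF J _ OK_nat]] k by blast
      moreover have "(of_nat n :: complex) - of_nat (n div k) * of_nat k = of_nat (n mod k)"
        by (metis add_diff_cancel_left' div_mult_mod_eq of_nat_add of_nat_mult)
      ultimately have "of_nat (n mod k) \<in> ?J" by simp
      moreover have "n mod k < k" using k by simp
      ultimately have "n mod k = 0" using not_less_Least[of "n mod k" "\<lambda>k. k > 0 \<and> of_nat k \<in> ?J"]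
        unfolding k_def by (metis gr0I)
      thus ?thesis by auto
    qed
    hence "k dvd G" unfolding G_def by (intro Gcd_greatest)
    then obtain l where "G = l * k" by (metis dvd_def mult.commute)
    hence "of_nat G \<in> ?J" using idealD(4)[OF J _ OK_nat[of l], of "of_nat k"] k by simp
    thus ?thesis unfolding principal_def using idealD(4)[OF J] by blast
  qed
  show ?thesis using sub sub2 G0 by blast
qed

section \<open>Finiteness of the class group\<close>

definition approx_bound :: nat where "approx_bound = (P + 1) ^ 2"

text \<open>
  Simultaneous Diophantine approximation of the two coordinates of \<open>z\<close> with error below \<open>1 / (P +
  1)\<close>, which suffices since \<open>1 + sqrt P \<le> P + 1\<close>.
\<close>

lemma approx_by_OK:
  obtains t :: nat and w where "0 < t" "t \<le> approx_bound" "w \<in> carrier R" "norm (of_nat t * z - w) < 1"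
proof -
  define \<theta> where "\<theta> = (\<lambda>i::nat. if i = 0 then Re z else Im z / sqrt (real P))"
  obtain q p where q: "0 < q" "q \<le> int ((P + 1) ^ 2)"
    and qp: "\<And>i. i < 2 \<Longrightarrow> \<bar>of_int q * \<theta> i - of_int (p i)\<bar> < 1 / real (P + 1)"
    using Dirichlet_approx_simult[of "P + 1" 2 \<theta>] by auto
  define w where "w = of_int (p 0) + of_int (p 1) * sqrtm P"
  have sP: "sqrt (real P) > 0" using P0 by simp
  have "sqrt (real P) \<le> real P" using P0 by (intro real_le_lsqrt) (auto simp: power2_eq_square)
  hence sP1: "1 + sqrt (real P) \<le> real (P + 1)" by simp
  have "\<bar>Re (of_int q * z - w)\<bar> = \<bar>of_int q * \<theta> 0 - of_int (p 0)\<bar>"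
    by (simp add: \<theta>_def w_def sqrtm_eq)
  hence 1: "\<bar>Re (of_int q * z - w)\<bar> < 1 / real (P + 1)" using qp[of 0] by simp
  have "Im (of_int q * z - w) = sqrt (real P) * (of_int q * \<theta> 1 - of_int (p 1))"
    using sP by (simp add: \<theta>_def w_def sqrtm_eq algebra_simps)
  hence "\<bar>Im (of_int q * z - w)\<bar> = sqrt (real P) * \<bar>of_int q * \<theta> 1 - of_int (p 1)\<bar>"
    using sP by (simp add: abs_mult)
  also have "\<dots> < sqrt (real P) * (1 / real (P + 1))" using sP qp[of 1] by (intro mult_strict_left_mono) auto
  finally have "norm (of_int q * z - w) < 1 / real (P + 1) + sqrt (real P) * (1 / real (P + 1))"
    using 1 cmod_le[of "of_int q * z - w"] by linarith
  also have "\<dots> = (1 + sqrt (real P)) * (1 / real (P + 1))" by (simp only: distrib_right mult_1)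
  also have "\<dots> \<le> real (P + 1) * (1 / real (P + 1))" using sP1 by (intro mult_right_mono) auto
  also have "\<dots> = 1" by simp
  finally have "norm (of_nat (nat q) * z - w) < 1" using q by simp
  moreover have "w \<in> carrier R" unfolding w_def by (rule OK_pair)
  moreover have "0 < nat q" "nat q \<le> approx_bound" using q by (auto simp: approx_bound_def nat_le_iff)
  ultimately show ?thesis using that by blast
qed

text \<open>
  Let \<open>\<alpha>\<close> be a nonzero element of \<open>I\<close> of least norm. For \<open>\<beta>\<close> in \<open>I\<close> some \<open>t * \<beta> - w * \<alpha>\<close> with \<open>0 <
  t \<le> approx_bound\<close> has smaller norm than \<open>\<alpha>\<close>, so it vanishes; hence \<open>\<alpha>\<close> divides \<open>M * \<beta>\<close>, and \<open>J =
  (M / \<alpha>) * I\<close> is an ideal.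
\<close>

lemma ideal_class_representative:
  assumes I: "ideal I R" and nz: "x0 \<in> I" "x0 \<noteq> 0"
  defines "M \<equiv> fact approx_bound :: nat"
  shows "\<exists>\<alpha> J. \<alpha> \<in> carrier R \<and> \<alpha> \<noteq> 0 \<and> ideal J R \<and> of_nat M \<in> J \<and> mult ideal_monoid (principal \<alpha>) J = mult ideal_monoid (principal (of_nat M)) I"
proof -
  define nrm where "nrm = (\<lambda>x::complex. nat \<lfloor>(norm x)\<^sup>2\<rfloor>)"
  have nrm: "real (nrm x) = (norm x)\<^sup>2" if xR: "x \<in> carrier R" for x
  proof -
    obtain n :: nat where n: "x * cnj x = of_nat n" using OK_norm xR by blast
    have "complex_of_real ((norm x)\<^sup>2) = of_real (real n)"
      using n by (simp add: complex_norm_square[symmetric] del: of_real_power)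
    hence "(norm x)\<^sup>2 = real n" by (simp only: of_real_eq_iff)
    thus ?thesis by (simp add: nrm_def)
  qed
  obtain \<alpha> where \<alpha>: "\<alpha> \<in> I" "\<alpha> \<noteq> 0" and min: "\<And>x. x \<in> I \<Longrightarrow> x \<noteq> 0 \<Longrightarrow> nrm \<alpha> \<le> nrm x"
    using ex_has_least_nat[of "\<lambda>x. x \<in> I \<and> x \<noteq> 0" x0 nrm] nz by blast
  have \<alpha>R: "\<alpha> \<in> carrier R" using idealD(1)[OF I \<alpha>(1)] .
  have divis: "\<exists>\<gamma>\<in>carrier R. of_nat M * \<beta> = \<alpha> * \<gamma>" if \<beta>: "\<beta> \<in> I" for \<beta>
  proof -
    obtain t w where t: "0 < t" "t \<le> approx_bound" and w: "w \<in> carrier R" and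
      lt: "norm (of_nat t * (\<beta> / \<alpha>) - w) < 1" by (rule approx_by_OK)
    define \<delta> where "\<delta> = of_nat t * \<beta> - w * \<alpha>"
    have \<delta>I: "\<delta> \<in> I" unfolding \<delta>_def using idealD(4,5)[OF I] \<alpha> \<beta> w OK_nat by blast
    have "\<delta> = (of_nat t * (\<beta> / \<alpha>) - w) * \<alpha>" unfolding \<delta>_def using \<alpha> by (simp add: field_simps)
    hence "norm \<delta> = norm (of_nat t * (\<beta> / \<alpha>) - w) * norm \<alpha>" by (simp add: norm_mult)
    also have "\<dots> < 1 * norm \<alpha>" using lt \<alpha> by (intro mult_strict_right_mono) auto
    finally have "(norm \<delta>)\<^sup>2 < (norm \<alpha>)\<^sup>2" by (intro power_strict_mono) auto
    hence "nrm \<delta> < nrm \<alpha>" using nrm[OF \<alpha>R] nrm[OF idealD(1)[OF I \<delta>I]] by linarith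
    hence "\<delta> = 0" using min \<delta>I by (meson not_le)
    hence e: "of_nat t * \<beta> = w * \<alpha>" by (simp add: \<delta>_def)
    have "t dvd M" unfolding M_def using t by (intro dvd_fact) auto
    then obtain k where "M = k * t" by (metis dvd_def mult.commute)
    hence "of_nat M * \<beta> = of_nat k * (of_nat t * \<beta>)" by simp
    also have "\<dots> = \<alpha> * (of_nat k * w)" unfolding e by simp
    finally show ?thesis using w by (intro bexI[of _ "of_nat k * w"]) auto
  qed
  define J where "J = {\<gamma> \<in> carrier R. \<exists>\<beta>\<in>I. of_nat M * \<beta> = \<alpha> * \<gamma>}"
  have "ideal J R" unfolding ideal_iff
  proof (intro conjI ballI)
    show "J \<subseteq> carrier R" by (auto simp: J_def)
    show "0 \<in> J" using idealD(2)[OF I] by (auto simp: J_def)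
    fix x assume x: "x \<in> J"
    show "x + y \<in> J" if y: "y \<in> J" for y
    proof -
      obtain u v where uv: "u \<in> I" "v \<in> I" "of_nat M * u = \<alpha> * x" "of_nat M * v = \<alpha> * y"
        using x y by (auto simp: J_def)
      hence "of_nat M * (u + v) = \<alpha> * (x + y)" by (simp add: algebra_simps)
      thus ?thesis using x y idealD(3)[OF I] uv by (auto simp: J_def)
    qed
    show "a * x \<in> J" if a: "a \<in> carrier R" for a
    proof -
      obtain u where u: "u \<in> I" "of_nat M * u = \<alpha> * x" using x by (auto simp: J_def)
      hence "of_nat M * (a * u) = \<alpha> * (a * x)" by (simp add: mult.left_commute)
      moreover have "a * u \<in> I" by (rule idealD(4)[OF I u(1) a])
      moreover have "a * x \<in> carrier R" using x a by (simp add: J_def)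
      ultimately show ?thesis unfolding J_def by blast
    qed
  qed
  moreover have "of_nat M \<in> J" unfolding J_def using \<alpha>(1) by (auto simp: mult.commute)
  moreover have "mult ideal_monoid (principal \<alpha>) J = mult ideal_monoid (principal (of_nat M)) I"
    unfolding principal_times_ideal[OF \<alpha>R \<open>ideal J R\<close>] principal_times_ideal[OF OK_nat I]
  proof
    show "(\<lambda>x. \<alpha> * x) ` J \<subseteq> (\<lambda>x. of_nat M * x) ` I"
      unfolding J_def by clarify (metis image_eqI)
    show "(\<lambda>x. of_nat M * x) ` I \<subseteq> (\<lambda>x. \<alpha> * x) ` J"
    proof
      fix y assume "y \<in> (\<lambda>x. of_nat M * x) ` I"
      then obtain \<beta> where \<beta>: "\<beta> \<in> I" "y = of_nat M * \<beta>" by blast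
      then obtain \<gamma> where "\<gamma> \<in> carrier R" "of_nat M * \<beta> = \<alpha> * \<gamma>" using divis by blast
      thus "y \<in> (\<lambda>x. \<alpha> * x) ` J" using \<beta> by (auto simp: J_def)
    qed
  qed
  ultimately show ?thesis using \<alpha>R \<alpha>(2) by blast
qed

text \<open>
  Such an ideal is determined by its intersection with the finite set of the \<open>half_int P a b\<close> with
  \<open>0 \<le> a, b < 2 * M\<close>, because it contains \<open>M * (k + l * sqrt (- P))\<close> for all integers \<open>k, l\<close>.
\<close>

lemma finite_ideals_containing:
  assumes "M > 0"
  shows "finite {J. ideal J R \<and> of_nat M \<in> J}"
proof -
  define red where "red = (\<lambda>(a, b). half_int P (a mod (2 * int M)) (b mod (2 * int M)))"
  define F where "F = (\<lambda>(a, b). half_int P a b) ` ({0..<2 * int M} \<times> {0..<2 * int M})"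
  have fin: "finite F" unfolding F_def by simp
  have redF: "red (a, b) \<in> F" for a b
    unfolding red_def F_def using assms by (auto intro!: image_eqI[where x = "(a mod (2 * int M), b mod (2 * int M))"])
  have red_iff: "half_int P a b \<in> J \<longleftrightarrow> red (a, b) \<in> J" if J: "ideal J R" "of_nat M \<in> J" for J a b
  proof -
    define k l where "k = a div (2 * int M)" and "l = b div (2 * int M)"
    have a: "a = a mod (2 * int M) + 2 * int M * k" and b: "b = b mod (2 * int M) + 2 * int M * l"
      unfolding k_def l_def by simp_all
    have e: "half_int P a b = red (a, b) + (of_int k + of_int l * sqrtm P) * of_nat M"
      by (subst a, subst b) (simp only: red_def case_prod_conv half_int_def of_int_add of_int_mult of_int_numeral of_int_of_nat_eq, simp add: field_simps)
    have m: "(of_int k + of_int l * sqrtm P) * of_nat M \<in> J" using idealD(4)[OF J(1) J(2) OK_pair] .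
    show ?thesis
    proof
      assume "half_int P a b \<in> J"
      from idealD(5)[OF J(1) this m] show "red (a, b) \<in> J" unfolding e by simp
    next
      assume "red (a, b) \<in> J"
      from idealD(3)[OF J(1) this m] show "half_int P a b \<in> J" unfolding e .
    qed
  qed
  have "inj_on (\<lambda>J. J \<inter> F) {J. ideal J R \<and> of_nat M \<in> J}"
  proof (rule inj_onI)
    fix J1 J2 assume J1: "J1 \<in> {J. ideal J R \<and> of_nat M \<in> J}" and J2: "J2 \<in> {J. ideal J R \<and> of_nat M \<in> J}"
      and eq: "J1 \<inter> F = J2 \<inter> F"
    have iff: "half_int P a b \<in> J1 \<longleftrightarrow> half_int P a b \<in> J2" for a b
    proof -
      have "red (a, b) \<in> J1 \<longleftrightarrow> red (a, b) \<in> J2" using redF[of a b] eq by blast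
      thus ?thesis using red_iff J1 J2 by blast
    qed
    show "J1 = J2"
    proof (rule Set.set_eqI)
      fix x
      show "x \<in> J1 \<longleftrightarrow> x \<in> J2"
      proof (cases "x \<in> carrier R")
        case True
        then obtain a b where "x = half_int P a b" by (rule OK_E)
        thus ?thesis using iff by simp
      next
        case False
        thus ?thesis using idealD(1) J1 J2 by blast
      qed
    qed
  qed
  moreover have "finite ((\<lambda>J. J \<inter> F) ` {J. ideal J R \<and> of_nat M \<in> J})"
    by (rule finite_subset[of _ "Pow F"]) (use fin in auto)
  ultimately show ?thesis by (rule finite_imageD[rotated])
qed

text \<open>
  Multiplying by the \<open>i\<close>-th power of the conjugate ideal cancels the common factor \<open>I ^ i\<close>.
\<close>

lemma principal_from_equivalent_powers:
  assumes I: "ideal I R" and nz: "x0 \<in> I" "x0 \<noteq> 0" and ij: "i < j"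
    and ab: "a \<in> carrier R" "b \<in> carrier R" "a \<noteq> 0" "b \<noteq> 0"
    and eq: "mult ideal_monoid (principal a) (I [^]\<^bsub>ideal_monoid\<^esub> (i::nat)) = mult ideal_monoid (principal b) (I [^]\<^bsub>ideal_monoid\<^esub> j)"
  shows "\<exists>c\<in>carrier R. I [^]\<^bsub>ideal_monoid\<^esub> (j - i) = principal c"
proof -
  interpret CM: comm_monoid ideal_monoid by (rule ideal_comm_monoid)
  have mem: "X \<in> carrier ideal_monoid \<longleftrightarrow> ideal X R" for X by (simp add: ideal_monoid_simps)
  obtain G :: nat where G: "G > 0" "mult ideal_monoid I (cnj ` I) = principal (of_nat G)"
    using ideal_times_cnj[OF I nz] by blast
  let ?C = "cnj ` I" and ?g = "of_nat G ^ i :: complex" and ?J = "I [^]\<^bsub>ideal_monoid\<^esub> (j - i)"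
  have IC: "I \<in> carrier ideal_monoid" "?C \<in> carrier ideal_monoid" "principal a \<in> carrier ideal_monoid" "principal b \<in> carrier ideal_monoid"
    using I cnj_ideal[OF I] principal_is_ideal ab by (simp_all add: mem)
  have gR: "?g \<in> carrier R" by simp
  have IiC: "mult ideal_monoid (I [^]\<^bsub>ideal_monoid\<^esub> i) (?C [^]\<^bsub>ideal_monoid\<^esub> i) = principal ?g"
    using CM.nat_pow_distrib[OF IC(1,2), of i] G(2) principal_power[of "of_nat G" i] by simp
  have Ij: "I [^]\<^bsub>ideal_monoid\<^esub> j = mult ideal_monoid (I [^]\<^bsub>ideal_monoid\<^esub> i) ?J"
    using CM.nat_pow_mult[OF IC(1), of i "j - i"] ij by simp
  have "principal (a * ?g) = mult ideal_monoid (principal a) (mult ideal_monoid (I [^]\<^bsub>ideal_monoid\<^esub> i) (?C [^]\<^bsub>ideal_monoid\<^esub> i))"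
    unfolding IiC using principal_mult[OF ab(1) gR] by simp
  also have "\<dots> = mult ideal_monoid (mult ideal_monoid (principal a) (I [^]\<^bsub>ideal_monoid\<^esub> i)) (?C [^]\<^bsub>ideal_monoid\<^esub> i)"
    using IC by (simp add: CM.m_assoc)
  also have "\<dots> = mult ideal_monoid (mult ideal_monoid (principal b) (mult ideal_monoid (I [^]\<^bsub>ideal_monoid\<^esub> i) ?J)) (?C [^]\<^bsub>ideal_monoid\<^esub> i)"
    unfolding eq Ij ..
  also have "\<dots> = mult ideal_monoid (mult ideal_monoid (principal b) (mult ideal_monoid (I [^]\<^bsub>ideal_monoid\<^esub> i) (?C [^]\<^bsub>ideal_monoid\<^esub> i))) ?J"
    using IC by (simp add: CM.m_assoc CM.m_lcomm CM.m_comm)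
  also have "\<dots> = mult ideal_monoid (principal (b * ?g)) ?J"
    unfolding IiC principal_mult[OF ab(2) gR] ..
  also have "\<dots> = (\<lambda>x. (b * ?g) * x) ` ?J"
    using ab(2) gR by (intro principal_times_ideal ideal_power I) auto
  finally have eq2: "principal (a * ?g) = (\<lambda>x. (b * ?g) * x) ` ?J" .
  have J: "ideal ?J R" by (rule ideal_power[OF I])
  have "a * ?g \<in> principal (a * ?g)" unfolding principal_def using OK_1 by force
  then obtain c where c: "c \<in> ?J" "a * ?g = (b * ?g) * c" unfolding eq2 by blast
  have nz': "b * ?g \<noteq> 0" using ab G by simp
  have "?J = principal c"
  proof
    show "principal c \<subseteq> ?J" unfolding principal_def using idealD(4)[OF J c(1)] by blast
    show "?J \<subseteq> principal c"
    proof
      fix x assume "x \<in> ?J"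
      hence "(b * ?g) * x \<in> principal (a * ?g)" unfolding eq2 by blast
      then obtain r where r: "r \<in> carrier R" "(b * ?g) * x = r * (a * ?g)" unfolding principal_def by blast
      hence "(b * ?g) * x = (b * ?g) * (r * c)" unfolding c(2) by (simp add: mult_ac)
      hence "x = r * c" using nz' by (metis mult_left_cancel)
      thus "x \<in> principal c" unfolding principal_def using r by blast
    qed
  qed
  thus ?thesis using idealD(1)[OF J c(1)] by blast
qed

text \<open>
  With \<open>c\<close> the number of ideals containing \<open>M\<close>, two of the powers \<open>I ^ 0, ..., I ^ c\<close> have the
  same representative, so \<open>I ^ e\<close> is principal for some \<open>1 \<le> e \<le> c\<close>, and \<open>e\<close> divides \<open>fact c\<close>.
\<close>

lemma uniform_exponent: "\<exists>h>0. \<forall>I. ideal I R \<longrightarrow> principalideal (I [^]\<^bsub>ideal_monoid\<^esub> (h::nat)) R"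
proof -
  interpret CM: comm_monoid ideal_monoid by (rule ideal_comm_monoid)
  define M :: nat where "M = fact approx_bound"
  define Js where "Js = {J. ideal J R \<and> of_nat M \<in> J}"
  define c where "c = card Js"
  have M0: "M > 0" by (simp add: M_def)
  have fin: "finite Js" unfolding Js_def by (rule finite_ideals_containing[OF M0])
  have "principalideal (I [^]\<^bsub>ideal_monoid\<^esub> (fact c :: nat)) R" if I: "ideal I R" for I
  proof (cases "\<exists>x\<in>I. x \<noteq> 0")
    case False
    hence "I = {0}" using idealD(2)[OF I] by blast
    also have "\<dots> = principal 0"
    proof -
      have "carrier R \<noteq> {}" using OK_0 by blast
      thus ?thesis by (simp add: principal_def image_constant_conv)
    qed
    finally have "I [^]\<^bsub>ideal_monoid\<^esub> (fact c :: nat) = principal (0 ^ fact c)" using principal_power[of 0] by simp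
    thus ?thesis using principal_iff by fastforce
  next
    case True
    then obtain x where x: "x \<in> I" "x \<noteq> 0" by blast
    have "\<exists>\<alpha> J. \<alpha> \<in> carrier R \<and> \<alpha> \<noteq> 0 \<and> J \<in> Js \<and> mult ideal_monoid (principal \<alpha>) J = mult ideal_monoid (principal (of_nat M)) (I [^]\<^bsub>ideal_monoid\<^esub> i)" for i :: nat
      using ideal_class_representative[OF ideal_power[OF I, of i] power_mem_ideal_power[OF x(1), of i]] x(2)
      unfolding Js_def M_def by fastforce
    then obtain \<alpha> J where aJ: "\<And>i. \<alpha> i \<in> carrier R" "\<And>i. \<alpha> i \<noteq> 0" "\<And>i::nat. J i \<in> Js"
      "\<And>i. mult ideal_monoid (principal (\<alpha> i)) (J i) = mult ideal_monoid (principal (of_nat M)) (I [^]\<^bsub>ideal_monoid\<^esub> i)" by metis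
    have "\<not> inj_on J {0..c}"
    proof (rule pigeonhole)
      have "card (J ` {0..c}) \<le> card Js" using fin aJ(3) by (intro card_mono) auto
      thus "card (J ` {0..c}) < card {0..c}" by (simp add: c_def)
    qed
    then obtain i j where ij: "i < j" "j \<le> c" "J i = J j"
      unfolding inj_on_def by (metis atLeastAtMost_iff linorder_neqE_nat)
    have mem: "X \<in> carrier ideal_monoid \<longleftrightarrow> ideal X R" for X by (simp add: ideal_monoid_simps)
    have ids: "principal (\<alpha> i) \<in> carrier ideal_monoid" "principal (\<alpha> j) \<in> carrier ideal_monoid" "J j \<in> carrier ideal_monoid" "I \<in> carrier ideal_monoid"
      "principal (of_nat M) \<in> carrier ideal_monoid"
      using principal_is_ideal aJ(1,3) I by (auto simp: mem Js_def)
    have MR: "of_nat M * \<alpha> i \<in> carrier R" "of_nat M * \<alpha> j \<in> carrier R" using aJ(1) by auto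
    have "mult ideal_monoid (principal (of_nat M * \<alpha> j)) (I [^]\<^bsub>ideal_monoid\<^esub> i) = mult ideal_monoid (principal (\<alpha> j)) (mult ideal_monoid (principal (of_nat M)) (I [^]\<^bsub>ideal_monoid\<^esub> i))"
      unfolding principal_mult[OF OK_nat aJ(1), symmetric] using ids by (simp add: CM.m_assoc CM.m_lcomm)
    also have "\<dots> = mult ideal_monoid (principal (\<alpha> j)) (mult ideal_monoid (principal (\<alpha> i)) (J j))" using aJ(4)[of i] ij(3) by simp
    also have "\<dots> = mult ideal_monoid (principal (\<alpha> i)) (mult ideal_monoid (principal (\<alpha> j)) (J j))" using ids by (simp add: CM.m_lcomm)
    also have "\<dots> = mult ideal_monoid (principal (of_nat M * \<alpha> i)) (I [^]\<^bsub>ideal_monoid\<^esub> j)"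
      unfolding principal_mult[OF OK_nat aJ(1), symmetric] aJ(4)[of j] using ids by (simp add: CM.m_assoc CM.m_lcomm)
    finally have "\<exists>b\<in>carrier R. I [^]\<^bsub>ideal_monoid\<^esub> (j - i) = principal b"
      using MR aJ(2) M0 by (intro principal_from_equivalent_powers[OF I x ij(1) MR(2,1)]) auto
    then obtain b where b: "b \<in> carrier R" "I [^]\<^bsub>ideal_monoid\<^esub> (j - i) = principal b" by blast
    have "j - i dvd fact c" using ij by (intro dvd_fact) auto
    then obtain k where k: "fact c = (j - i) * k" by (elim dvdE)
    have "I [^]\<^bsub>ideal_monoid\<^esub> (fact c :: nat) = (I [^]\<^bsub>ideal_monoid\<^esub> (j - i)) [^]\<^bsub>ideal_monoid\<^esub> k"
      unfolding k using ids(4) by (simp add: CM.nat_pow_pow)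
    also have "\<dots> = principal (b ^ k)" unfolding b(2) by (rule principal_power[OF b(1)])
    finally show ?thesis using principal_iff b(1) OK_power by blast
  qed
  thus ?thesis by (intro exI[of _ "fact c"]) auto
qed

text \<open>
  Only through the existence of an exponent does the \<open>LEAST\<close> in the definition of \<^const>\<open>h_exp\<close> acquire
  its meaning.
\<close>

lemma h_exp_spec:
  shows "h_exp (- int P) > 0" and "ideal I R \<Longrightarrow> principalideal (I [^]\<^bsub>ideal_monoid\<^esub> h_exp (- int P)) R"
proof -
  obtain h :: nat where "h > 0 \<and> (\<forall>I. ideal I R \<longrightarrow> principalideal (I [^]\<^bsub>ideal_monoid\<^esub> h) R)" using uniform_exponent by blast
  from LeastI[of "\<lambda>h. h > 0 \<and> (\<forall>I. ideal I R \<longrightarrow> principalideal (I [^]\<^bsub>ideal_monoid\<^esub> h) R)", OF this]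
  show "h_exp (- int P) > 0" and "ideal I R \<Longrightarrow> principalideal (I [^]\<^bsub>ideal_monoid\<^esub> h_exp (- int P)) R"
    unfolding h_exp_def by blast+
qed

section \<open>Roots of elements of prime power norm\<close>

text \<open>
  The ideal is \<open>I = (p, z)\<close>. Its \<open>k\<close>-th power lies in \<open>(p ^ k, z)\<close>, and \<open>(p ^ m, z) = (z)\<close> since
  \<open>z\<close> divides \<open>p ^ m\<close>. In the other direction the power contains \<open>p ^ m = z * cnj z\<close> and \<open>z ^ m\<close>,
  and \<open>cnj z\<close> is comaximal with \<open>z ^ (m - 1)\<close>, because \<open>z\<close> and \<open>cnj z\<close> generate the coprime
  integers \<open>t\<close> and \<open>p ^ m\<close>.
\<close>

lemma ideal_power_generated:
  assumes z: "z \<in> carrier R" and nz: "z * cnj z = of_nat (p ^ m)" and tr: "z + cnj z = of_int t"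
    and cop: "coprime t (int p)" and m: "m > 0"
  shows "\<exists>I. ideal I R \<and> I [^]\<^bsub>ideal_monoid\<^esub> m = principal z"
proof -
  interpret CM: comm_monoid ideal_monoid by (rule ideal_comm_monoid)
  \<comment> \<open>the ideal \<open>(p ^ k, z)\<close>\<close>
  define S where "S = (\<lambda>k::nat. {of_nat p ^ k * u + z * v | u v. u \<in> carrier R \<and> v \<in> carrier R})"
  have SI: "of_nat p ^ k * u + z * v \<in> S k" if "u \<in> carrier R" "v \<in> carrier R" for k u v
    unfolding S_def using that by blast
  have S_ideal: "ideal (S k) R" for k
    unfolding ideal_iff
  proof (intro conjI ballI)
    show "S k \<subseteq> carrier R" using z by (auto simp: S_def)
    show "0 \<in> S k" unfolding S_def by (intro CollectI exI[of _ 0]) auto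
    fix x assume "x \<in> S k"
    then obtain u v where uv: "x = of_nat p ^ k * u + z * v" "u \<in> carrier R" "v \<in> carrier R" by (auto simp: S_def)
    show "x + y \<in> S k" if "y \<in> S k" for y
    proof -
      obtain u' v' where uv': "y = of_nat p ^ k * u' + z * v'" "u' \<in> carrier R" "v' \<in> carrier R"
        using \<open>y \<in> S k\<close> by (auto simp: S_def)
      have e: "x + y = of_nat p ^ k * (u + u') + z * (v + v')" unfolding uv uv' by (simp add: algebra_simps)
      show ?thesis unfolding e by (rule SI) (use uv uv' in auto)
    qed
    show "a * x \<in> S k" if "a \<in> carrier R" for a
    proof -
      have e: "a * x = of_nat p ^ k * (a * u) + z * (a * v)" unfolding uv by (simp add: algebra_simps)
      show ?thesis unfolding e by (rule SI) (use uv that in auto)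
    qed
  qed
  define I where "I = S 1"
  have I: "ideal I R" unfolding I_def by (rule S_ideal)
  have sub: "I [^]\<^bsub>ideal_monoid\<^esub> k \<subseteq> S k" for k :: nat
  proof (induction k)
    case 0
    have "x \<in> S 0" if "x \<in> carrier R" for x
      unfolding S_def using that by (intro CollectI exI[of _ x] exI[of _ 0]) auto
    thus ?case by (auto simp: ideal_monoid_simps)
  next
    case (Suc k)
    have "ideal_prod R (I [^]\<^bsub>ideal_monoid\<^esub> k) I \<subseteq> S (Suc k)"
    proof (rule ideal_prod_subset)
      fix x y assume "x \<in> I [^]\<^bsub>ideal_monoid\<^esub> k" "y \<in> I"
      then obtain u v u' v' where uv: "x = of_nat p ^ k * u + z * v" "u \<in> carrier R" "v \<in> carrier R"
        and uv': "y = of_nat p * u' + z * v'" "u' \<in> carrier R" "v' \<in> carrier R"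
        using Suc by (auto simp: S_def I_def)
      have "x * y = of_nat p ^ Suc k * (u * u') + z * (of_nat p ^ k * u * v' + v * (of_nat p * u') + z * v * v')"
        unfolding uv uv' by (simp add: algebra_simps)
      moreover have "of_nat p ^ k * u * v' + v * (of_nat p * u') + z * v * v' \<in> carrier R" "u * u' \<in> carrier R"
        using uv uv' z by auto
      ultimately show "x * y \<in> S (Suc k)" unfolding S_def by blast
    qed (rule idealD(3)[OF S_ideal])
    thus ?case by (simp add: ideal_monoid_simps)
  qed
  have "I [^]\<^bsub>ideal_monoid\<^esub> m \<subseteq> principal z"
  proof
    fix x assume "x \<in> I [^]\<^bsub>ideal_monoid\<^esub> m"
    then obtain u v where uv: "x = of_nat p ^ m * u + z * v" "u \<in> carrier R" "v \<in> carrier R"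
      using sub[of m] by (auto simp: S_def)
    have "x = (cnj z * u + v) * z" unfolding uv using nz by (simp add: algebra_simps)
    thus "x \<in> principal z" unfolding principal_def using uv z by auto
  qed
  moreover have "principal z \<subseteq> I [^]\<^bsub>ideal_monoid\<^esub> m"
  proof -
    have J: "ideal (I [^]\<^bsub>ideal_monoid\<^esub> m) R" by (rule ideal_power[OF I])
    have "coprime t (int p ^ m)" using cop by simp
    then obtain i j where ij: "i * t + j * int p ^ m = 1"
      by (metis bezout_int coprime_iff_gcd_eq_1)
    define q where "q = of_int i + of_int j * z"
    have "cnj z * q + z * of_int i = of_int i * (z + cnj z) + of_int j * (z * cnj z)"
      by (simp add: q_def algebra_simps)
    also have "\<dots> = of_int (i * t + j * int p ^ m)" unfolding nz tr by simp
    finally have base: "cnj z * q + z * of_int i = 1" unfolding ij by simp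
    have q: "q \<in> carrier R" using z by (simp add: q_def)
    have bez: "\<exists>u\<in>carrier R. \<exists>v\<in>carrier R. cnj z * u + z ^ k * v = 1" for k
    proof (induction k)
      case 0
      show ?case by (intro bexI[of _ 0] bexI[of _ 1]) auto
    next
      case (Suc k)
      then obtain u v where uv: "u \<in> carrier R" "v \<in> carrier R" "cnj z * u + z ^ k * v = 1" by blast
      have "cnj z * (u + z ^ k * v * q) + z ^ Suc k * (v * of_int i) = cnj z * u + z ^ k * v * (cnj z * q + z * of_int i)"
        by (simp add: algebra_simps)
      also have "\<dots> = 1" unfolding base using uv by simp
      finally show ?case using uv z q by (intro bexI[of _ "u + z ^ k * v * q"] bexI[of _ "v * of_int i"]) auto
    qed
    obtain u v where uv: "u \<in> carrier R" "v \<in> carrier R" "cnj z * u + z ^ (m - 1) * v = 1" using bez by blast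
    have pI: "of_nat p \<in> I" unfolding I_def S_def by (intro CollectI exI[of _ 1] exI[of _ 0]) auto
    have zI: "z \<in> I" unfolding I_def S_def by (intro CollectI exI[of _ 0] exI[of _ 1]) auto
    have "u * of_nat p ^ m + v * z ^ m \<in> I [^]\<^bsub>ideal_monoid\<^esub> m"
      using idealD(3,4)[OF J] power_mem_ideal_power[OF pI, of m] power_mem_ideal_power[OF zI, of m] uv(1,2) by blast
    also have "u * of_nat p ^ m + v * z ^ m = z * (cnj z * u + z ^ (m - 1) * v)"
    proof -
      have "z ^ m = z * z ^ (m - 1)" using m by (simp add: power_eq_if)
      moreover have "of_nat p ^ m = z * cnj z" using nz by simp
      ultimately show ?thesis by (simp add: algebra_simps)
    qed
    also have "\<dots> = z" unfolding uv by simp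
    finally show ?thesis unfolding principal_def using idealD(4)[OF J] by blast
  qed
  ultimately show ?thesis using I by blast
qed

lemma norm_eq_1_if: "x * cnj x = 1 \<Longrightarrow> norm x = 1"
proof -
  assume "x * cnj x = 1"
  hence "complex_of_real ((norm x)\<^sup>2) = of_real 1" by (simp only: complex_norm_square of_real_1)
  hence "(norm x)\<^sup>2 = 1" by (simp only: of_real_eq_iff)
  hence "norm x = 1 \<or> norm x = -1" by (simp only: power2_eq_1_iff)
  thus "norm x = 1" using norm_ge_zero[of x] by linarith
qed

lemma associated_if_principal_eq:
  assumes "a \<in> carrier R" "b \<in> carrier R" "b \<noteq> 0" "principal a = principal b"
  shows "\<exists>\<epsilon>\<in>carrier R. a = \<epsilon> * b \<and> norm \<epsilon> = 1"
proof -
  have "a \<in> principal a" "b \<in> principal b" unfolding principal_def using OK_1 by force+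
  hence "a \<in> principal b" "b \<in> principal a" using assms by auto
  then obtain e f where e: "a = e * b" "e \<in> carrier R" and f: "b = f * a" "f \<in> carrier R"
    unfolding principal_def by blast
  have "b = (f * e) * b" using e f by (metis mult.assoc)
  hence fe: "f * e = 1" using assms(3) by simp
  obtain n1 :: nat where n1: "e * cnj e = of_nat n1" using OK_norm e by blast
  obtain n2 :: nat where n2: "f * cnj f = of_nat n2" using OK_norm f by blast
  have "of_nat (n2 * n1) = (f * e) * cnj (f * e)" using n1 n2 by (simp add: mult_ac)
  hence "(of_nat (n2 * n1) :: complex) = of_nat 1" unfolding fe by simp
  hence "n1 = 1" by (simp only: of_nat_eq_iff) simp
  hence "norm e = 1" using n1 by (intro norm_eq_1_if) simp
  thus ?thesis using e by blast
qed

lemma algebraic_int_power_root: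
  assumes "algebraic_int (x ^ n :: complex)" "n > 0"
  shows "algebraic_int x"
  by (rule algebraic_int_root[OF assms(1), of "Polynomial.monom 1 n"])
     (use assms(2) in \<open>auto simp: poly_monom Polynomial.degree_monom_eq\<close>)

text \<open>
  Let \<open>I ^ m = (z)\<close> and \<open>I ^ H = (\<alpha>)\<close>, so that \<open>\<alpha> ^ m\<close> is a unit times \<open>z ^ H\<close>. If \<open>H * a = m * b
  + d\<close> with \<open>d = gcd H m\<close>, then \<open>\<gamma> = \<alpha> ^ a / z ^ b\<close> would generate \<open>I ^ d\<close>. No further ideals are
  needed to see this: \<open>\<gamma> ^ m\<close> is a unit times \<open>z ^ d\<close>, so \<open>\<gamma>\<close> is an algebraic integer, and \<open>\<gamma> ^ (m
  / d) / z\<close> is a unit since a power of it is one.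
\<close>

lemma root_of_prime_power_norm:
  assumes z: "z \<in> carrier R" and nz: "z * cnj z = of_nat (p ^ m)" and tr: "z + cnj z = of_int t"
    and cop: "coprime t (int p)" and m: "m > 0" and p: "p > 0"
  shows "\<exists>\<gamma>\<in>carrier R. \<exists>\<eta>\<in>carrier R. \<exists>d k. d * k = m \<and> d dvd h_exp (- int P) \<and> norm \<eta> = 1 \<and> \<gamma> ^ k = \<eta> * z"
proof -
  interpret CM: comm_monoid ideal_monoid by (rule ideal_comm_monoid)
  define H where "H = h_exp (- int P)"
  have H0: "H > 0" unfolding H_def by (rule h_exp_spec(1))
  obtain I where I: "ideal I R" "I [^]\<^bsub>ideal_monoid\<^esub> m = principal z" using ideal_power_generated[OF z nz tr cop m] by blast
  obtain \<alpha> where \<alpha>: "\<alpha> \<in> carrier R" "I [^]\<^bsub>ideal_monoid\<^esub> H = principal \<alpha>"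
    using h_exp_spec(2)[OF I(1)] unfolding principal_iff H_def by blast
  have z0: "z \<noteq> 0" using nz p by auto
  have Ic: "I \<in> carrier ideal_monoid" using I by (simp add: ideal_monoid_simps)
  have "principal (\<alpha> ^ m) = I [^]\<^bsub>ideal_monoid\<^esub> (H * m)" unfolding principal_power[OF \<alpha>(1), symmetric] \<alpha>(2)[symmetric] using Ic by (simp add: CM.nat_pow_pow)
  also have "\<dots> = principal (z ^ H)" unfolding principal_power[OF z, symmetric] I(2)[symmetric] using Ic by (simp add: CM.nat_pow_pow mult.commute)
  finally obtain \<epsilon> where \<epsilon>: "\<epsilon> \<in> carrier R" "\<alpha> ^ m = \<epsilon> * z ^ H" "norm \<epsilon> = 1"
    using associated_if_principal_eq[of "\<alpha> ^ m" "z ^ H"] \<alpha>(1) z z0 by auto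
  define d where "d = gcd H m"
  obtain a b where ab: "H * a = m * b + d" using bezout_nat[of H m] H0 unfolding d_def by blast
  have d0: "d > 0" using m by (simp add: d_def)
  obtain k where k: "m = d * k" unfolding d_def by (metis gcd_dvd2 dvd_def)
  have k0: "k > 0" using m k by (cases k) auto
  have div_z: "x / z ^ i \<in> quadratic_field (- int P)" if "x \<in> carrier R" for x i
  proof -
    have "x / z ^ i = (x * cnj z ^ i) / (z * cnj z) ^ i" using z0 by (simp add: power_mult_distrib)
    also have "\<dots> = (x * cnj z ^ i) / of_nat ((p ^ m) ^ i)" unfolding nz by simp
    finally have e: "x / z ^ i = (x * cnj z ^ i) / of_nat ((p ^ m) ^ i)" .
    show ?thesis unfolding e by (rule quadratic_field_divide_nat) (use that z in auto)
  qed
  define \<gamma> where "\<gamma> = \<alpha> ^ a / z ^ b"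
  have "\<gamma> ^ m = (\<alpha> ^ m) ^ a / z ^ (m * b)"
    by (simp add: \<gamma>_def power_divide power_mult[symmetric] mult.commute)
  also have "\<dots> = \<epsilon> ^ a * z ^ (H * a) / z ^ (m * b)"
    unfolding \<epsilon>(2) by (simp add: power_mult_distrib power_mult)
  also have "\<dots> = \<epsilon> ^ a * z ^ d" unfolding ab using z0 by (simp add: power_add)
  finally have \<gamma>m: "\<gamma> ^ m = \<epsilon> ^ a * z ^ d" .
  have alg: "algebraic_int x" if "x \<in> carrier R" for x using that by (simp add: ring_of_integers_def)
  have OKI: "x \<in> carrier R" if "x \<in> quadratic_field (- int P)" "algebraic_int x" for x
    using that by (simp add: ring_of_integers_def)
  have "algebraic_int (\<gamma> ^ m)" unfolding \<gamma>m using \<epsilon> z by (intro alg) auto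
  hence "algebraic_int \<gamma>" using m by (rule algebraic_int_power_root)
  moreover have "\<gamma> \<in> quadratic_field (- int P)" unfolding \<gamma>_def using \<alpha> by (intro div_z) auto
  ultimately have \<gamma>R: "\<gamma> \<in> carrier R" by (rule OKI[rotated])
  define \<eta> where "\<eta> = \<gamma> ^ k / z ^ 1"
  have \<eta>d: "\<eta> ^ d = \<epsilon> ^ a"
  proof -
    have "\<eta> ^ d = \<gamma> ^ m / z ^ d" by (simp add: \<eta>_def power_divide power_mult[symmetric] k mult.commute)
    thus ?thesis unfolding \<gamma>m using z0 by simp
  qed
  have "algebraic_int (\<eta> ^ d)" unfolding \<eta>d using \<epsilon> by (intro alg) auto
  hence "algebraic_int \<eta>" using d0 by (rule algebraic_int_power_root)
  moreover have "\<eta> \<in> quadratic_field (- int P)" unfolding \<eta>_def using \<gamma>R by (intro div_z) auto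
  ultimately have \<eta>R: "\<eta> \<in> carrier R" by (rule OKI[rotated])
  have "norm \<eta> ^ d = 1 ^ d" using \<eta>d \<epsilon>(3) by (metis norm_power power_one)
  hence "norm \<eta> = 1" by (rule power_eq_imp_eq_base) (use d0 in auto)
  moreover have "\<gamma> ^ k = \<eta> * z" using z0 by (simp add: \<eta>_def)
  moreover have "d dvd h_exp (- int P)" by (simp add: d_def H_def)
  ultimately show ?thesis using \<gamma>R \<eta>R k by blast
qed

section \<open>Units\<close>

lemma pair_eq_iff:
  "of_int a + of_int b * sqrtm P = of_int c + of_int d * sqrtm P \<longleftrightarrow> a = c \<and> b = d"
proof -
  have e: "of_int a + of_int b * sqrtm P = half_int P (2 * a) (2 * b)" for a b
    unfolding half_int_def by (simp only: of_int_mult of_int_numeral) (simp add: field_simps)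
  show ?thesis unfolding e half_int_eq_iff[OF P0] by simp
qed

lemma half_int_even: "half_int P (2 * a) (2 * b) = of_int a + of_int b * sqrtm P"
  unfolding half_int_def by (simp only: of_int_mult of_int_numeral) (simp add: field_simps)

lemma pair_mult:
  "(of_int a + of_int b * sqrtm P) * (of_int c + of_int d * sqrtm P)
   = of_int (a * c - int P * (b * d)) + of_int (a * d + b * c) * sqrtm P"
proof -
  have "(of_int a + of_int b * sqrtm P) * (of_int c + of_int d * sqrtm P)
     = of_int (a * c) + of_int (b * d) * (sqrtm P * sqrtm P) + of_int (a * d + b * c) * sqrtm P"
    by (simp only: of_int_mult of_int_add) (simp add: algebra_simps)
  also have "\<dots> = of_int (a * c - int P * (b * d)) + of_int (a * d + b * c) * sqrtm P"
    unfolding sqrtm_square by (simp add: mult.commute)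
  finally show ?thesis .
qed

lemma norm_half_int:
  assumes "norm (half_int P a b) = 1"
  shows "a\<^sup>2 + int P * b\<^sup>2 = 4"
proof -
  have "half_int P a b * cnj (half_int P a b) = 1" using assms by (metis complex_norm_square of_real_1 power_one)
  hence "(of_int (a\<^sup>2 + int P * b\<^sup>2) :: complex) = of_int 4" unfolding half_int_norm by simp
  thus ?thesis by (simp only: of_int_eq_iff)
qed

text \<open>
  A unit \<open>half_int P a b\<close> satisfies \<open>a\<^sup>2 + P * b\<^sup>2 = 4\<close>.
\<close>

lemma unit_cases:
  assumes \<eta>: "\<eta> \<in> carrier R" "norm \<eta> = 1"
  shows "\<eta> = 1 \<or> \<eta> = -1 \<or> (P = 1 \<and> (\<exists>f. f\<^sup>2 = 1 \<and> \<eta> = of_int f * sqrtm P))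
     \<or> (P = 3 \<and> (\<exists>e f. e\<^sup>2 = 1 \<and> f\<^sup>2 = 1 \<and> \<eta> = half_int P e f))"
proof -
  obtain a b where ab: "\<eta> = half_int P a b" "even a \<longleftrightarrow> even b" "odd a \<longrightarrow> P mod 4 = 3" using \<eta>(1) by (rule OK_E)
  have N: "a\<^sup>2 + int P * b\<^sup>2 = 4" using norm_half_int \<eta>(2) ab(1) by simp
  show ?thesis
  proof (cases "b = 0")
    case True
    then obtain c where c: "a = 2 * c" using ab(2) by auto
    hence "c\<^sup>2 = 1" using N True by simp
    hence "c = 1 \<or> c = -1" by (simp add: power2_eq_1_iff)
    thus ?thesis using ab(1) True c by (auto simp: half_int_def)
  next
    case False
    hence b1: "b\<^sup>2 \<ge> 1" by (simp add: int_one_le_iff_zero_less)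
    have Pb: "int P * 1 \<le> int P * b\<^sup>2" using b1 by (intro mult_left_mono) auto
    hence "int P \<le> 4" using N zero_le_power2[of a] by linarith
    moreover have "P \<noteq> 4"
    proof
      assume "P = 4"
      hence "2\<^sup>2 dvd P" by simp
      thus False using sf unfolding squarefree_def by (metis nat_dvd_1_iff_1 numeral_eq_one_iff semiring_norm(85))
    qed
    ultimately have "P = 1 \<or> P = 2 \<or> P = 3" using P0 by linarith
    thus ?thesis
    proof (elim disjE)
      assume P1: "P = 1"
      obtain c d where cd: "a = 2 * c" "b = 2 * d" using ab(2,3) P1 by (auto elim!: evenE)
      have "c\<^sup>2 + d\<^sup>2 = 1" using N P1 cd by simp
      moreover have "d\<^sup>2 \<ge> 1" using False cd by (simp add: int_one_le_iff_zero_less)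
      ultimately have "d\<^sup>2 = 1" "c\<^sup>2 = 0" using zero_le_power2[of c] by linarith+
      moreover have "\<eta> = of_int c + of_int d * sqrtm P" unfolding ab cd by (rule half_int_even)
      ultimately have "\<eta> = of_int d * sqrtm P" by simp
      thus ?thesis using \<open>d\<^sup>2 = 1\<close> P1 by blast
    next
      assume P2: "P = 2"
      obtain c d where cd: "a = 2 * c" "b = 2 * d" using ab(2,3) P2 by (auto elim!: evenE)
      have "c\<^sup>2 + 2 * d\<^sup>2 = 1" using N P2 cd by simp
      moreover have "d\<^sup>2 \<ge> 1" using False cd by (simp add: int_one_le_iff_zero_less)
      ultimately show ?thesis using zero_le_power2[of c] by linarith
    next
      assume P3: "P = 3"
      have "b\<^sup>2 = 1"
      proof (rule ccontr)
        assume "b\<^sup>2 \<noteq> 1"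
        hence "b\<^sup>2 \<ge> 2" using b1 by linarith
        thus False using N P3 zero_le_power2[of a] by simp
      qed
      moreover from this have "a\<^sup>2 = 1" using N P3 by simp
      ultimately show ?thesis using P3 ab(1) by blast
    qed
  qed
qed

lemma pair_power: "(of_int a + of_int b * sqrtm P) ^ n
   = of_int (qre a (int P * b\<^sup>2) n) + of_int (b * qim a (int P * b\<^sup>2) n) * sqrtm P"
proof (induction n)
  case (Suc n)
  show ?case unfolding power_Suc Suc pair_mult by (simp add: algebra_simps power2_eq_square)
qed auto

lemma norm_pair: "(of_int a + of_int b * sqrtm P) * cnj (of_int a + of_int b * sqrtm P) = of_int (a\<^sup>2 + int P * b\<^sup>2)"
proof -
  have "(of_int a + of_int b * sqrtm P) * cnj (of_int a + of_int b * sqrtm P)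
    = (of_int a + of_int b * sqrtm P) * (of_int a + of_int (- b) * sqrtm P)" by (simp add: cnj_sqrtm)
  also have "\<dots> = of_int (a\<^sup>2 + int P * b\<^sup>2)" unfolding pair_mult by (simp add: power2_eq_square)
  finally show ?thesis .
qed

lemma odd_norm_if_power:
  assumes \<gamma>: "\<gamma> = half_int P a b" "4 dvd a\<^sup>2 + int P * b\<^sup>2" and e: "\<gamma> ^ k * cnj (\<gamma> ^ k) = of_nat n" "odd n" "k > 0"
  obtains N where "a\<^sup>2 + int P * b\<^sup>2 = 4 * N" "odd N"
proof -
  obtain N where N: "a\<^sup>2 + int P * b\<^sup>2 = 4 * N" using \<gamma>(2) by (elim dvdE)
  have "\<gamma> * cnj \<gamma> = of_int N" unfolding \<gamma> half_int_norm N by simp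
  hence "(of_int (N ^ k) :: complex) = of_int (int n)" using e(1) by (simp flip: power_mult_distrib)
  hence "N ^ k = int n" by (simp only: of_int_eq_iff)
  hence "odd N" using e by (metis even_of_nat even_power)
  thus ?thesis using N that by blast
qed

text \<open>
  Only \<open>P = 1\<close> and \<open>P = 3\<close> have units other than \<open>\<plusminus> 1\<close>. There \<open>\<gamma>\<close> is first multiplied by a unit
  such that its real part is an odd integer and the other coefficient even (\<open>P = 1\<close>), or that both
  coefficients are integers (\<open>P = 3\<close>). As \<open>x\<close> is odd and \<open>D\<close> is even, comparing parities excludes
  all units but \<open>\<plusminus> 1\<close>.
\<close>

lemma root_up_to_sign:
  assumes z: "z = of_int x + of_int D * sqrtm P" and nz: "z * cnj z = of_nat (p ^ m)"
    and p: "prime p" "odd p" and cop: "\<not> int p dvd x" and m: "m > 0" and x: "odd x" and D: "odd P \<Longrightarrow> even D"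
  shows "\<exists>\<gamma>\<in>carrier R. \<exists>d k. d * k = m \<and> d dvd h_exp (- int P) \<and> (\<gamma> ^ k = z \<or> \<gamma> ^ k = - z) \<and>
           (P = 3 \<longrightarrow> (\<exists>a b. \<gamma> = of_int a + of_int b * sqrtm P))"
proof -
  have zR: "z \<in> carrier R" unfolding z by (rule OK_pair)
  have tr: "z + cnj z = of_int (2 * x)" unfolding z by (simp add: cnj_sqrtm)
  have "prime (int p)" using p by simp
  moreover have "\<not> int p dvd 2 * x"
  proof
    assume "int p dvd 2 * x"
    hence "int p dvd 2" using cop \<open>prime (int p)\<close> by (simp add: prime_dvd_mult_iff)
    hence "int p = 2" using \<open>prime (int p)\<close> primes_dvd_imp_eq[of "int p" 2] by simp
    thus False using p by simp
  qed
  ultimately have cop2: "coprime (2 * x) (int p)" using prime_imp_coprime coprime_commute by blast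
  have p0: "p > 0" using p prime_gt_0_nat by simp
  obtain \<gamma> \<eta> d k where g: "\<gamma> \<in> carrier R" "\<eta> \<in> carrier R" "d * k = m" "d dvd h_exp (- int P)"
    "norm \<eta> = 1" "\<gamma> ^ k = \<eta> * z"
    using root_of_prime_power_norm[OF zR nz tr cop2 m p0] by blast
  have k0: "k > 0" using g(3) m by (cases k) auto
  have unit_norm: "\<eta> * cnj \<eta> = 1" using g(5) by (metis complex_norm_square of_real_1 power_one)
  have gn: "\<gamma> ^ k * cnj (\<gamma> ^ k) = of_nat (p ^ m)"
  proof -
    have "\<gamma> ^ k * cnj (\<gamma> ^ k) = (\<eta> * cnj \<eta>) * (z * cnj z)" unfolding g by (simp add: mult_ac)
    thus ?thesis unfolding unit_norm nz by simp
  qed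
  have odd_pm: "odd (p ^ m)" using p by simp
  obtain a b where ab: "\<gamma> = half_int P a b" "4 dvd a\<^sup>2 + int P * b\<^sup>2" "even a \<longleftrightarrow> even b" "odd a \<longrightarrow> P mod 4 = 3"
    using g(1) by (rule OK_E)
  obtain N where N: "a\<^sup>2 + int P * b\<^sup>2 = 4 * N" "odd N" using odd_norm_if_power[OF ab(1,2) gn odd_pm k0] .
  consider "P = 1" | "P = 3" | "P \<noteq> 1" "P \<noteq> 3" by blast
  thus ?thesis
  proof cases
    case 3
    hence "\<eta> = 1 \<or> \<eta> = -1" using unit_cases[OF g(2,5)] by blast
    hence "\<gamma> ^ k = z \<or> \<gamma> ^ k = - z" using g(6) by auto
    thus ?thesis using g 3 by blast
  next
    case 1
    have "even a" using ab(4) 1 by auto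
    then obtain c e where ce: "a = 2 * c" "b = 2 * e" using ab(3) by (auto elim!: evenE)
    have gam: "\<gamma> = of_int c + of_int e * sqrtm P" unfolding ab ce by (rule half_int_even)
    have "c\<^sup>2 + e\<^sup>2 = N" using N ce 1 by simp
    hence par: "odd c \<longleftrightarrow> even e" using N(2) by (metis even_add even_power pos2)
    have "\<exists>\<gamma>' \<eta>' c' e'. \<gamma>' = of_int c' + of_int e' * sqrtm P \<and> odd c' \<and> even e' \<and> \<eta>' \<in> carrier R \<and> norm \<eta>' = 1 \<and> \<gamma>' ^ k = \<eta>' * z"
    proof (cases "odd c")
      case True
      thus ?thesis using gam par g(2,5,6) by blast
    next
      case False
      have i: "sqrtm P = \<i>" using 1 by (simp add: sqrtm_eq)
      have "sqrtm P * \<gamma> = of_int (- e) + of_int c * sqrtm P"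
        unfolding gam i by (simp add: algebra_simps)
      moreover have "(sqrtm P * \<gamma>) ^ k = (sqrtm P ^ k * \<eta>) * z"
        unfolding power_mult_distrib g(6) by simp
      moreover have "sqrtm P \<in> carrier R" using OK_pair[of 0 1] by simp
      moreover have "norm (sqrtm P ^ k * \<eta>) = 1" using g(5) unfolding i by (simp add: norm_mult norm_power)
      moreover have "odd (- e)" "even c" using par False by auto
      ultimately show ?thesis using g(2)
        by (intro exI[of _ "sqrtm P * \<gamma>"] exI[of _ "sqrtm P ^ k * \<eta>"] exI[of _ "- e"] exI[of _ c]) auto
    qed
    then obtain \<gamma>' \<eta>' c' e' where g': "\<gamma>' = of_int c' + of_int e' * sqrtm P" "odd c'" "even e'"
      "\<eta>' \<in> carrier R" "norm \<eta>' = 1" "\<gamma>' ^ k = \<eta>' * z" by blast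
    have "\<eta>' = 1 \<or> \<eta>' = -1"
    proof (rule ccontr)
      assume "\<not> ?thesis"
      then obtain f where f: "f\<^sup>2 = 1" "\<eta>' = of_int f * sqrtm P" using unit_cases[OF g'(4,5)] 1 by auto
      have "of_int (qre c' (int P * e'\<^sup>2) k) + of_int (e' * qim c' (int P * e'\<^sup>2) k) * sqrtm P = \<gamma>' ^ k"
        unfolding g'(1) pair_power ..
      also have "\<dots> = (of_int 0 + of_int f * sqrtm P) * (of_int x + of_int D * sqrtm P)"
        unfolding g'(6) f z by simp
      also have "\<dots> = of_int (- (int P * (f * D))) + of_int (f * x) * sqrtm P" unfolding pair_mult by simp
      finally have "qre c' (int P * e'\<^sup>2) k = - (int P * (f * D))" unfolding pair_eq_iff by blast
      moreover have "odd (qre c' (int P * e'\<^sup>2) k)" using g'(2,3) by (intro odd_qre) auto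
      moreover have "even D" using D 1 by simp
      ultimately show False by simp
    qed
    hence "\<gamma>' ^ k = z \<or> \<gamma>' ^ k = - z" using g'(6) by auto
    moreover have "\<gamma>' \<in> carrier R" unfolding g'(1) by (rule OK_pair)
    ultimately show ?thesis using g(3,4) 1 by (intro bexI[of _ \<gamma>'] exI[of _ d] exI[of _ k]) auto
  next
    case 2
    have "\<exists>\<gamma>' \<eta>' c e. \<gamma>' = of_int c + of_int e * sqrtm P \<and> \<eta>' \<in> carrier R \<and> norm \<eta>' = 1 \<and> \<gamma>' ^ k = \<eta>' * z"
    proof (cases "even a")
      case True
      then obtain c e where ce: "a = 2 * c" "b = 2 * e" using ab(3) by (auto elim!: evenE)
      have "\<gamma> = of_int c + of_int e * sqrtm P" unfolding ab ce by (rule half_int_even)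
      thus ?thesis using g(2,5,6) by blast
    next
      case False
      hence odd: "odd a" "odd b" using ab(3) by auto
      \<comment> \<open>One of the two products with a primitive sixth root of unity has integral coefficients.\<close>
      have "\<exists>s::int. s\<^sup>2 = 1 \<and> 4 dvd b + s * a"
      proof (cases "4 dvd b + a")
        case True thus ?thesis by (intro exI[of _ 1]) auto
      next
        case False
        hence "4 dvd b - a" using odd by presburger
        thus ?thesis by (intro exI[of _ "-1"]) auto
      qed
      then obtain s where s: "s\<^sup>2 = 1" "4 dvd b + s * a" by blast
      then obtain e where e: "b + s * a = 4 * e" by (elim dvdE)
      define \<omega> where "\<omega> = half_int P 1 s"
      have ss: "s * s = 1" using s(1) by (simp add: power2_eq_square)
      have e1: "a * 1 - int P * (b * s) = 4 * (a - 3 * e * s)"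
      proof -
        have "b * s = (4 * e - s * a) * s" using e by simp
        also have "\<dots> = 4 * e * s - a" using ss by (simp add: algebra_simps)
        finally show ?thesis using 2 by simp
      qed
      have e2: "a * s + b * 1 = 4 * e" using e by (simp add: mult.commute)
      have "\<gamma> * \<omega> = half_int P (4 * (a - 3 * e * s) div 2) (4 * e div 2)"
        unfolding ab(1) \<omega>_def by (rule half_int_mult[of a 1 b s, unfolded e1 e2]) simp_all
      also have "4 * (a - 3 * e * s) div 2 = 2 * (a - 3 * e * s)" by simp
      also have "4 * e div 2 = 2 * e" by simp
      finally have "\<gamma> * \<omega> = half_int P (2 * (a - 3 * e * s)) (2 * e)" .
      hence 1: "\<gamma> * \<omega> = of_int (a - 3 * e * s) + of_int e * sqrtm P" unfolding half_int_even .
      have \<omega>R: "\<omega> \<in> carrier R" unfolding \<omega>_def using s(1) 2 by (intro OK_I) simp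
      have "\<omega> * cnj \<omega> = 1" unfolding \<omega>_def half_int_norm using s(1) 2 by simp
      hence "norm \<omega> = 1" by (rule norm_eq_1_if)
      hence "norm (\<omega> ^ k * \<eta>) = 1" using g(5) by (simp add: norm_mult norm_power)
      moreover have "(\<gamma> * \<omega>) ^ k = (\<omega> ^ k * \<eta>) * z" unfolding power_mult_distrib g(6) by simp
      moreover have "\<omega> ^ k * \<eta> \<in> carrier R" using \<omega>R g(2) by simp
      ultimately show ?thesis using 1 by blast
    qed
    then obtain \<gamma>' \<eta>' c e where g': "\<gamma>' = of_int c + of_int e * sqrtm P"
      "\<eta>' \<in> carrier R" "norm \<eta>' = 1" "\<gamma>' ^ k = \<eta>' * z" by blast
    have "\<eta>' = 1 \<or> \<eta>' = -1"
    proof (rule ccontr)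
      assume "\<not> ?thesis"
      then obtain f h where f: "f\<^sup>2 = 1" "h\<^sup>2 = 1" "\<eta>' = half_int P f h" using unit_cases[OF g'(2,3)] 2 by auto
      define u v where "u = qre c (int P * e\<^sup>2) k" and "v = e * qim c (int P * e\<^sup>2) k"
      have "of_int (2 * u) + of_int (2 * v) * sqrtm P = 2 * \<gamma>' ^ k"
        unfolding g'(1) pair_power u_def v_def by (simp only: of_int_mult of_int_numeral) (simp add: algebra_simps)
      also have "\<dots> = (2 * half_int P f h) * z" unfolding g'(4) f(3) by simp
      also have "2 * half_int P f h = of_int f + of_int h * sqrtm P" by (simp add: half_int_def)
      also have "(of_int f + of_int h * sqrtm P) * z
         = of_int (f * x - int P * (h * D)) + of_int (f * D + h * x) * sqrtm P"
        unfolding z pair_mult ..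
      finally have "2 * v = f * D + h * x" unfolding pair_eq_iff by blast
      moreover have "even D" using D 2 by simp
      moreover have "odd h" using f(2) by (metis even_power odd_one pos2)
      ultimately show False using x by (metis even_add even_mult_iff even_numeral)
    qed
    hence "\<gamma>' ^ k = z \<or> \<gamma>' ^ k = - z" using g'(4) by auto
    moreover have "\<gamma>' \<in> carrier R" unfolding g'(1) by (rule OK_pair)
    ultimately show ?thesis using g(3,4) g'(1) by (intro bexI[of _ \<gamma>'] exI[of _ d] exI[of _ k]) auto
  qed
qed

end

section \<open>Ranks of apparition\<close>

text \<open>
  Compare multiplicities, which are at most \<open>1\<close> in \<open>Q\<close>.
\<close>

lemma squarefree_dvd_if_primes_dvd:
  fixes Q :: nat and b :: int
  assumes "squarefree Q" "\<And>q. prime q \<Longrightarrow> q dvd Q \<Longrightarrow> int q dvd b"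
  shows "int Q dvd b"
proof (cases "b = 0")
  case False
  have Q0: "Q \<noteq> 0" using assms(1) by (metis not_squarefree_0)
  have "Q dvd nat \<bar>b\<bar>"
  proof (rule multiplicity_le_imp_dvd[OF Q0])
    fix q :: nat assume q: "prime q"
    show "multiplicity q Q \<le> multiplicity q (nat \<bar>b\<bar>)"
    proof (cases "q dvd Q")
      case True
      have "multiplicity q Q = 1"
        using assms(1) q True unfolding squarefree_factorial_semiring'[OF Q0]
        by (simp add: in_prime_factors_iff Q0)
      moreover have "q dvd nat \<bar>b\<bar>" using assms(2)[OF q True] by simp
      hence "multiplicity q (nat \<bar>b\<bar>) \<ge> 1" using False q
        by (metis Suc_leI One_nat_def multiplicity_gt_zero_iff nat_0_iff not_prime_unit abs_le_zero_iff)
      ultimately show ?thesis by linarith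
    qed (simp add: not_dvd_imp_multiplicity_0)
  qed
  thus ?thesis by simp
qed auto

lemma int_fermat_legendre:
  assumes "prime q" "q = 2 * h + 1"
  shows "[(a::int) ^ h = Legendre a (int q)] (mod int q)" and "[a ^ q = a] (mod int q)"
proof -
  have q2: "q > 2" using assms prime_ge_2_nat[of q] by (cases h) auto
  show 1: "[a ^ h = Legendre a (int q)] (mod int q)"
    using euler_criterion[OF assms(1) q2, of a] assms(2) by (simp add: cong_sym)
  have "a ^ q = a * (a ^ h * a ^ h)" by (simp add: assms(2) power_add mult_2)
  also have "[\<dots> = a * (Legendre a (int q) * Legendre a (int q))] (mod int q)"
    by (intro cong_mult cong_refl 1)
  also have "[a * (Legendre a (int q) * Legendre a (int q)) = a] (mod int q)"
    by (auto simp: Legendre_def Cong.cong_def)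
  finally show "[a ^ q = a] (mod int q)" .
qed

context imag_quad begin

text \<open>
  The order of conductor \<open>q\<close> in the ring of all \<open>a + b * sqrt (- P)\<close> with integers \<open>a, b\<close>. That
  \<open>q\<close> divides the coefficient of \<open>sqrt (- P)\<close> in a power becomes membership in a multiplicatively
  closed set.
\<close>

definition pairs_mod :: "int \<Rightarrow> complex set" where
  "pairs_mod q = {of_int a + of_int (q * b) * sqrtm P | a b. True}"

lemma pairs_mod_iff: "of_int a + of_int b * sqrtm P \<in> pairs_mod q \<longleftrightarrow> q dvd b"
proof
  assume "of_int a + of_int b * sqrtm P \<in> pairs_mod q"
  then obtain c d where "of_int a + of_int b * sqrtm P = of_int c + of_int (q * d) * sqrtm P"
    unfolding pairs_mod_def by blast
  hence "b = q * d" unfolding pair_eq_iff by blast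
  thus "q dvd b" by simp
next
  assume "q dvd b"
  then obtain d where "b = q * d" by (elim dvdE)
  thus "of_int a + of_int b * sqrtm P \<in> pairs_mod q" unfolding pairs_mod_def by blast
qed

lemma pairs_modE:
  assumes "x \<in> pairs_mod q" obtains a b where "x = of_int a + of_int b * sqrtm P" "q dvd b"
proof -
  from assms obtain a b where "x = of_int a + of_int (q * b) * sqrtm P" unfolding pairs_mod_def by blast
  thus ?thesis by (rule that) simp
qed

lemma pairs_mod_mult: "x \<in> pairs_mod q \<Longrightarrow> y \<in> pairs_mod q \<Longrightarrow> x * y \<in> pairs_mod q"
  by (elim pairs_modE) (simp only: pair_mult pairs_mod_iff, simp)

lemma pairs_mod_add:
  assumes "x \<in> pairs_mod q" "y \<in> pairs_mod q" shows "x + y \<in> pairs_mod q"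
proof -
  obtain a b where x: "x = of_int a + of_int b * sqrtm P" "q dvd b" using assms(1) by (rule pairs_modE)
  obtain c d where y: "y = of_int c + of_int d * sqrtm P" "q dvd d" using assms(2) by (rule pairs_modE)
  have e: "x + y = of_int (a + c) + of_int (b + d) * sqrtm P" unfolding x y by (simp add: algebra_simps)
  show ?thesis unfolding e pairs_mod_iff by (rule dvd_add[OF x(2) y(2)])
qed

lemma pairs_mod_int: "of_int a \<in> pairs_mod q"
  using pairs_mod_iff[of a 0 q] by simp

lemma pairs_mod_power: "x \<in> pairs_mod q \<Longrightarrow> x ^ n \<in> pairs_mod q"
  by (induction n) (use pairs_mod_int[of 1] in \<open>auto intro: pairs_mod_mult\<close>)

lemma pairs_mod_minus: "x \<in> pairs_mod q \<Longrightarrow> - x \<in> pairs_mod q"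
  using pairs_mod_mult[OF pairs_mod_int[of "-1"]] by simp

lemma pairs_mod_sum: "(\<And>i. i \<in> S \<Longrightarrow> f i \<in> pairs_mod q) \<Longrightarrow> sum f S \<in> pairs_mod q"
  by (induction S rule: infinite_finite_induct) (use pairs_mod_int[of 0] in \<open>auto intro: pairs_mod_add\<close>)

lemma pairs_mod_1: "of_int a + of_int b * sqrtm P \<in> pairs_mod 1"
  unfolding pairs_mod_iff by simp

lemma times_pairs_mod: "y \<in> pairs_mod 1 \<Longrightarrow> of_int q * y \<in> pairs_mod q"
proof -
  assume "y \<in> pairs_mod 1"
  then obtain a b where "y = of_int a + of_int b * sqrtm P" by (rule pairs_modE)
  hence e: "of_int q * y = of_int (q * a) + of_int (q * b) * sqrtm P" by (simp add: algebra_simps)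
  show ?thesis unfolding e pairs_mod_iff by simp
qed

lemma pairs_mod_cancel:
  assumes "of_int N * x \<in> pairs_mod q" "x \<in> pairs_mod 1" "coprime q N"
  shows "x \<in> pairs_mod q"
proof -
  obtain a b where x: "x = of_int a + of_int b * sqrtm P" using assms(2) by (rule pairs_modE)
  have e: "of_int N * x = of_int (N * a) + of_int (N * b) * sqrtm P" unfolding x by (simp add: algebra_simps)
  have "q dvd N * b" using assms(1) unfolding e pairs_mod_iff .
  hence "q dvd b" using assms(3) by (simp add: coprime_dvd_mult_right_iff)
  thus ?thesis unfolding x pairs_mod_iff .
qed

lemma frobenius:
  assumes q: "prime q" and xy: "x \<in> pairs_mod 1" "y \<in> pairs_mod 1"
  shows "\<exists>r\<in>pairs_mod 1. (x + y) ^ q = x ^ q + y ^ q + of_int (int q) * r"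
proof -
  define f where "f = (\<lambda>k. of_nat (q choose k) * x ^ k * y ^ (q - k))"
  define g where "g = (\<lambda>k. of_int (int ((q choose k) div q)) * x ^ k * y ^ (q - k))"
  have q1: "q > 1" using q prime_gt_1_nat by blast
  have fg: "f k = of_int (int q) * g k" if "k \<in> {1..<q}" for k
  proof -
    have "q dvd q choose k" using dvd_choose_prime[of k q] that q by simp
    hence "(of_nat (q choose k) :: complex) = of_nat q * of_nat ((q choose k) div q)"
      by (metis dvd_mult_div_cancel of_nat_mult)
    thus ?thesis by (simp add: f_def g_def)
  qed
  have set_eq: "{..q} = insert 0 (insert q {1..<q})" using q1 by auto
  have "(x + y) ^ q = sum f {..q}" unfolding f_def by (rule binomial_ring)
  also have "\<dots> = f 0 + f q + sum f {1..<q}" unfolding set_eq using q1 by simp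
  also have "sum f {1..<q} = of_int (int q) * sum g {1..<q}"
    unfolding sum_distrib_left by (intro sum.cong refl fg)
  also have "f 0 + f q = x ^ q + y ^ q" by (simp add: f_def)
  finally have "(x + y) ^ q = x ^ q + y ^ q + of_int (int q) * sum g {1..<q}" .
  moreover have "sum g {1..<q} \<in> pairs_mod 1" unfolding g_def
    by (intro pairs_mod_sum pairs_mod_mult pairs_mod_power pairs_mod_int xy)
  ultimately show ?thesis by blast
qed

text \<open>
  For odd \<open>q\<close> the Frobenius congruence and Euler's criterion show that \<open>x ^ q\<close> is \<open>x\<close> or \<open>cnj x\<close>
  modulo \<open>q\<close>, according to the Legendre symbol. Multiplication by \<open>cnj x\<close> (and cancelling the
  norm, which is prime to \<open>q\<close>) or by \<open>x\<close> gives an integer modulo \<open>q\<close>.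
\<close>

lemma rank_of_apparition:
  assumes q: "prime q" and qP: "\<not> q dvd P" and x: "x = of_int a + of_int b * sqrtm P"
    and N: "\<not> int q dvd a\<^sup>2 + int P * b\<^sup>2"
  shows "x ^ nat (int q - legendre0 (- int P) q) \<in> pairs_mod (int q)"
proof (cases "q = 2")
  case True
  have "x ^ 2 = of_int (a * a - int P * (b * b)) + of_int (a * b + b * a) * sqrtm P"
    unfolding x power2_eq_square by (rule pair_mult)
  moreover have "of_int (a * a - int P * (b * b)) + of_int (a * b + b * a) * sqrtm P \<in> pairs_mod 2"
    unfolding pairs_mod_iff by (simp add: mult.commute)
  ultimately have "x ^ 2 \<in> pairs_mod 2" by simp
  thus ?thesis using True by (simp add: legendre0_def)
next
  case False
  hence "odd q" using q prime_ge_2_nat[OF q] by (intro prime_odd_nat) auto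
  then obtain h where h: "q = 2 * h + 1" by (elim oddE)
  define L where "L = Legendre (- int P) (int q)"
  define M where "M = a\<^sup>2 + int P * b\<^sup>2"
  have x1: "x \<in> pairs_mod 1" unfolding x by (rule pairs_mod_1)
  have xc: "x * cnj x = of_int M" unfolding x M_def by (rule norm_pair)
  have copM: "coprime (int q) M" using N q unfolding M_def by (intro prime_imp_coprime) auto
  have cx: "cnj x = of_int a + of_int (- b) * sqrtm P" unfolding x by (simp add: cnj_sqrtm)
  have cx1: "cnj x \<in> pairs_mod 1" unfolding cx by (rule pairs_mod_1)
  obtain r where r: "r \<in> pairs_mod 1" "x ^ q = of_int a ^ q + (of_int b * sqrtm P) ^ q + of_int (int q) * r"
    using frobenius[OF q, of "of_int a" "of_int b * sqrtm P"] pairs_mod_int pairs_mod_1[of 0 b] unfolding x by auto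
  have sq: "sqrtm P ^ q = of_int ((- int P) ^ h) * sqrtm P"
    unfolding h power_add power_mult power2_eq_square sqrtm_square by simp
  have bs: "(of_int b * sqrtm P) ^ q = of_int (b ^ q * (- int P) ^ h) * sqrtm P"
    unfolding power_mult_distrib sq by simp
  have "[a ^ q = a] (mod int q)" by (rule int_fermat_legendre(2)[OF q h])
  then obtain i where i: "a ^ q = a + int q * i" by (metis cong_iff_lin cong_sym)
  have "[b ^ q * (- int P) ^ h = b * L] (mod int q)"
    unfolding L_def by (intro cong_mult int_fermat_legendre[OF q h])
  then obtain j where j: "b ^ q * (- int P) ^ h = b * L + int q * j" by (metis cong_iff_lin cong_sym)
  define y where "y = of_int i + of_int j * sqrtm P + r"
  have y1: "y \<in> pairs_mod 1" unfolding y_def by (rule pairs_mod_add[OF pairs_mod_1 r(1)])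
  have xq: "x ^ q = of_int a + of_int (b * L) * sqrtm P + of_int (int q) * y"
    unfolding r(2) bs j of_int_power[symmetric] i y_def by (simp add: algebra_simps)
  have "\<not> [- int P = 0] (mod int q)" using qP by (simp add: cong_iff_dvd_diff)
  hence L: "L = 1 \<or> L = -1" unfolding L_def Legendre_def by auto
  have l0: "legendre0 (- int P) q = L" using False by (simp add: legendre0_def L_def)
  show ?thesis
  proof (cases "L = 1")
    case True
    have "nat (int q - legendre0 (- int P) q) = q - 1" unfolding l0 True by simp
    moreover have "x ^ (q - 1) \<in> pairs_mod (int q)"
    proof (rule pairs_mod_cancel[OF _ pairs_mod_power[OF x1] copM])
      have "of_int M * x ^ (q - 1) = cnj x * x ^ q" unfolding xc[symmetric] h by simp
      also have "x ^ q = x + of_int (int q) * y" using xq unfolding True mult_1_right x[symmetric] .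
      also have "cnj x * (x + of_int (int q) * y) = of_int M + of_int (int q) * (cnj x * y)"
        unfolding xc[symmetric] by (simp add: algebra_simps)
      also have "\<dots> \<in> pairs_mod (int q)" by (intro pairs_mod_add pairs_mod_int times_pairs_mod pairs_mod_mult cx1 y1)
      finally show "of_int M * x ^ (q - 1) \<in> pairs_mod (int q)" .
    qed
    ultimately show ?thesis by simp
  next
    case False
    hence L1: "L = -1" using L by blast
    have "nat (int q - legendre0 (- int P) q) = Suc q" unfolding l0 L1 by simp
    moreover have "x ^ Suc q = of_int M + of_int (int q) * (x * y)"
    proof -
      have "x ^ q = cnj x + of_int (int q) * y" unfolding xq L1 cx by simp
      thus ?thesis unfolding xc[symmetric] by (simp add: algebra_simps)
    qed
    moreover have "of_int M + of_int (int q) * (x * y) \<in> pairs_mod (int q)"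
      by (intro pairs_mod_add pairs_mod_int times_pairs_mod pairs_mod_mult x1 y1)
    ultimately show ?thesis by simp
  qed
qed

text \<open>
  An integer of the field with odd norm and genuine half-integers as coefficients exists only for
  \<open>P\<close> congruent to \<open>3\<close> modulo \<open>8\<close>, and its cube has integral coefficients. This is the origin of
  the factor \<open>3 ^ u\<close>.
\<close>

lemma power_in_pairs_mod_1:
  assumes g: "\<gamma> = half_int P a b" "even a \<longleftrightarrow> even b" "odd a \<longrightarrow> P mod 4 = 3" "a\<^sup>2 + int P * b\<^sup>2 = 4 * N" "odd N"
    and P3: "P = 3 \<longrightarrow> \<gamma> \<in> pairs_mod 1"
  shows "\<gamma> ^ (3 ^ (if 3 < P \<and> [P = 3] (mod 8) then 1 else 0)) \<in> pairs_mod 1"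
proof (cases "even a")
  case True
  then obtain c e where "a = 2 * c" "b = 2 * e" using g(2) by (auto elim!: evenE)
  hence "\<gamma> \<in> pairs_mod 1" unfolding g(1) using half_int_even pairs_mod_1 by simp
  thus ?thesis by (rule pairs_mod_power)
next
  case False
  then obtain c where c: "a = 2 * c + 1" by (elim oddE)
  obtain e where e: "b = 2 * e + 1" using False g(2) by (metis oddE)
  have cc: "even (c * (c + 1))" "even (e * (e + 1))" by simp_all
  obtain c' where c': "c * (c + 1) = 2 * c'" using cc(1) by (rule evenE)
  obtain e' where e': "e * (e + 1) = 2 * e'" using cc(2) by (rule evenE)
  have a8: "a\<^sup>2 = 1 + 8 * c'"
  proof -
    have "a\<^sup>2 = 1 + 4 * (c * (c + 1))" by (simp add: c power2_eq_square algebra_simps)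
    thus ?thesis using c' by simp
  qed
  have b8: "b\<^sup>2 = 1 + 8 * e'"
  proof -
    have "b\<^sup>2 = 1 + 4 * (e * (e + 1))" by (simp add: e power2_eq_square algebra_simps)
    thus ?thesis using e' by simp
  qed
  obtain N' where N': "N = 2 * N' + 1" using g(5) by (elim oddE)
  have "1 + int P = 4 + 8 * (N' - c' - int P * e')"
    using g(4) unfolding a8 b8 N' by (simp add: algebra_simps)
  hence "int P = 3 + 8 * (N' - c' - int P * e')" by simp
  hence "int P mod 8 = 3" by presburger
  hence P8: "P mod 8 = 3" by presburger
  show ?thesis
  proof (cases "P = 3")
    case True
    thus ?thesis using P3 by simp
  next
    case False
    hence "3 < P" using P8 by presburger
    moreover have "[P = 3] (mod 8)" using P8 by (simp add: Cong.cong_def)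
    ultimately have e1: "3 ^ (if 3 < P \<and> [P = 3] (mod 8) then 1 else 0) = (3::nat)" by simp
    obtain f where "P = 3 + 8 * f" using P8 by (metis mod_mult_div_eq)
    hence f: "int P = 3 + 8 * int f" by simp
    have "8 * \<gamma> ^ 3 = (of_int a + of_int b * sqrtm P) ^ 3"
      unfolding g(1) half_int_def by (simp add: power_divide)
    also have "\<dots> = of_int (a * (a\<^sup>2 - 3 * int P * b\<^sup>2)) + of_int (b * (3 * a\<^sup>2 - int P * b\<^sup>2)) * sqrtm P"
    proof -
      have "qre a (int P * b\<^sup>2) 3 = a * (a\<^sup>2 - 3 * int P * b\<^sup>2)" "qim a (int P * b\<^sup>2) 3 = 3 * a\<^sup>2 - int P * b\<^sup>2"
        by (simp_all add: numeral_eq_Suc algebra_simps)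
      thus ?thesis unfolding pair_power by simp
    qed
    also have "a\<^sup>2 - 3 * int P * b\<^sup>2 = 8 * (c' - 9 * e' - 3 * int f * b\<^sup>2 - 1)"
      unfolding f a8 by (simp add: b8 algebra_simps)
    also have "3 * a\<^sup>2 - int P * b\<^sup>2 = 8 * (3 * c' - 3 * e' - int f * b\<^sup>2)"
      unfolding f a8 by (simp add: b8 algebra_simps)
    also have "of_int (a * (8 * (c' - 9 * e' - 3 * int f * b\<^sup>2 - 1))) + of_int (b * (8 * (3 * c' - 3 * e' - int f * b\<^sup>2))) * sqrtm P
      = 8 * (of_int (a * (c' - 9 * e' - 3 * int f * b\<^sup>2 - 1)) + of_int (b * (3 * c' - 3 * e' - int f * b\<^sup>2)) * sqrtm P)"
      by (simp only: of_int_mult of_int_numeral) (simp only: distrib_left mult_ac)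
    finally have "\<gamma> ^ 3 = of_int (a * (c' - 9 * e' - 3 * int f * b\<^sup>2 - 1)) + of_int (b * (3 * c' - 3 * e' - int f * b\<^sup>2)) * sqrtm P"
      by (rule mult_left_cancel[THEN iffD1, rotated]) (rule zero_neq_numeral[symmetric])
    thus ?thesis unfolding e1 using pairs_mod_1 by metis
  qed
qed

text \<open>
  Both \<open>\<gamma> ^ E\<close>, with \<open>E\<close> a multiple of all ranks of apparition, and \<open>\<gamma> ^ k = \<plusminus> z\<close> lie in the order
  of conductor \<open>Q\<close>, so the power with exponent \<open>gcd E k\<close> lies there too: the elements are
  invertible modulo \<open>2 * Q\<close>, as their norms are powers of \<open>p\<close>.
\<close>

lemma root_in_order:
  fixes Q :: nat
  assumes z: "z = of_int x + of_int D * sqrtm P" and nz: "z * cnj z = of_nat (p ^ m)"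
    and p: "prime p" "odd p" and cop: "\<not> int p dvd x" and m: "m > 0" and x: "odd x" and D: "odd P \<Longrightarrow> even D"
    and Q: "squarefree Q" "int Q dvd D" "coprime P Q" "\<not> p dvd Q"
  shows "\<exists>A B T s. T * s = m \<and> (2 * int T) dvd N_bound P Q \<and> int Q dvd B \<and>
     ((of_int A + of_int B * sqrtm P) ^ s = z \<or> (of_int A + of_int B * sqrtm P) ^ s = - z)"
proof -
  obtain \<gamma> d k where g: "\<gamma> \<in> carrier R" "d * k = m" "d dvd h_exp (- int P)" "\<gamma> ^ k = z \<or> \<gamma> ^ k = - z"
      "P = 3 \<longrightarrow> (\<exists>a b. \<gamma> = of_int a + of_int b * sqrtm P)"
    using root_up_to_sign[OF z nz p cop m x D] by blast
  have k0: "k > 0" using g(2) m by (cases k) auto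
  have gn: "\<gamma> ^ k * cnj (\<gamma> ^ k) = of_nat (p ^ m)"
    using g(4)
  proof
    assume h: "\<gamma> ^ k = z" show ?thesis unfolding h by (rule nz)
  next
    assume h: "\<gamma> ^ k = - z" show ?thesis unfolding h using nz by simp
  qed
  obtain a b where ab: "\<gamma> = half_int P a b" "4 dvd a\<^sup>2 + int P * b\<^sup>2" "even a \<longleftrightarrow> even b" "odd a \<longrightarrow> P mod 4 = 3"
    using g(1) by (rule OK_E)
  have odd_pm: "odd (p ^ m)" using p by simp
  obtain N where N: "a\<^sup>2 + int P * b\<^sup>2 = 4 * N" "odd N" using odd_norm_if_power[OF ab(1,2) gn odd_pm k0] .
  define u :: nat where "u = 3 ^ (if 3 < P \<and> [P = 3] (mod 8) then 1 else 0)"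
  define y where "y = \<gamma> ^ u"
  have "P = 3 \<longrightarrow> \<gamma> \<in> pairs_mod 1" using g(5) pairs_mod_1 by auto
  hence y1: "y \<in> pairs_mod 1" unfolding y_def u_def using power_in_pairs_mod_1[OF ab(1,3,4) N] by blast
  then obtain c e where ce: "y = of_int c + of_int e * sqrtm P" by (rule pairs_modE)
  define L :: int where "L = Lcm ((\<lambda>q. int q - legendre0 (- int P) q) ` prime_factors Q)"
  have L0: "L \<ge> 0" by (simp add: L_def)
  have bound: "N_bound P Q = 2 * (int u * int (h_exp (- int P)) * L)"
    unfolding N_bound_def u_def L_def by simp
  have yk: "y ^ k = z ^ u \<or> y ^ k = (- z) ^ u"
    unfolding y_def power_mult[symmetric] mult.commute[of u k] using g(4) by (auto simp: power_mult)
  have ynorm: "(c\<^sup>2 + int P * e\<^sup>2) ^ k = int p ^ (m * u)"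
  proof -
    have "(of_int (c\<^sup>2 + int P * e\<^sup>2) :: complex) ^ k = (y * cnj y) ^ k" unfolding ce norm_pair ..
    also have "\<dots> = y ^ k * cnj (y ^ k)" by (simp add: power_mult_distrib)
    also have "\<dots> = (z * cnj z) ^ u"
      using yk
    proof
      assume h: "y ^ k = z ^ u"
      show ?thesis unfolding h by (simp add: power_mult_distrib)
    next
      assume h: "y ^ k = (- z) ^ u"
      have "(- z) ^ u * cnj ((- z) ^ u) = ((- z) * cnj (- z)) ^ u" unfolding power_mult_distrib complex_cnj_power ..
      thus ?thesis unfolding h by simp
    qed
    also have "\<dots> = of_int (int p ^ (m * u))" unfolding nz by (simp add: power_mult)
    finally have "(of_int ((c\<^sup>2 + int P * e\<^sup>2) ^ k) :: complex) = of_int (int p ^ (m * u))" by simp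
    thus ?thesis by (simp only: of_int_eq_iff)
  qed
  have yL: "y ^ nat L \<in> pairs_mod (int q)" if q: "prime q" "q dvd Q" for q
  proof -
    have "\<not> q dvd P" using Q(3) q by (metis coprime_common_divisor_nat nat_dvd_1_iff_1 not_prime_1)
    moreover have "\<not> int q dvd c\<^sup>2 + int P * e\<^sup>2"
    proof
      assume "int q dvd c\<^sup>2 + int P * e\<^sup>2"
      hence "int q dvd (c\<^sup>2 + int P * e\<^sup>2) ^ k" using k0 by (meson dvd_power dvd_trans)
      hence "int q = int p" unfolding ynorm using p(1) q(1) by (intro prime_power_dvd_cases) auto
      thus False using q Q(4) by simp
    qed
    ultimately have yr: "y ^ nat (int q - legendre0 (- int P) q) \<in> pairs_mod (int q)"
      using rank_of_apparition[OF q(1) _ ce] by blast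
    have "Q \<noteq> 0" using Q(1) by (metis not_squarefree_0)
    hence "q \<in> prime_factors Q" using q by (simp add: in_prime_factors_iff)
    hence "int q - legendre0 (- int P) q dvd L" unfolding L_def by (intro dvd_Lcm) auto
    moreover have "int q - legendre0 (- int P) q \<ge> 0"
      using prime_ge_2_nat[OF q(1)] by (auto simp: legendre0_def Legendre_def)
    ultimately have "nat (int q - legendre0 (- int P) q) dvd nat L" using L0 by (simp add: nat_dvd_iff)
    then obtain i where "nat L = nat (int q - legendre0 (- int P) q) * i" by (elim dvdE)
    thus ?thesis using pairs_mod_power[OF yr, of i] by (simp add: power_mult)
  qed
  have yLQ: "y ^ nat L \<in> pairs_mod (int Q)"
  proof -
    obtain c' e' where ce': "y ^ nat L = of_int c' + of_int e' * sqrtm P" using pairs_mod_power[OF y1] by (rule pairs_modE)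
    have "int Q dvd e'"
      by (rule squarefree_dvd_if_primes_dvd[OF Q(1)]) (use yL in \<open>simp add: ce' pairs_mod_iff\<close>)
    thus ?thesis unfolding ce' pairs_mod_iff .
  qed
  define E where "E = u * nat L"
  have gE: "\<gamma> ^ E \<in> pairs_mod (int Q)" using yLQ by (simp add: E_def y_def power_mult)
  have gk: "\<gamma> ^ k \<in> pairs_mod (int Q)"
  proof -
    have "z \<in> pairs_mod (int Q)" unfolding z pairs_mod_iff by (rule Q(2))
    thus ?thesis using g(4) pairs_mod_minus by auto
  qed
  define d' where "d' = gcd E k"
  have "\<exists>\<beta>. \<gamma> ^ d' = \<beta> \<and> \<beta> \<in> pairs_mod (int Q)"
  proof (cases "E = 0")
    case True
    hence "d' = k" by (simp add: d'_def)
    thus ?thesis using gk by blast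
  next
    case False
    obtain i j where ij: "E * i = k * j + d'" using bezout_nat[OF False, of k] unfolding d'_def by blast
    have "\<gamma> ^ d' * of_nat (p ^ m) ^ j = \<gamma> ^ d' * (\<gamma> ^ k * cnj (\<gamma> ^ k)) ^ j" unfolding gn ..
    also have "\<dots> = (\<gamma> ^ k) ^ j * \<gamma> ^ d' * cnj (\<gamma> ^ k) ^ j"
      unfolding power_mult_distrib by (simp only: mult_ac)
    also have "(\<gamma> ^ k) ^ j * \<gamma> ^ d' = \<gamma> ^ (k * j + d')" unfolding power_add power_mult ..
    also have "\<gamma> ^ (k * j + d') = (\<gamma> ^ E) ^ i" unfolding ij[symmetric] power_mult ..
    also have "(\<gamma> ^ E) ^ i * cnj (\<gamma> ^ k) ^ j \<in> pairs_mod (int Q)"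
    proof (rule pairs_mod_mult[OF pairs_mod_power[OF gE] pairs_mod_power])
      obtain c' e' where ce': "\<gamma> ^ k = of_int c' + of_int e' * sqrtm P" "int Q dvd e'" using gk by (rule pairs_modE)
      have e: "cnj (\<gamma> ^ k) = of_int c' + of_int (- e') * sqrtm P" unfolding ce' by (simp add: cnj_sqrtm)
      show "cnj (\<gamma> ^ k) \<in> pairs_mod (int Q)" unfolding e pairs_mod_iff using ce'(2) by simp
    qed
    finally have "\<gamma> ^ d' * of_nat (p ^ m) ^ j \<in> pairs_mod (int Q)" .
    then obtain c' e' where ce': "\<gamma> ^ d' * of_nat (p ^ m) ^ j = of_int c' + of_int e' * sqrtm P" "int Q dvd e'" by (rule pairs_modE)
    have "\<gamma> ^ d' \<in> carrier R" using g(1) by simp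
    then obtain f h where fh: "\<gamma> ^ d' = half_int P f h" by (rule OK_E)
    define W where "W = int ((p ^ m) ^ j)"
    have W: "odd W" "coprime W (int Q)"
    proof -
      show "odd W" unfolding W_def using p by simp
      have "coprime p Q" using p(1) Q(4) by (simp add: prime_imp_coprime)
      thus "coprime W (int Q)" unfolding W_def by simp
    qed
    have "half_int P (W * f) (W * h) = half_int P (2 * c') (2 * e')"
    proof -
      have "half_int P (W * f) (W * h) = \<gamma> ^ d' * of_nat (p ^ m) ^ j"
        unfolding fh W_def half_int_def by (simp add: field_simps)
      thus ?thesis unfolding ce' half_int_even .
    qed
    hence WW: "W * f = 2 * c'" "W * h = 2 * e'" using half_int_eq_iff[OF P0] by blast+
    hence "even f" "even h" using W(1) by (metis dvd_triv_left even_mult_iff)+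
    then obtain f' h' where f'h': "f = 2 * f'" "h = 2 * h'" by (auto elim!: evenE)
    have "\<gamma> ^ d' = of_int f' + of_int h' * sqrtm P" unfolding fh f'h' half_int_even ..
    moreover have "int Q dvd h'"
    proof -
      have "W * h' = e'" using WW(2) f'h'(2) by simp
      hence "int Q dvd W * h'" using ce'(2) by simp
      thus ?thesis using W(2) by (simp add: coprime_dvd_mult_right_iff coprime_commute)
    qed
    ultimately show ?thesis using pairs_mod_iff by simp
  qed
  then obtain A B where AB: "\<gamma> ^ d' = of_int A + of_int B * sqrtm P" "int Q dvd B" by (metis pairs_modE)
  obtain s where s: "k = d' * s" unfolding d'_def by (metis gcd_dvd2 dvd_def)
  have "(of_int A + of_int B * sqrtm P) ^ s = \<gamma> ^ k" unfolding AB(1)[symmetric] s power_mult ..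
  hence 1: "(of_int A + of_int B * sqrtm P) ^ s = z \<or> (of_int A + of_int B * sqrtm P) ^ s = - z" using g(4) by simp
  have "d * d' dvd h_exp (- int P) * E" using g(3) by (intro mult_dvd_mono) (auto simp: d'_def)
  hence "int (d * d') dvd int (h_exp (- int P) * E)" by (simp only: of_nat_dvd_iff)
  also have "int (h_exp (- int P) * E) = int u * int (h_exp (- int P)) * L" using L0 by (simp add: E_def)
  finally have 2: "2 * int (d * d') dvd N_bound P Q" unfolding bound by (intro mult_dvd_mono) auto
  have 3: "(d * d') * s = m" using g(2) s by simp
  show ?thesis using 1 2 3 AB(2) by blast
qed

end

section \<open>The equation\<close>

lemma sqrt_quotient_int:
  fixes C P :: nat
  assumes "sqrt (real C / real P) \<in> \<int>" "P > 0"
  obtains D :: nat where "C = P * D\<^sup>2"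
proof -
  obtain d where d: "sqrt (real C / real P) = of_int d" using assms(1) by (elim Ints_cases)
  have "real C / real P = (sqrt (real C / real P))\<^sup>2" by simp
  hence "real C = real P * (of_int d)\<^sup>2" unfolding d using assms(2) by (simp add: field_simps)
  hence "of_int (int C) = (of_int (int P * d\<^sup>2) :: real)" by simp
  hence "int C = int P * d\<^sup>2" by (simp only: of_int_eq_iff)
  also have "\<dots> = int (P * (nat \<bar>d\<bar>)\<^sup>2)" by simp
  finally have "C = P * (nat \<bar>d\<bar>)\<^sup>2" by (simp only: of_nat_eq_iff)
  thus ?thesis by (rule that)
qed

text \<open>
  The largest squarefree divisor is the product of all prime divisors: a missing prime could be
  multiplied to it.
\<close>

lemma largest_squarefree_divisor:
  fixes C S :: nat
  assumes C: "C > 0" and S: "S = Max {d. squarefree d \<and> d dvd C}"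
  shows "squarefree S" "S dvd C" "\<And>q. prime q \<Longrightarrow> q dvd C \<Longrightarrow> q dvd S"
proof -
  have fin: "finite {d. squarefree d \<and> d dvd C}" using C by auto
  have "1 \<in> {d. squarefree d \<and> d dvd C}" by simp
  hence "{d. squarefree d \<and> d dvd C} \<noteq> {}" by blast
  hence "S \<in> {d. squarefree d \<and> d dvd C}" unfolding S using fin by (intro Max_in)
  thus sq: "squarefree S" and dv: "S dvd C" by auto
  fix q assume q: "prime q" "q dvd C"
  show "q dvd S"
  proof (rule ccontr)
    assume n: "\<not> q dvd S"
    hence cop: "coprime q S" using q by (simp add: prime_imp_coprime)
    have "squarefree (q * S)" using cop sq q(1) by (simp add: squarefree_mult_coprime squarefree_prime)
    moreover have "q * S dvd C" using cop q(2) dv by (intro divides_mult)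
    ultimately have "q * S \<le> S" unfolding S using fin by (intro Max_ge) auto
    moreover have "S > 0" using sq by (metis gr0I not_squarefree_0)
    ultimately show False using prime_gt_1_nat[OF q(1)] by simp
  qed
qed

lemma at_most_one_prime:
  fixes x :: int
  assumes "x \<noteq> 0" "card {p. prime p \<and> p dvd x} \<le> 1" "prime q" "prime q'" "q dvd x" "q' dvd x"
  shows "q = q'"
proof -
  have "finite {p. prime p \<and> p dvd x}" using assms(1) by (rule finite_prime_divisors)
  thus ?thesis using assms(2-6) card_le_Suc0_iff_eq[of "{p. prime p \<and> p dvd x}"] by auto
qed

lemma abs_prime_power_if_at_most_one_prime:
  fixes y :: int
  assumes "\<bar>y\<bar> > 1" "card {p. prime p \<and> p dvd y} \<le> 1"
  obtains p k where "prime p" "\<bar>y\<bar> = int p ^ k" "k > 0"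
proof -
  have y0: "y \<noteq> 0" using assms(1) by auto
  obtain q where q: "prime q" "q dvd y" using prime_factor_int[of y] assms(1) by auto
  have qn: "q = int (nat q)" using q(1) prime_ge_0_int by simp
  have pn: "prime (nat q)" using q(1) by simp
  have "\<exists>k. \<bar>y\<bar> = int (nat q) ^ k"
  proof (rule eq_prime_power_if_only_prime_factor)
    show "\<bar>y\<bar> > 0" using y0 by simp
    fix r :: int assume "prime r" "r dvd \<bar>y\<bar>"
    hence "r = q" using at_most_one_prime[OF y0 assms(2) _ q(1) _ q(2)] by simp
    thus "r = int (nat q)" using qn by simp
  qed
  then obtain k where k: "\<bar>y\<bar> = int (nat q) ^ k" by blast
  have "k > 0" using k assms(1) by (cases k) auto
  thus ?thesis using that[OF pn k] by blast
qed

theorem theorem4: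
  fixes C P Q n :: nat and x y :: int
  assumes "even C" and "C > 0"
    and "P * Q = Max {d. squarefree d \<and> d dvd C}"
    and "sqrt (real C / real P) \<in> \<int>"
    and "x\<^sup>2 + int C = y ^ n"
    and "x \<noteq> 0" and "y \<noteq> 0"
    and "card {p. prime p \<and> p dvd x} \<le> 1"
    and "card {p. prime p \<and> p dvd y} \<le> 1"
    and "gcd x y = 1"
    and "n > 0"
    and "(\<bar>x\<bar>, \<bar>y\<bar>, n) \<noteq> (7, 3, 4)"
    and "(\<bar>x\<bar>, \<bar>y\<bar>, n) \<noteq> (401, 11, 5)"
  shows "n = 3 \<or> int n dvd N_bound P Q"
proof -
  note S = largest_squarefree_divisor[OF assms(2,3)]
  have P: "P > 0" and Q: "Q > 0" using S(1) by (metis gr0I mult_0 mult_0_right not_squarefree_0)+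
  have sfP: "squarefree P" and sfQ: "squarefree Q" using squarefree_multD[OF S(1)] by auto
  have copPQ: "coprime P Q"
  proof (rule coprimeI)
    fix c assume "c dvd P" "c dvd Q"
    hence "c\<^sup>2 dvd P * Q" unfolding power2_eq_square by (rule mult_dvd_mono)
    thus "is_unit c" using S(1) squarefreeD by blast
  qed
  obtain D :: nat where D: "C = P * D\<^sup>2" using sqrt_quotient_int[OF assms(4) P] .
  have QD: "int Q dvd int D"
  proof (rule squarefree_dvd_if_primes_dvd[OF sfQ])
    fix q assume q: "prime q" "q dvd Q"
    hence "q dvd P * D\<^sup>2" using S(2) unfolding D by (meson dvd_mult_right dvd_trans dvd_mult)
    moreover have "\<not> q dvd P" using q copPQ by (metis coprime_common_divisor_nat not_prime_1)
    ultimately have "q dvd D" using q(1) by (metis prime_dvd_mult_iff prime_dvd_power)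
    thus "int q dvd int D" by simp
  qed
  have y_abs: "y ^ n = \<bar>y\<bar> ^ n"
  proof -
    have "y ^ n > 0" unfolding assms(5)[symmetric] using assms(2) by (simp add: add_nonneg_pos)
    thus ?thesis by (metis abs_of_pos power_abs)
  qed
  have y1: "\<bar>y\<bar> > 1"
  proof (rule ccontr)
    assume "\<not> ?thesis"
    hence "\<bar>y\<bar> = 1" using assms(7) by linarith
    hence "x\<^sup>2 + int C = 1" using assms(5) y_abs by simp
    moreover have "x\<^sup>2 > 0" using assms(6) by simp
    ultimately show False using assms(2) by linarith
  qed
  obtain p k where pk: "prime p" "\<bar>y\<bar> = int p ^ k" "k > 0"
    using abs_prime_power_if_at_most_one_prime[OF y1 assms(9)] .
  define m where "m = k * n"
  have m: "m > 0" using pk(3) assms(11) by (simp add: m_def)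
  have eq: "x\<^sup>2 + int C = int p ^ m" using assms(5) y_abs pk(2) by (simp add: m_def power_mult)
  have pp: "prime (int p)" using pk(1) by simp
  have py: "int p dvd y" using pk(2,3) by (metis dvd_abs_iff dvd_power)
  have px: "\<not> int p dvd x"
  proof
    assume "int p dvd x"
    hence "int p dvd gcd x y" using py by simp
    thus False using assms(10) pp by (metis not_prime_unit)
  qed
  have pC: "\<not> p dvd C"
  proof
    assume "p dvd C"
    moreover have "int p dvd x\<^sup>2 + int C" unfolding eq using m by simp
    ultimately have "int p dvd x\<^sup>2" by (metis dvd_add_left_iff int_dvd_int_iff)
    hence "int p dvd x" using pp prime_dvd_power by blast
    thus False using px by simp
  qed
  have p_odd: "odd p"
  proof
    assume "even p"
    hence "p = 2" using pk(1) primes_dvd_imp_eq[of 2 p] by auto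
    thus False using pC assms(1) by simp
  qed
  have x_odd: "odd x"
  proof
    assume "even x"
    hence "even (x\<^sup>2 + int C)" using assms(1) by simp
    thus False unfolding eq using p_odd by simp
  qed
  have two: "2 dvd P * Q" using S(3)[of 2] assms(1) by simp
  have D_even: "even (int D)" if "odd P"
  proof -
    have "2 dvd Q" using two that by auto
    hence "2 dvd int Q" by simp
    thus ?thesis using QD dvd_trans by blast
  qed
  interpret imag_quad P using sfP P by unfold_locales
  define z where "z = of_int x + of_int (int D) * sqrtm P"
  have nz: "z * cnj z = of_nat (p ^ m)"
  proof -
    have "z * cnj z = of_int (x\<^sup>2 + int P * (int D)\<^sup>2)" unfolding z_def by (rule norm_pair)
    also have "x\<^sup>2 + int P * (int D)\<^sup>2 = int (p ^ m)" using eq D by simp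
    finally show ?thesis by simp
  qed
  have pQ: "\<not> p dvd Q"
  proof
    assume "p dvd Q"
    hence "p dvd C" using S(2) by (meson dvd_mult dvd_trans)
    thus False using pC by simp
  qed
  obtain A B T s where AB: "T * s = m" "2 * int T dvd N_bound P Q" "int Q dvd B"
     "(of_int A + of_int B * sqrtm P) ^ s = z \<or> (of_int A + of_int B * sqrtm P) ^ s = - z"
    using root_in_order[OF z_def nz pk(1) p_odd px m x_odd D_even sfQ QD copPQ pQ] by blast
  have T: "T > 0" and s: "s > 0" using AB(1) m by auto
  define w where "w = int P * B\<^sup>2"
  have X: "qre A w s = x \<and> B * qim A w s = int D \<or> qre A w s = - x \<and> B * qim A w s = - int D"
  proof -
    have "- z = of_int (- x) + of_int (- int D) * sqrtm P" by (simp add: z_def)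
    thus ?thesis using AB(4) unfolding pair_power w_def[symmetric] z_def by (metis pair_eq_iff)
  qed
  have D0: "int D \<noteq> 0" using D assms(2) by auto
  have B0: "B \<noteq> 0" and U0: "qim A w s \<noteq> 0" using X D0 by auto
  have w_even: "even w"
  proof (cases "even P")
    case False
    hence "2 dvd Q" using two by auto
    hence "2 dvd int Q" by simp
    hence "2 dvd B" using AB(3) dvd_trans by blast
    thus ?thesis by (simp add: w_def)
  qed (simp add: w_def)
  have w_pos: "w > 0" using B0 P by (simp add: w_def)
  have N: "A\<^sup>2 + w = int p ^ T"
  proof -
    have "(A\<^sup>2 + w) ^ s = (qre A w s)\<^sup>2 + w * (qim A w s)\<^sup>2" by (rule qre_qim_norm[symmetric])
    also have "w * (qim A w s)\<^sup>2 = int P * (B * qim A w s)\<^sup>2" by (simp add: w_def power_mult_distrib)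
    also have "(qre A w s)\<^sup>2 + int P * (B * qim A w s)\<^sup>2 = x\<^sup>2 + int P * (int D)\<^sup>2" using X by auto
    also have "\<dots> = (int p ^ T) ^ s" using eq D AB(1) by (simp add: power_mult[symmetric])
    finally show ?thesis using w_pos s by (intro power_eq_imp_eq_base[of "A\<^sup>2 + w" s]) auto
  qed
  have U: "q dvd w" if q: "prime q" "q dvd qim A w s" for q :: int
  proof -
    have qn: "q = int (nat q)" "prime (nat q)" using q(1) prime_ge_0_int by simp_all
    have "q dvd B * qim A w s" using q(2) by simp
    hence "q dvd int D" using X by (metis dvd_minus_iff)
    hence "nat q dvd D" using qn(1) by (metis int_dvd_int_iff)
    hence "nat q dvd C" unfolding D by (simp add: power2_eq_square)
    hence "nat q dvd P * Q" using S(3) qn(2) by blast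
    hence "nat q dvd P \<or> nat q dvd Q" using qn(2) by (simp add: prime_dvd_mult_iff)
    hence "q dvd int P \<or> q dvd int Q" using qn(1) by (metis int_dvd_int_iff)
    thus ?thesis
    proof
      assume "q dvd int P" thus ?thesis by (simp add: w_def)
    next
      assume "q dvd int Q"
      hence "q dvd B" using AB(3) dvd_trans by blast
      thus ?thesis by (simp add: w_def power2_eq_square)
    qed
  qed
  have absX: "\<bar>qre A w s\<bar> = \<bar>x\<bar>" using X by auto
  have dvdX: "q dvd qre A w s \<longleftrightarrow> q dvd x" for q using absX by (metis dvd_abs_iff)
  have "s dvd 2 \<or> T * s = 3 \<or> (T * s = 4 \<and> p = 3 \<and> \<bar>qre A w s\<bar> = 7) \<or>
         (T * s = 5 \<and> p = 11 \<and> \<bar>qre A w s\<bar> = 401)"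
  proof (rule exponent_bound[OF pk(1) w_even w_pos N T s U U0])
    show "\<not> int p dvd qre A w s" using px dvdX by simp
    show "q = q'" if "prime q" "prime q'" "q dvd qre A w s" "q' dvd qre A w s" for q q'
      using at_most_one_prime[OF assms(6,8) that(1,2)] that(3,4) dvdX by simp
  qed
  hence cases: "s dvd 2 \<or> m = 3 \<or> (m = 4 \<and> p = 3 \<and> \<bar>x\<bar> = 7) \<or> (m = 5 \<and> p = 11 \<and> \<bar>x\<bar> = 401)"
    unfolding AB(1) absX .
  have N2: "2 dvd N_bound P Q" using AB(2) by (rule dvd_mult_left)
  have nm: "n dvd m" by (simp add: m_def)
  have k1: "k = 1" if "n = m"
    using that m by (simp add: m_def)
  show ?thesis
    using cases
  proof (elim disjE conjE)
    assume "s dvd 2"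
    hence "int s dvd 2" by presburger
    hence "int (T * s) dvd 2 * int T" by (simp add: mult.commute)
    hence "int m dvd N_bound P Q" unfolding AB(1) using AB(2) by (rule dvd_trans)
    thus ?thesis using nm by (meson dvd_trans int_dvd_int_iff)
  next
    assume "m = 3"
    moreover have "prime (3::nat)" by simp
    ultimately have "n = 1 \<or> n = 3" using nm by (metis prime_nat_iff)
    thus ?thesis by auto
  next
    assume a: "m = 4" "p = 3" "\<bar>x\<bar> = 7"
    have "n \<noteq> 4"
    proof
      assume "n = 4"
      hence "\<bar>y\<bar> = 3" using a k1 pk(2) by simp
      thus False using assms(12) a \<open>n = 4\<close> by simp
    qed
    moreover have "n \<le> 4" using nm a(1) by (intro dvd_imp_le) auto
    moreover have "n \<noteq> 3" using nm a(1) by auto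
    ultimately have "n = 1 \<or> n = 2" using assms(11) by linarith
    thus ?thesis using N2 by auto
  next
    assume a: "m = 5" "p = 11" "\<bar>x\<bar> = 401"
    have "n \<noteq> 5"
    proof
      assume "n = 5"
      hence "\<bar>y\<bar> = 11" using a k1 pk(2) by simp
      thus False using assms(13) a \<open>n = 5\<close> by simp
    qed
    moreover have "prime (5::nat)" by simp
    ultimately have "n = 1" using nm a(1) by (metis prime_nat_iff)
    thus ?thesis by simp
  qed
qed

end
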